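(* Let $b$ be a constant. For instances of the line planning on all lines problem (LPAL) whose graph $T$ is a tree with $n$ vertices, with $d_{\mathrm{fix}}=0$ and $f^{\max}_e\le b$ for all edges $e$, the minimal cost of a feasible line concept can be computed in $\mathcal{O}(nb^3)$ time, and an optimal line concept can be computed in $\mathcal{O}(n^3b^3)$ time.
   Context: A line planning instance is a tuple $(G,d_{\mathrm{fix}},c_{\mathrm{fix}},c,f^{\min},f^{\max})$ where $G=(V,E)$ is a finite simple graph, $d_{\mathrm{fix}}\ge 0$ and $c_{\mathrm{fix}}\ge 0$ are reals, $c:E\to\mathbb{R}_{\ge 0}$ gives edge costs $c_e$, and $f^{\min},f^{\max}$ assign to each edge integer bounds $f^{\min}_e\le f^{\max}_e$. A line is a simple path in $G$; a line concept $(\mathcal{L},f)$ is a set $\mathcal{L}$ of lines with frequencies $f_\ell\in\mathbb{N}$. It is feasible if for every edge $e$, $f^{\min}_e\le\sum_{\ell\in\mathcal{L}:e\in E(\ell)}f_\ell\le f^{\max}_e$. Its cost is $d_{\mathrm{fix}}|\mathcal{L}|+\sum_{\ell\in\mathcal{L}}f_\ell\,(c_{\mathrm{fix}}+\sum_{e\in E(\ell)}c_e)$. LPAL asks for a feasible line concept of minimum cost. *)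

theory Defs
  imports Complex_Main
begin

section \<open>Line planning on all lines\<close>

record 'v lp_instance =
  verts :: "'v set"
  edges :: "'v set set"
  dfix :: real
  cfix :: real
  ecost :: "'v set \<Rightarrow> real"
  fmin :: "'v set \<Rightarrow> int"
  fmax :: "'v set \<Rightarrow> int"

definition lp_instance_wf :: "'v lp_instance \<Rightarrow> bool" where
  "lp_instance_wf I \<longleftrightarrow>
     finite (verts I) \<and>
     (\<forall>e\<in>edges I. e \<subseteq> verts I \<and> card e = 2) \<and>
     dfix I \<ge> 0 \<and> cfix I \<ge> 0 \<and>
     (\<forall>e\<in>edges I. ecost I e \<ge> 0 \<and> fmin I e \<le> fmax I e)"

definition path_edges :: "'v list \<Rightarrow> 'v set set" where
  "path_edges p = {{p ! i, p ! Suc i} | i. Suc i < length p}"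

definition simple_path :: "'v lp_instance \<Rightarrow> 'v list \<Rightarrow> bool" where
  "simple_path I p \<longleftrightarrow>
     p \<noteq> [] \<and> distinct p \<and> set p \<subseteq> verts I \<and> path_edges p \<subseteq> edges I"

definition tree :: "'v lp_instance \<Rightarrow> bool" where
  "tree I \<longleftrightarrow>
     verts I \<noteq> {} \<and>
     (\<forall>u\<in>verts I. \<forall>v\<in>verts I. \<exists>p. simple_path I p \<and> hd p = u \<and> last p = v) \<and>
     \<not> (\<exists>p. simple_path I p \<and> length p \<ge> 3 \<and> {last p, hd p} \<in> edges I)"

text \<open>
  A line is a path regarded as a subgraph (vertex set, edge set), so that a vertex sequence
  and its reversal are the same line and are counted once.
\<close>

type_synonym 'v line = "'v set \<times> 'v set set"

definition path_line :: "'v list \<Rightarrow> 'v line" where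
  "path_line p = (set p, path_edges p)"

abbreviation line_edges :: "'v line \<Rightarrow> 'v set set" where
  "line_edges \<equiv> snd"

definition lines :: "'v lp_instance \<Rightarrow> 'v line set" where
  "lines I = path_line ` {p. simple_path I p}"

definition feasible :: "'v lp_instance \<Rightarrow> 'v line set \<Rightarrow> ('v line \<Rightarrow> nat) \<Rightarrow> bool" where
  "feasible I L f \<longleftrightarrow>
     L \<subseteq> lines I \<and>
     (\<forall>e\<in>edges I.
        fmin I e \<le> (\<Sum>l | l \<in> L \<and> e \<in> line_edges l. int (f l)) \<and>
        (\<Sum>l | l \<in> L \<and> e \<in> line_edges l. int (f l)) \<le> fmax I e)"

definition concept_cost :: "'v lp_instance \<Rightarrow> 'v line set \<Rightarrow> ('v line \<Rightarrow> nat) \<Rightarrow> real" where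
  "concept_cost I L f =
     dfix I * real (card L) +
     (\<Sum>l\<in>L. real (f l) * (cfix I + (\<Sum>e\<in>line_edges l. ecost I e)))"

definition optimal :: "'v lp_instance \<Rightarrow> 'v line set \<Rightarrow> ('v line \<Rightarrow> nat) \<Rightarrow> bool" where
  "optimal I L f \<longleftrightarrow>
     feasible I L f \<and>
     (\<forall>L' f'. feasible I L' f' \<longrightarrow> concept_cost I L f \<le> concept_cost I L' f')"


section \<open>Machine model: structured programs on a real RAM\<close>

text \<open>
  The memory consists of named integer arrays and named real arrays; a program mentions only
  finitely many names, and scalars are cells at index 0. Every operator, memory access and
  control step has unit cost. Integers can only be added, subtracted and compared, so that
  unit cost cannot be abused to pack large data structures into one cell. The only real
  literals are images of integers, so that a program contains no non-computable constants.
\<close>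

record state =
  ints :: "string \<Rightarrow> int \<Rightarrow> int"
  reals :: "string \<Rightarrow> int \<Rightarrow> real"

datatype iexp =
    Const int
  | IRead string iexp
  | IAdd iexp iexp
  | ISub iexp iexp

datatype rexp =
    OfInt iexp
  | RRead string iexp
  | RAdd rexp rexp
  | RSub rexp rexp
  | RMul rexp rexp

datatype bexp =
    ILess iexp iexp
  | RLess rexp rexp
  | Not bexp
  | And bexp bexp

primrec ival :: "iexp \<Rightarrow> state \<Rightarrow> int" where
  "ival (Const k) s = k"
| "ival (IRead a i) s = ints s a (ival i s)"
| "ival (IAdd x y) s = ival x s + ival y s"
| "ival (ISub x y) s = ival x s - ival y s"

primrec rval :: "rexp \<Rightarrow> state \<Rightarrow> real" where
  "rval (OfInt i) s = real_of_int (ival i s)"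
| "rval (RRead a i) s = reals s a (ival i s)"
| "rval (RAdd x y) s = rval x s + rval y s"
| "rval (RSub x y) s = rval x s - rval y s"
| "rval (RMul x y) s = rval x s * rval y s"

primrec bval :: "bexp \<Rightarrow> state \<Rightarrow> bool" where
  "bval (ILess x y) s \<longleftrightarrow> ival x s < ival y s"
| "bval (RLess x y) s \<longleftrightarrow> rval x s < rval y s"
| "bval (Not p) s \<longleftrightarrow> \<not> bval p s"
| "bval (And p q) s \<longleftrightarrow> bval p s \<and> bval q s"

primrec itime :: "iexp \<Rightarrow> nat" where
  "itime (Const k) = 1"
| "itime (IRead a i) = 1 + itime i"
| "itime (IAdd x y) = 1 + itime x + itime y"
| "itime (ISub x y) = 1 + itime x + itime y"

primrec rtime :: "rexp \<Rightarrow> nat" where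
  "rtime (OfInt i) = 1 + itime i"
| "rtime (RRead a i) = 1 + itime i"
| "rtime (RAdd x y) = 1 + rtime x + rtime y"
| "rtime (RSub x y) = 1 + rtime x + rtime y"
| "rtime (RMul x y) = 1 + rtime x + rtime y"

primrec btime :: "bexp \<Rightarrow> nat" where
  "btime (ILess x y) = 1 + itime x + itime y"
| "btime (RLess x y) = 1 + rtime x + rtime y"
| "btime (Not p) = 1 + btime p"
| "btime (And p q) = 1 + btime p + btime q"

datatype com =
    Skip
  | IWrite string iexp iexp
  | RWrite string iexp rexp
  | Seq com com
  | If bexp com com
  | While bexp com

definition iupdate :: "state \<Rightarrow> string \<Rightarrow> int \<Rightarrow> int \<Rightarrow> state" where
  "iupdate s a i x = s\<lparr>ints := (ints s)(a := (ints s a)(i := x))\<rparr>"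

definition rupdate :: "state \<Rightarrow> string \<Rightarrow> int \<Rightarrow> real \<Rightarrow> state" where
  "rupdate s a i x = s\<lparr>reals := (reals s)(a := (reals s a)(i := x))\<rparr>"

text \<open>\<open>runs P s t s'\<close>: started in \<open>s\<close>, program \<open>P\<close> halts in \<open>s'\<close> after exactly \<open>t\<close> steps.\<close>

inductive runs :: "com \<Rightarrow> state \<Rightarrow> nat \<Rightarrow> state \<Rightarrow> bool" where
  Skip: "runs Skip s 1 s"
| IWrite: "runs (IWrite a i x) s (1 + itime i + itime x) (iupdate s a (ival i s) (ival x s))"
| RWrite: "runs (RWrite a i x) s (1 + itime i + rtime x) (rupdate s a (ival i s) (rval x s))"
| Seq: "runs P s t s' \<Longrightarrow> runs Q s' t' s'' \<Longrightarrow> runs (Seq P Q) s (t + t') s''"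
| IfTrue: "bval g s \<Longrightarrow> runs P s t s' \<Longrightarrow> runs (If g P Q) s (1 + btime g + t) s'"
| IfFalse: "\<not> bval g s \<Longrightarrow> runs Q s t s' \<Longrightarrow> runs (If g P Q) s (1 + btime g + t) s'"
| WhileFalse: "\<not> bval g s \<Longrightarrow> runs (While g P) s (1 + btime g) s"
| WhileTrue: "bval g s \<Longrightarrow> runs P s t s' \<Longrightarrow> runs (While g P) s' t' s'' \<Longrightarrow>
    runs (While g P) s (1 + btime g + t + t') s''"

inductive_cases SkipE: "runs Skip s t s'"
inductive_cases IWriteE: "runs (IWrite a i x) s t s'"
inductive_cases RWriteE: "runs (RWrite a i x) s t s'"
inductive_cases SeqE: "runs (Seq P Q) s t s'"
inductive_cases IfE: "runs (If g P Q) s t s'"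
inductive_cases WhileE: "runs (While g P) s t s'"

lemma runs_deterministic:
  "runs P s t s' \<Longrightarrow> runs P s u s'' \<Longrightarrow> u = t \<and> s'' = s'"
proof (induction arbitrary: u s'' rule: runs.induct)
  case (Skip s)
  then show ?case by (rule SkipE) simp
next
  case (IWrite a i x s)
  then show ?case by (rule IWriteE) simp
next
  case (RWrite a i x s)
  then show ?case by (rule RWriteE) simp
next
  case (Seq P s t s' Q t' s2)
  from Seq.prems obtain v v' r where "u = v + v'" "runs P s v r" "runs Q r v' s''"
    by (rule SeqE)
  with Seq.IH show ?case by metis
next
  case (IfTrue g s P t s' Q)
  from IfTrue.prems IfTrue.hyps obtain v where "u = 1 + btime g + v" "runs P s v s''"
    by (auto elim: IfE)
  with IfTrue.IH show ?case by simp
next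
  case (IfFalse g s Q t s' P)
  from IfFalse.prems IfFalse.hyps obtain v where "u = 1 + btime g + v" "runs Q s v s''"
    by (auto elim: IfE)
  with IfFalse.IH show ?case by simp
next
  case (WhileFalse g s P)
  then show ?case by (auto elim: WhileE)
next
  case (WhileTrue g s P t s' t' s2)
  from WhileTrue.prems WhileTrue.hyps obtain v v' r
    where "u = 1 + btime g + v + v'" "runs P s v r" "runs (While g P) r v' s''"
    by (auto elim: WhileE)
  with WhileTrue.IH show ?case by metis
qed


section \<open>Input and output encoding\<close>

definition array_of :: "'a::zero list \<Rightarrow> int \<Rightarrow> 'a" where
  "array_of xs i = (if 0 \<le> i \<and> nat i < length xs then xs ! nat i else 0)"

text \<open>
  An instance is presented by an arbitrary duplicate-free list of its edges, each in an
  arbitrary orientation; the vertices are numbered from 0.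
\<close>

definition edge_list :: "nat lp_instance \<Rightarrow> (nat \<times> nat) list \<Rightarrow> bool" where
  "edge_list I es \<longleftrightarrow>
     verts I = {..<card (verts I)} \<and>
     distinct (map (\<lambda>(u, v). {u, v}) es) \<and>
     set (map (\<lambda>(u, v). {u, v}) es) = edges I"

text \<open>All cells that do not hold input data are initially 0.\<close>

definition input_state :: "nat lp_instance \<Rightarrow> (nat \<times> nat) list \<Rightarrow> state" where
  "input_state I es =
     \<lparr>ints = (\<lambda>_ _. 0)
        (''n'' := array_of [int (card (verts I))],
         ''m'' := array_of [int (length es)],
         ''u'' := array_of (map (\<lambda>(u, v). int u) es),
         ''v'' := array_of (map (\<lambda>(u, v). int v) es),
         ''fmin'' := array_of (map (\<lambda>(u, v). fmin I {u, v}) es),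
         ''fmax'' := array_of (map (\<lambda>(u, v). fmax I {u, v}) es)),
      reals = (\<lambda>_ _. 0)
        (''dfix'' := array_of [dfix I],
         ''cfix'' := array_of [cfix I],
         ''c'' := array_of (map (\<lambda>(u, v). ecost I {u, v}) es))\<rparr>"

text \<open>
  A flag reports whether a feasible line concept exists; the remaining output is only
  constrained if one does.
\<close>

definition reports_feasibility :: "nat lp_instance \<Rightarrow> state \<Rightarrow> bool" where
  "reports_feasibility I s \<longleftrightarrow>
     ints s ''feasible'' 0 = (if \<exists>L f. feasible I L f then 1 else 0)"

definition outputs_min_cost :: "nat lp_instance \<Rightarrow> state \<Rightarrow> bool" where
  "outputs_min_cost I s \<longleftrightarrow>
     reports_feasibility I s \<and>
     ((\<exists>L f. feasible I L f) \<longrightarrow>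
      (\<exists>L f. optimal I L f \<and> reals s ''cost'' 0 = concept_cost I L f))"

definition stores :: "state \<Rightarrow> string \<Rightarrow> nat list \<Rightarrow> bool" where
  "stores s a xs \<longleftrightarrow> (\<forall>i<length xs. ints s a (int i) = int (xs ! i))"

text \<open>
  A line concept is written out explicitly: the number of lines, their frequencies, the
  numbers of vertices of their paths, and the concatenation of these paths. Each line is
  listed exactly once.
\<close>

definition outputs_optimal_concept :: "nat lp_instance \<Rightarrow> state \<Rightarrow> bool" where
  "outputs_optimal_concept I s \<longleftrightarrow>
     reports_feasibility I s \<and>
     ((\<exists>L f. feasible I L f) \<longrightarrow>
      (\<exists>ps f.
         (\<forall>p\<in>set ps. simple_path I p) \<and>
         distinct (map path_line ps) \<and>
         optimal I (set (map path_line ps)) f \<and>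
         stores s ''lines'' [length ps] \<and>
         stores s ''freq'' (map (\<lambda>p. f (path_line p)) ps) \<and>
         stores s ''len'' (map length ps) \<and>
         stores s ''path'' (concat ps)))"

definition solves_within ::
  "com \<Rightarrow> (nat lp_instance \<Rightarrow> state \<Rightarrow> bool) \<Rightarrow> nat lp_instance \<Rightarrow> (nat \<times> nat) list \<Rightarrow> nat \<Rightarrow> bool"
where
  "solves_within P out I es T \<longleftrightarrow>
     (\<exists>t s. runs P (input_state I es) t s \<and> t \<le> T \<and> out I s)"

end

theory Submission
  imports Defs
begin

text \<open>
  Since \<open>dfix = 0\<close>, the cost of a line concept is determined by the edge frequencies and the
  number of paths, counted with multiplicity. In a tree, any pairing of path ends on different
  edges at a vertex joins pieces of paths to longer simple paths, so paths can be built up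
  while leaves are removed one after the other. A dynamic program computes, for every vertex
  \<open>v\<close> and every number \<open>r\<close>, the least cost of the part already hanging below \<open>v\<close> if \<open>r\<close> of its
  paths still end at \<open>v\<close> and remain open. By a parity argument it suffices to consider
  \<open>r \<le> B\<close>, where \<open>B \<le> b\<close> is the largest upper frequency bound, so one step takes \<open>O(B\<^sup>3)\<close> time.
  An optimal line concept is obtained by tracing back the minima and building the paths
  forward: a vertical open path is given by its lowest vertex, a finished one by its two
  endpoints, which determine its top. A table indexed by pairs of endpoints thus merges
  equal lines.
\<close>

section \<open>A program logic with time bounds\<close>

text \<open>The lower bound never looks at paths. If \<open>N v\<close> paths visit
  \<open>v\<close>, then \<open>2 * N v\<close> minus the frequencies of the edges at
  \<open>v\<close> counts the path ends at \<open>v\<close>, and half the total of these numbers is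
  the number of paths. So every path end is charged half a path, and all comparisons are made with
  twice the cost. The obstacle is that two path ends may be paired only if they come from different
  edges, while a table indexed by an open count forgets how the open ends are spread over the edges.
  The way out is a closed description of the counts that can be left open: right parity, and no edge
  carrying more than half of all ends when the open ones are added as partners. This description
  survives the removal of one edge at a time, so a solution can be followed backwards through the
  table. The elimination order is computed by the program, and the argument uses only its
  combinatorial properties. Since \<open>b\<close> is not part of the input, the program finds its
  own \<open>B\<close>, and the running time is bounded in \<open>B\<close> first.\<close>

lemma ints_iupdate [simp]: "ints (iupdate s a i x) = (ints s)(a := (ints s a)(i := x))"
  and reals_iupdate [simp]: "reals (iupdate s a i x) = reals s"
  and ints_rupdate [simp]: "ints (rupdate s a i y) = ints s"
  and reals_rupdate [simp]: "reals (rupdate s a i y) = (reals s)(a := (reals s a)(i := y))"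
  by (simp_all add: iupdate_def rupdate_def)

definition tr :: "com \<Rightarrow> state \<Rightarrow> nat \<Rightarrow> (state \<Rightarrow> bool) \<Rightarrow> bool" where
  "tr P s T Q \<longleftrightarrow> (\<exists>t s'. runs P s t s' \<and> t \<le> T \<and> Q s')"

lemma tr_mono:
  assumes "tr P s T Q" "T \<le> T'" "\<And>s'. Q s' \<Longrightarrow> Q' s'"
  shows "tr P s T' Q'"
  using assms unfolding tr_def by (meson le_trans)

lemma tr_Seq:
  assumes "tr P s T (\<lambda>s'. tr Q s' T' R)"
  shows "tr (Seq P Q) s (T + T') R"
  using assms unfolding tr_def by (meson Seq add_mono)

primrec iwr :: "com \<Rightarrow> string set" where
  "iwr Skip = {}"
| "iwr (IWrite a i x) = {a}"
| "iwr (RWrite a i x) = {}"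
| "iwr (Seq P Q) = iwr P \<union> iwr Q"
| "iwr (If g P Q) = iwr P \<union> iwr Q"
| "iwr (While g P) = iwr P"

primrec rwr :: "com \<Rightarrow> string set" where
  "rwr Skip = {}"
| "rwr (IWrite a i x) = {}"
| "rwr (RWrite a i x) = {a}"
| "rwr (Seq P Q) = rwr P \<union> rwr Q"
| "rwr (If g P Q) = rwr P \<union> rwr Q"
| "rwr (While g P) = rwr P"

definition frame :: "string set \<Rightarrow> string set \<Rightarrow> state \<Rightarrow> state \<Rightarrow> bool" where
  "frame X Y s s' \<longleftrightarrow> (\<forall>a. a \<notin> X \<longrightarrow> ints s' a = ints s a) \<and> (\<forall>a. a \<notin> Y \<longrightarrow> reals s' a = reals s a)"

abbreviation framed :: "com \<Rightarrow> state \<Rightarrow> state \<Rightarrow> bool" where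
  "framed P \<equiv> frame (iwr P) (rwr P)"

abbreviation framed_loop :: "string \<Rightarrow> com \<Rightarrow> state \<Rightarrow> state \<Rightarrow> bool" where
  "framed_loop i P \<equiv> frame (insert i (iwr P)) (rwr P)"

lemma frame_ints: "frame X Y s s' \<Longrightarrow> a \<notin> X \<Longrightarrow> ints s' a = ints s a"
  and frame_reals: "frame X Y s s' \<Longrightarrow> a \<notin> Y \<Longrightarrow> reals s' a = reals s a"
  by (simp_all add: frame_def)

lemma runs_frame: "runs P s t s' \<Longrightarrow> frame (iwr P) (rwr P) s s'"
  by (induction rule: runs.induct) (auto simp: frame_def)

text \<open>The frame comes for free with every run, so invariants and postconditions need to
  mention only the arrays that a program changes.\<close>

lemma tr_frame:
  assumes "tr P s T Q"
  shows "tr P s T (\<lambda>s'. Q s' \<and> frame (iwr P) (rwr P) s s')"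
  using assms runs_frame unfolding tr_def by blast

lemma tr_SeqI:
  assumes "tr P s T R" "T + T' \<le> T''"
    and "\<And>s'. R s' \<Longrightarrow> frame (iwr P) (rwr P) s s' \<Longrightarrow> tr Q s' T' R'"
  shows "tr (Seq P Q) s T'' R'"
  using tr_mono[OF tr_Seq[OF tr_mono[OF tr_frame[OF assms(1)] order_refl, of "\<lambda>s'. tr Q s' T' R'"]] assms(2)]
    assms(3) by blast

lemma tr_If:
  assumes "bval g s \<Longrightarrow> tr P s T Q" "\<not> bval g s \<Longrightarrow> tr P' s T Q" "1 + btime g + T \<le> T'"
  shows "tr (If g P P') s T' Q"
proof (cases "bval g s")
  case True
  then obtain t s' where "runs P s t s'" "t \<le> T" "Q s'" using assms(1) by (auto simp: tr_def)
  with True assms(3) show ?thesis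
    unfolding tr_def by (intro exI[of _ "1 + btime g + t"] exI[of _ s']) (auto intro: runs.IfTrue[simplified])
next
  case False
  then obtain t s' where "runs P' s t s'" "t \<le> T" "Q s'" using assms(2) by (auto simp: tr_def)
  with False assms(3) show ?thesis
    unfolding tr_def by (intro exI[of _ "1 + btime g + t"] exI[of _ s']) (auto intro: runs.IfFalse[simplified])
qed

section \<open>Loop-free programs as state transformers\<close>

primrec loop_free :: "com \<Rightarrow> bool" where
  "loop_free Skip \<longleftrightarrow> True"
| "loop_free (IWrite a i x) \<longleftrightarrow> True"
| "loop_free (RWrite a i x) \<longleftrightarrow> True"
| "loop_free (Seq P Q) \<longleftrightarrow> loop_free P \<and> loop_free Q"
| "loop_free (If g P Q) \<longleftrightarrow> loop_free P \<and> loop_free Q"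
| "loop_free (While g P) \<longleftrightarrow> False"

primrec effect :: "com \<Rightarrow> state \<Rightarrow> state" where
  "effect Skip s = s"
| "effect (IWrite a i x) s = iupdate s a (ival i s) (ival x s)"
| "effect (RWrite a i x) s = rupdate s a (ival i s) (rval x s)"
| "effect (Seq P Q) s = effect Q (effect P s)"
| "effect (If g P Q) s = (if bval g s then effect P s else effect Q s)"
| "effect (While g P) s = s"

text \<open>Both branches of a conditional are added rather than maximised: the simplifier then
  evaluates the bound to a numeral, and the slack disappears in the constants.\<close>

primrec max_time :: "com \<Rightarrow> nat" where
  "max_time Skip = 1"
| "max_time (IWrite a i x) = 1 + itime i + itime x"
| "max_time (RWrite a i x) = 1 + itime i + rtime x"
| "max_time (Seq P Q) = max_time P + max_time Q"
| "max_time (If g P Q) = 1 + btime g + (max_time P + max_time Q)"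
| "max_time (While g P) = 0"

lemma runs_effect: "loop_free P \<Longrightarrow> \<exists>t \<le> max_time P. runs P s t (effect P s)"
proof (induction P arbitrary: s)
  case (Seq P Q)
  then obtain t t' where "t \<le> max_time P" "runs P s t (effect P s)"
    "t' \<le> max_time Q" "runs Q (effect P s) t' (effect Q (effect P s))"
    by (metis loop_free.simps(4))
  then show ?case by (auto intro!: exI[of _ "t + t'"] runs.Seq)
next
  case (If g P Q)
  then obtain t t' where "t \<le> max_time P" "runs P s t (effect P s)"
    "t' \<le> max_time Q" "runs Q s t' (effect Q s)"
    by (metis loop_free.simps(5))
  then show ?case
    by (intro exI[of _ "if bval g s then 1 + btime g + t else 1 + btime g + t'"])
      (auto intro: runs.IfTrue[simplified] runs.IfFalse[simplified])
next
  case Skip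
  then show ?case using runs.Skip by auto
next
  case (IWrite a i x)
  then show ?case using runs.IWrite by (metis effect.simps(2) max_time.simps(2) order_refl)
next
  case (RWrite a i x)
  then show ?case using runs.RWrite by (metis effect.simps(3) max_time.simps(3) order_refl)
qed simp

lemma tr_effect:
  assumes "loop_free P" "max_time P \<le> T" "Q (effect P s)"
  shows "tr P s T Q"
  using runs_effect[OF assms(1), of s] assms(2,3) unfolding tr_def by (meson le_trans)

text \<open>The measure bounds the remaining rounds. Each \<open>s'\<close> is framed against the
  initial \<open>s\<close>, so facts about untouched arrays reach the body without being part of
  \<open>J\<close>.\<close>

lemma tr_While:
  fixes \<mu> :: "state \<Rightarrow> nat"
  assumes "J s"
    and "\<And>s'. J s' \<Longrightarrow> frame (iwr P) (rwr P) s s' \<Longrightarrow> bval g s' \<Longrightarrow>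
      tr P s' T (\<lambda>s''. J s'' \<and> \<mu> s'' < \<mu> s')"
  shows "tr (While g P) s (\<mu> s * (1 + btime g + T) + 1 + btime g) (\<lambda>s'. J s' \<and> \<not> bval g s')"
proof -
  have "tr (While g P) s' (\<mu> s' * (1 + btime g + T) + 1 + btime g) (\<lambda>s'. J s' \<and> \<not> bval g s')"
    if "J s'" "frame (iwr P) (rwr P) s s'" for s'
    using that
  proof (induction "\<mu> s'" arbitrary: s' rule: less_induct)
    case less
    show ?case
    proof (cases "bval g s'")
      case True
      obtain t s2 where 1: "runs P s' t s2" "t \<le> T" "J s2" "\<mu> s2 < \<mu> s'"
        using assms(2)[OF less.prems True] by (auto simp: tr_def)
      have "frame (iwr P) (rwr P) s s2" using runs_frame[OF 1(1)] less.prems(2) by (simp add: frame_def)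
      from less.hyps[OF 1(4,3) this] obtain t' s3 where
        2: "runs (While g P) s2 t' s3" "t' \<le> \<mu> s2 * (1 + btime g + T) + 1 + btime g" "J s3" "\<not> bval g s3"
        by (auto simp: tr_def)
      have "Suc (\<mu> s2) * (1 + btime g + T) \<le> \<mu> s' * (1 + btime g + T)"
        using 1(4) by (intro mult_right_mono) auto
      with 1 2 show ?thesis unfolding tr_def
        by (intro exI[of _ "1 + btime g + t + t'"] exI[of _ s3]) (auto intro: runs.WhileTrue[OF True, simplified])
    next
      case False
      then show ?thesis unfolding tr_def
        using less.prems by (intro exI[of _ "1 + btime g"] exI[of _ s']) (auto intro: runs.WhileFalse[simplified])
    qed
  qed
  then show ?thesis using assms(1) by (simp add: frame_def)
qed

text \<open>A guard costs at most 20, so 21 is charged per round and 21 once more for the last test;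
  as \<open>1 \<le> Y\<close>, both fit into 42 per round.\<close>

lemma tr_While':
  fixes \<mu> :: "state \<Rightarrow> nat"
  assumes "J s"
    and "\<And>s'. J s' \<Longrightarrow> frame (iwr P) (rwr P) s s' \<Longrightarrow> bval g s' \<Longrightarrow>
      tr P s' K (\<lambda>s''. J s'' \<and> \<mu> s'' < \<mu> s')"
    and "btime g \<le> 20" "\<mu> s \<le> Y" "1 \<le> Y" "(K + 42) * Y \<le> T"
    and "\<And>s'. J s' \<Longrightarrow> \<not> bval g s' \<Longrightarrow> frame (iwr P) (rwr P) s s' \<Longrightarrow> Q s'"
  shows "tr (While g P) s T Q"
proof (rule tr_mono[OF tr_frame[OF tr_While[where J = J and \<mu> = \<mu> and P = P and g = g and s = s and T = K]]])
  show "J s" by fact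
  show "tr P s' K (\<lambda>s''. J s'' \<and> \<mu> s'' < \<mu> s')"
    if "J s'" "frame (iwr P) (rwr P) s s'" "bval g s'" for s' using assms(2) that .
  have "\<mu> s * (1 + btime g + K) \<le> Y * (21 + K)" using assms(3,4) by (intro mult_mono) auto
  also have "\<dots> + 21 \<le> (K + 42) * Y" using assms(5) by (simp add: algebra_simps)
  finally show "\<mu> s * (1 + btime g + K) + 1 + btime g \<le> T" using assms(3,6) by simp
qed (use assms(7) in auto)

abbreviation Var :: "string \<Rightarrow> iexp" where "Var a \<equiv> IRead a (Const 0)"
abbreviation Set :: "string \<Rightarrow> iexp \<Rightarrow> com" where "Set a x \<equiv> IWrite a (Const 0) x"
abbreviation Inc :: "string \<Rightarrow> com" where "Inc a \<equiv> Set a (IAdd (Var a) (Const 1))"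

definition For :: "string \<Rightarrow> iexp \<Rightarrow> iexp \<Rightarrow> com \<Rightarrow> com" where
  "For i lo hi P = Seq (Set i lo) (While (ILess (Var i) hi) (Seq P (Inc i)))"

lemma iwr_For [simp]: "iwr (For i lo hi P) = insert i (iwr P)"
  and rwr_For [simp]: "rwr (For i lo hi P) = rwr P"
  by (auto simp: For_def)

text \<open>\<open>Y\<close> bounds the rounds and \<open>K * X\<close> the body, kept as separate
  factors so that nested loops multiply. Of the constant 50, 20 pay for guard and increment in each
  round and 30 for the initialisation and the last guard. The invariant is required after the
  increment, hence the \<open>iupdate\<close> in the body's postcondition.\<close>

lemma tr_For:
  assumes lo: "ival lo s = int l" and lh: "l \<le> h"
    and init: "J l (iupdate s i 0 (int l))"
    and guard: "\<And>j s'. frame (insert i (iwr P)) (rwr P) s s' \<Longrightarrow> J j s' \<Longrightarrow> ival hi s' = int h"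
    and body: "\<And>j s'. l \<le> j \<Longrightarrow> j < h \<Longrightarrow> frame (insert i (iwr P)) (rwr P) s s' \<Longrightarrow> J j s' \<Longrightarrow>
      ints s' i 0 = int j \<Longrightarrow> tr P s' (K * X) (\<lambda>s''. J (Suc j) (iupdate s'' i 0 (int (Suc j))))"
    and "i \<notin> iwr P" "itime lo \<le> 10" "itime hi \<le> 10" "h - l \<le> Y" "1 \<le> Y" "1 \<le> X"
    and "(K + 50) * (Y * X) \<le> T"
    and post: "\<And>s'. frame (insert i (iwr P)) (rwr P) s s' \<Longrightarrow> J h s' \<Longrightarrow> ints s' i 0 = int h \<Longrightarrow> Q s'"
  shows "tr (For i lo hi P) s T Q"
proof -
  let ?fr = "frame (insert i (iwr P)) (rwr P)"
  let ?s = "iupdate s i 0 (int l)"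
  let ?g = "ILess (Var i) hi"
  let ?J = "\<lambda>s'. ?fr s s' \<and> (\<exists>j. l \<le> j \<and> j \<le> h \<and> J j s' \<and> ints s' i 0 = int j)"
  let ?\<mu> = "\<lambda>s'. h - nat (ints s' i 0)"
  have fr1: "?fr s ?s" by (simp add: frame_def)
  have *: "tr (While ?g (Seq P (Inc i))) ?s
      (?\<mu> ?s * (1 + btime ?g + (K * X + 6)) + 1 + btime ?g)
      (\<lambda>s'. ?J s' \<and> \<not> bval ?g s')"
  proof (rule tr_While)
    show "?J ?s" using fr1 lh init by auto
  next
    fix s'
    assume J: "?J s'" and b: "bval ?g s'"
    then obtain j where j: "l \<le> j" "j \<le> h" "J j s'" "ints s' i 0 = int j" by auto
    have jh: "j < h" using b guard[OF conjunct1[OF J] j(3)] j by simp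
    show "tr (Seq P (Inc i)) s' (K * X + 6) (\<lambda>s''. ?J s'' \<and> ?\<mu> s'' < ?\<mu> s')"
    proof (rule tr_SeqI[OF body[OF j(1) jh conjunct1[OF J] j(3,4)]])
      show "K * X + 6 \<le> K * X + 6" by simp
      fix s2 assume s2: "J (Suc j) (iupdate s2 i 0 (int (Suc j)))" and f2: "frame (iwr P) (rwr P) s' s2"
      have i2: "ints s2 i 0 = int j" using frame_ints[OF f2] assms(6) j(4) by simp
      have "?fr s s2" using f2 conjunct1[OF J] by (simp add: frame_def)
      then have "?fr s (iupdate s2 i 0 (int (Suc j)))" by (simp add: frame_def)
      then show "tr (Inc i) s2 6 (\<lambda>s''. ?J s'' \<and> ?\<mu> s'' < ?\<mu> s')"
        using s2 i2 jh j by (intro tr_effect) (auto simp: add.commute intro!: exI[of _ "Suc j"])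
    qed
  qed
  have P: "Q s'" if "?J s' \<and> \<not> bval ?g s'" for s'
  proof -
    from that obtain j where j: "?fr s s'" "l \<le> j" "j \<le> h" "J j s'" "ints s' i 0 = int j" by auto
    with that guard[OF j(1,4)] have "j = h" by simp
    with j show ?thesis using post by blast
  qed
  have "tr (For i lo hi P) s (12 + (?\<mu> ?s * (1 + btime ?g + (K * X + 6)) + 1 + btime ?g)) Q"
    unfolding For_def
    by (rule tr_Seq, rule tr_effect) (use * P lo assms(7) in \<open>auto intro: tr_mono\<close>)
  moreover have "12 + (?\<mu> ?s * (1 + btime ?g + (K * X + 6)) + 1 + btime ?g) \<le> (K + 50) * (Y * X)"
  proof -
    have "?\<mu> ?s * (1 + btime ?g + (K * X + 6)) \<le> Y * ((K + 20) * X)"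
      using assms(8-11) by (intro mult_mono) (auto simp: algebra_simps)
    moreover have "1 + btime ?g + 12 \<le> 30 * (Y * X)"
    proof -
      have "1 + btime ?g + 12 \<le> 30" using assms(8) by simp
      also have "\<dots> = 30 * 1" by simp
      also have "\<dots> \<le> 30 * (Y * X)" using assms(10,11) by (intro mult_left_mono) auto
      finally show ?thesis .
    qed
    ultimately show ?thesis by (simp add: algebra_simps)
  qed
  ultimately show ?thesis using assms(12) by (meson le_trans tr_mono)
qed

text \<open>
  The running minimum \<open>best\<close> is attained at the pair \<open>(a1, a2)\<close>; \<open>has\<close> is 0 as long as no candidate
  has been seen.
\<close>

definition Minimize :: "rexp \<Rightarrow> iexp \<Rightarrow> iexp \<Rightarrow> com" where
  "Minimize x a b = Seq (RWrite ''cand'' (Const 0) x)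
     (If (Not (And (ILess (Const 0) (Var ''has'')) (Not (RLess (RRead ''cand'' (Const 0)) (RRead ''best'' (Const 0))))))
       (Seq (Set ''has'' (Const 1)) (Seq (RWrite ''best'' (Const 0) (RRead ''cand'' (Const 0)))
         (Seq (Set ''a1'' a) (Set ''a2'' b)))) Skip)"

definition running_min :: "(nat \<times> nat) set \<Rightarrow> (nat \<times> nat \<Rightarrow> real) \<Rightarrow> state \<Rightarrow> bool" where
  "running_min S f s \<longleftrightarrow> ints s ''has'' 0 = (if S = {} then 0 else 1) \<and>
     (S \<noteq> {} \<longrightarrow> (\<exists>x\<in>S. ints s ''a1'' 0 = int (fst x) \<and> ints s ''a2'' 0 = int (snd x) \<and>
        reals s ''best'' 0 = f x \<and> (\<forall>y\<in>S. f x \<le> f y)))"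

lemma running_min_cong:
  assumes "running_min S f s" "ints s' ''has'' = ints s ''has''" "ints s' ''a1'' = ints s ''a1''"
    "ints s' ''a2'' = ints s ''a2''" "reals s' ''best'' = reals s ''best''"
  shows "running_min S f s'"
  using assms by (simp add: running_min_def)

lemma Minimize_wr [simp]: "iwr (Minimize x a b) = {''has'', ''a1'', ''a2''}"
  "rwr (Minimize x a b) = {''cand'', ''best''}"
  "loop_free (Minimize x a b)"
  "max_time (Minimize x a b) = rtime x + itime a + itime b + 27"
  by (auto simp: Minimize_def)

text \<open>The index expressions are evaluated after \<open>has\<close>, and for \<open>b\<close>
  also \<open>a1\<close>, have been written, so their values are required in those intermediate
  states.\<close>

lemma running_min_Minimize:
  assumes "running_min S f s" "rval x s = f (i, j)"
    and "\<And>s'. ints s' = (ints s)(''has'' := (ints s ''has'')(0 := 1)) \<Longrightarrow> ival a s' = int i"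
    and "\<And>s'. ints s' = (ints s)(''has'' := (ints s ''has'')(0 := 1),
      ''a1'' := (ints s ''a1'')(0 := int i)) \<Longrightarrow> ival b s' = int j"
  shows "running_min (insert (i, j) S) f (effect (Minimize x a b) s)"
proof -
  define s1 where "s1 = effect (RWrite ''cand'' (Const 0) x) s"
  have s1: "ints s1 = ints s" "reals s1 ''cand'' 0 = f (i, j)" "reals s1 ''best'' = reals s ''best''"
    using assms(2) by (simp_all add: s1_def)
  define c where "c \<longleftrightarrow> S = {} \<or> f (i, j) < reals s ''best'' 0"
  have e: "effect (Minimize x a b) s = (if c then effect (Seq (Set ''has'' (Const 1)) (Seq (RWrite ''best'' (Const 0) (RRead ''cand'' (Const 0)))
         (Seq (Set ''a1'' a) (Set ''a2'' b)))) s1 else s1)"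
    using s1 assms(1) by (auto simp: Minimize_def s1_def c_def running_min_def)
  show ?thesis
  proof (cases c)
    case True
    then have 2: "\<forall>y\<in>S. f (i, j) \<le> f y" using assms(1) by (force simp: running_min_def c_def)
    show ?thesis unfolding e using True s1 2 by (auto simp: running_min_def assms(3,4))
  next
    case False
    then show ?thesis unfolding e using s1 assms(1) by (auto simp: running_min_def c_def)
  qed
qed

section \<open>The dynamic program along a leaf elimination order\<close>

text \<open>Step \<open>k\<close> removes the leaf \<open>ch k\<close>, whose only remaining
  neighbour is \<open>pa k\<close>. That a removed vertex never occurs again replaces every appeal
  to acyclicity, and \<open>root_iff\<close> replaces connectedness: exactly one vertex is never
  removed.\<close>

locale peeling =
  fixes n m root :: nat and ch pa :: "nat \<Rightarrow> nat"
  assumes ch_less: "k < m \<Longrightarrow> ch k < n"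
    and pa_less: "k < m \<Longrightarrow> pa k < n"
    and ch_neq_pa: "k < m \<Longrightarrow> ch k \<noteq> pa k"
    and ch_later: "k < j \<Longrightarrow> j < m \<Longrightarrow> ch k \<noteq> ch j \<and> ch k \<noteq> pa j"
    and root_less: "root < n"
    and root_iff: "v < n \<Longrightarrow> (\<forall>k<m. v \<noteq> ch k) \<longleftrightarrow> v = root"
begin

lemma ch_inj: "j < m \<Longrightarrow> k < m \<Longrightarrow> ch j = ch k \<Longrightarrow> j = k"
  using ch_later by (metis nat_neq_iff)

definition rest :: "nat \<Rightarrow> nat set" where
  "rest k = {v. v < n \<and> (\<forall>j<k. v \<noteq> ch j)}"

lemma finite_rest [simp]: "finite (rest k)"
  by (simp add: rest_def)

lemma rest_0 [simp]: "rest 0 = {..<n}"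
  by (auto simp: rest_def)

lemma rest_m: "rest m = {root}"
  using root_iff root_less by (auto simp: rest_def)

lemma rest_Suc: "k < m \<Longrightarrow> rest (Suc k) = rest k - {ch k}"
  by (auto simp: rest_def less_Suc_eq)

lemma ch_in_rest: "k < m \<Longrightarrow> ch k \<in> rest k"
  using ch_less ch_later by (fastforce simp: rest_def)

lemma pa_in_rest: "k < m \<Longrightarrow> pa k \<in> rest k"
  using pa_less ch_later by (fastforce simp: rest_def)

lemma pa_in_rest_Suc: "k < m \<Longrightarrow> pa k \<in> rest (Suc k)"
  using pa_in_rest ch_neq_pa by (fastforce simp: rest_Suc)

lemma sum_rest:
  fixes f :: "nat \<Rightarrow> 'a::ab_group_add"
  assumes "k < m"
  shows "sum f (rest k) = f (ch k) + f (pa k) + sum f (rest k - {ch k, pa k})"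
    and "sum f (rest (Suc k)) = f (pa k) + sum f (rest k - {ch k, pa k})"
proof -
  have "sum f (rest k) = f (ch k) + sum f (rest k - {ch k})"
    using ch_in_rest[OF assms] by (simp add: sum.remove)
  moreover have "sum f (rest k - {ch k}) = f (pa k) + sum f (rest k - {ch k} - {pa k})"
    using pa_in_rest_Suc[OF assms] by (simp add: sum.remove rest_Suc[OF assms])
  moreover have "rest k - {ch k} - {pa k} = rest k - {ch k, pa k}" by auto
  ultimately show "sum f (rest k) = f (ch k) + f (pa k) + sum f (rest k - {ch k, pa k})"
    and "sum f (rest (Suc k)) = f (pa k) + sum f (rest k - {ch k, pa k})"
    by (simp_all add: rest_Suc[OF assms] add.assoc)
qed

end

locale peel_dp = peeling +
  fixes B :: nat and lo hi :: "nat \<Rightarrow> nat" and w :: "nat \<Rightarrow> real" and cf :: real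
  assumes lo_hi: "k < m \<Longrightarrow> lo k \<le> hi k" and hi_B: "k < m \<Longrightarrow> hi k \<le> B"
    and cf_nonneg: "cf \<ge> 0"
begin

text \<open>
  \<open>A k v r\<close> is the least cost of the part hanging below \<open>v\<close> after \<open>k\<close> elimination steps when
  \<open>r\<close> of its paths end at \<open>v\<close> and may still be prolonged or joined there. Initially these are
  \<open>r\<close> one-vertex paths. Step \<open>k\<close> sends \<open>F\<close> paths along its edge, starts \<open>F - r\<close> new ones if
  necessary (truncated subtraction), and joins \<open>i\<close> of them with paths ending at \<open>pa k\<close>.
\<close>

definition choices :: "nat \<Rightarrow> nat \<Rightarrow> (nat \<times> nat) set" where
  "choices k q = {(F, i). lo k \<le> F \<and> F \<le> hi k \<and> i \<le> F \<and> F \<le> q + i \<and> q + 2 * i \<le> F + B}"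

text \<open>The best open count below depends on \<open>F\<close> alone. Computing it before
  \<open>q\<close> and \<open>i\<close> are considered keeps a step cubic in \<open>B\<close>, where
  a joint minimisation would be quartic.\<close>

definition up :: "(nat \<Rightarrow> nat \<Rightarrow> real) \<Rightarrow> nat \<Rightarrow> nat \<Rightarrow> real" where
  "up a k F = Min ((\<lambda>r. a (ch k) r + cf * real (F - r)) ` {..B}) + w k * real F"

definition join :: "(nat \<Rightarrow> nat \<Rightarrow> real) \<Rightarrow> nat \<Rightarrow> nat \<Rightarrow> nat \<times> nat \<Rightarrow> real" where
  "join a k q x = a (pa k) (q + 2 * snd x - fst x) + up a k (fst x) - cf * real (snd x)"

primrec A :: "nat \<Rightarrow> nat \<Rightarrow> nat \<Rightarrow> real" where
  "A 0 = (\<lambda>v r. cf * real r)"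
| "A (Suc k) = (A k)(pa k := (\<lambda>q. Min (join (A k) k q ` choices k q)))"

lemma finite_choices [simp]: "finite (choices k q)"
  by (rule finite_subset[of _ "{..hi k} \<times> {..hi k}"]) (auto simp: choices_def)

lemma choices_nonempty:
  assumes "k < m" "q \<le> B"
  shows "choices k q \<noteq> {}"
proof -
  \<comment> \<open>If \<open>q\<close> is below \<open>lo k\<close>, the surplus
    \<open>lo k - q\<close> has to be joined, and exactly that many open paths at
    \<open>pa k\<close> serve as partners; otherwise nothing is joined.\<close>
  have "(lo k, lo k - q) \<in> choices k q"
    using lo_hi[OF assms(1)] hi_B[OF assms(1)] assms(2) by (auto simp: choices_def)
  then show ?thesis by blast
qed

text \<open>Naming the earlier count \<open>r\<close> by an equation removes the truncated
  subtraction of \<open>join\<close> from all later arguments.\<close>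

lemma A_Suc_le:
  assumes "k < m" "lo k \<le> F" "F \<le> hi k" "r \<le> B" "i \<le> F" "i \<le> r" "q + 2 * i = r + F" "rc \<le> B"
  shows "A (Suc k) (pa k) q \<le> A k (pa k) r + A k (ch k) rc + w k * real F + cf * real (F - rc) - cf * real i"
proof -
  have "(F, i) \<in> choices k q" using assms by (auto simp: choices_def)
  then have "A (Suc k) (pa k) q \<le> join (A k) k q (F, i)" by (auto intro!: Min_le)
  moreover have "up (A k) k F \<le> A k (ch k) rc + cf * real (F - rc) + w k * real F"
    unfolding up_def using assms(8) by (auto intro!: Min_le)
  moreover have "q + 2 * i - F = r" using assms by simp
  ultimately show ?thesis by (simp add: join_def)
qed

end

subsection \<open>Lower bound\<close>

text \<open>
  The open counts reachable at a vertex are those of the right parity in an interval. This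
  interval may be cut off at \<open>B\<close> because all edge frequencies are at most \<open>B\<close>.
\<close>

lemma parity_step:
  fixes S B F q :: nat
  assumes "finite Fs" "\<forall>f\<in>Fs. f \<le> S \<and> f \<le> B" "F \<le> B" "q \<le> S + F" "q \<le> B" "even (q + S + F)"
    "\<forall>f\<in>insert F Fs. 2 * f \<le> q + S + F"
  obtains r where "r \<le> S" "r \<le> B" "even (r + S)" "\<forall>f\<in>Fs. 2 * f \<le> r + S" "F \<le> r + q" "r \<le> F + q" "q \<le> r + F"
proof -
  \<comment> \<open>The triangle inequalities force \<open>r\<close> to be at least the distance of
    \<open>F\<close> and \<open>q\<close>. If some edge would then hold more than half of the ends,
    raising \<open>r\<close> to \<open>2 * f - S\<close> for the largest \<open>f\<close> is just
    enough, and the parity is kept.\<close>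
  define d where "d = (if q \<le> F then F - q else q - F)"
  have d: "even (d + S)" "d \<le> S" "d \<le> B" "F \<le> d + q" "d \<le> F + q" "q \<le> d + F"
    using assms by (auto simp: d_def)
  show ?thesis
  proof (cases "\<forall>f\<in>Fs. 2 * f \<le> d + S")
    case True
    then show ?thesis using d that[of d] by auto
  next
    case False
    then have ne: "Fs \<noteq> {}" by auto
    define f where "f = Max Fs"
    have f: "f \<in> Fs" "\<forall>f'\<in>Fs. f' \<le> f" using assms(1) ne by (auto simp: f_def)
    have "d + S < 2 * f" using False f by force
    then show ?thesis using f d assms by (intro that[of "2 * f - S"]) (auto simp: algebra_simps)
  qed
qed

text \<open>If \<open>min X S\<close> exceeds \<open>B\<close>, the count is lowered to
  \<open>B\<close> or \<open>B - 1\<close>, whichever has the right parity. From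
  \<open>f \<le> B\<close> and \<open>f \<le> S\<close> the edge condition can fail by at most one,
  and parity excludes that. The hypothesis for \<open>B = 0\<close> makes \<open>B - 1\<close> a
  genuine predecessor.\<close>

lemma parity_cut:
  fixes S B X :: nat
  assumes "\<forall>f\<in>Fs. f \<le> S \<and> f \<le> B" "even (X + S)" "\<forall>f\<in>Fs. 2 * f \<le> X + S" "B = 0 \<Longrightarrow> S = 0"
  obtains q where "q \<le> X" "q \<le> S" "q \<le> B" "even (q + S)" "\<forall>f\<in>Fs. 2 * f \<le> q + S"
proof (cases "min X S \<le> B")
  case True
  have "even (min X S + S)" using assms(2) by (auto simp: min_def)
  with True assms show ?thesis by (intro that[of "min X S"]) (auto simp: min_def)
next
  case False
  then have B: "B > 0" "B < X" "B < S" using assms by (auto simp: min_def split: if_splits)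
  define q where "q = (if even (B + S) then B else B - 1)"
  have q: "q \<le> B" "B \<le> Suc q" "even (q + S)" using B by (auto simp: q_def)
  have "2 * f \<le> q + S" if "f \<in> Fs" for f
  proof -
    have "f \<le> S" "f \<le> B" using assms(1) that by auto
    with q have "2 * f \<le> Suc (q + S)" by arith
    moreover have "2 * f \<noteq> Suc (q + S)" using q(3) by presburger
    ultimately show ?thesis by arith
  qed
  with q B show ?thesis by (intro that[of q]) auto
qed

context peel_dp
begin

definition load :: "(nat \<Rightarrow> nat) \<Rightarrow> nat \<Rightarrow> nat \<Rightarrow> nat" where
  "load F k v = (\<Sum>j | j < k \<and> pa j = v. F j)"

definition degree_load :: "(nat \<Rightarrow> nat) \<Rightarrow> nat \<Rightarrow> nat" where
  "degree_load F v = (\<Sum>j | j < m \<and> (ch j = v \<or> pa j = v). F j)"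

text \<open>These are the numbers of ends that a pairing across different edges can leave open at
  \<open>v\<close>, cut off at \<open>B\<close>: an edge with \<open>f\<close> ends needs
  \<open>f\<close> partners among the ends on other edges and the \<open>r\<close> open
  slots.\<close>

definition reachable :: "(nat \<Rightarrow> nat) \<Rightarrow> nat \<Rightarrow> nat \<Rightarrow> nat set" where
  "reachable F k v = {r. r \<le> load F k v \<and> r \<le> B \<and> even (r + load F k v) \<and>
     (\<forall>f\<in>F ` {j. j < k \<and> pa j = v}. 2 * f \<le> r + load F k v)}"

lemma load_Suc: "load F (Suc k) v = load F k v + (if pa k = v then F k else 0)"
proof -
  have "{j. j < Suc k \<and> pa j = v} = {j. j < k \<and> pa j = v} \<union> (if pa k = v then {k} else {})"
    by (auto simp: less_Suc_eq)
  then show ?thesis by (auto simp: load_def)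
qed

lemma load_bounds:
  assumes "\<And>j. j < m \<Longrightarrow> F j \<le> hi j" "k \<le> m" "f \<in> F ` {j. j < k \<and> pa j = v}"
  shows "f \<le> load F k v \<and> f \<le> B"
proof -
  from assms(3) obtain j where j: "j < k" "pa j = v" "f = F j" by auto
  then have "F j \<le> load F k v" unfolding load_def by (intro member_le_sum) auto
  with j assms(1)[of j] hi_B[of j] assms(2) show ?thesis by auto
qed

text \<open>Apart from its own edge, every edge at \<open>ch k\<close> was removed earlier with
  \<open>ch k\<close> as the parent, because \<open>ch k\<close> does not occur after step
  \<open>k\<close>.\<close>

lemma degree_load_ch:
  assumes "k < m"
  shows "degree_load F (ch k) = load F k (ch k) + F k"
proof -
  have "{j. j < m \<and> (ch j = ch k \<or> pa j = ch k)} = insert k {j. j < k \<and> pa j = ch k}"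
    using assms ch_inj ch_later[of k] ch_neq_pa by (auto simp del: neq_iff) (metis linorder_neqE_nat)
  then show ?thesis by (simp add: degree_load_def load_def)
qed

lemma degree_load_root: "degree_load F root = load F m root"
  using root_iff[OF root_less] by (auto simp: degree_load_def load_def intro!: sum.cong)

text \<open>For a line concept, \<open>N v\<close> is the number of paths through \<open>v\<close>,
  counted with frequency. A visit has two slots, each taken by an edge or by a path end, so the last
  sum counts path ends, two for every path. This is why both sides are doubled.\<close>

theorem dp_lower_bound:
  fixes F N :: "nat \<Rightarrow> nat"
  assumes F: "\<And>j. j < m \<Longrightarrow> lo j \<le> F j \<and> F j \<le> hi j"
    and N: "\<And>j. j < m \<Longrightarrow> F j \<le> N (ch j) \<and> F j \<le> N (pa j)"
    and deg: "\<And>v. v < n \<Longrightarrow> degree_load F v \<le> 2 * N v"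
  obtains r where "r \<le> B"
    "2 * A m root r \<le> 2 * (\<Sum>j<m. w j * real (F j)) + cf * real (\<Sum>v<n. 2 * N v - degree_load F v)"
proof -
  define X where "X v = 2 * N v - degree_load F v" for v
  have X: "X v + degree_load F v = 2 * N v" if "v < n" for v
    using deg[OF that] by (simp add: X_def)
  have B0: "F j = 0" if "j < m" "B = 0" for j
    using F[OF that(1)] hi_B[OF that(1)] that(2) by simp
  have FB: "F j \<le> B" if "j < m" for j using F[OF that] hi_B[OF that] by simp
  \<comment> \<open>The counts \<open>z\<close> stay arbitrary because undoing a step chooses new
    ones at \<open>ch k\<close> and \<open>pa k\<close>. An open end is charged half a path, just as
    a true end at a removed vertex.\<close>
  have main: "2 * (\<Sum>v\<in>rest k. A k v (z v)) \<le>
      2 * (\<Sum>j<k. w j * real (F j)) + cf * ((\<Sum>j<k. real (X (ch j))) + (\<Sum>v\<in>rest k. real (z v)))"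
    if "k \<le> m" "\<forall>v\<in>rest k. z v \<in> reachable F k v" for k z
    using that
  proof (induction k arbitrary: z)
    case 0
    have "z v = 0" if "v < n" for v using 0 that by (auto simp: reachable_def load_def)
    then show ?case by simp
  next
    case (Suc k)
    then have k: "k < m" by simp
    let ?c = "ch k" and ?p = "pa k"
    have FI: "\<And>j. j < m \<Longrightarrow> F j \<le> hi j" using F by blast
    let ?Fs = "\<lambda>v. F ` {j. j < k \<and> pa j = v}"
    have bnd: "\<forall>f\<in>?Fs v. f \<le> load F k v \<and> f \<le> B" for v
      using load_bounds[of F k _ v] FI k by auto
    have "z ?p \<in> reachable F (Suc k) ?p" using Suc.prems pa_in_rest_Suc[OF k] by auto
    moreover have "{j. j < Suc k \<and> pa j = ?p} = insert k {j. j < k \<and> pa j = ?p}"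
      by (auto simp: less_Suc_eq)
    ultimately have zp: "z ?p \<le> load F k ?p + F k" "z ?p \<le> B" "even (z ?p + load F k ?p + F k)"
      "\<forall>f\<in>insert (F k) (?Fs ?p). 2 * f \<le> z ?p + load F k ?p + F k"
      by (auto simp: reachable_def load_Suc algebra_simps)
    \<comment> \<open>Of the \<open>r\<close> ends open at \<open>pa k\<close> before the step, some
      are joined with the \<open>F k\<close> arriving ones so that \<open>z (pa k)\<close>
      remain.\<close>
    obtain r where r: "r \<in> reachable F k ?p" "F k \<le> r + z ?p" "r \<le> F k + z ?p" "z ?p \<le> r + F k"
      by (rule parity_step[OF _ bnd FB[OF k] zp]) (simp_all add: reachable_def)
    have Xc: "even (X ?c + (load F k ?c + F k))"
      using X[OF ch_less[OF k]] by (simp add: degree_load_ch[OF k])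
    have fX: "\<forall>f\<in>insert (F k) (?Fs ?c). 2 * f \<le> X ?c + (load F k ?c + F k)"
    proof -
      have "F j \<le> N ?c" if "j < k" "pa j = ?c" for j
        using N[of j] that k by simp
      then have "f \<le> N ?c" if "f \<in> insert (F k) (?Fs ?c)" for f
        using that N[OF k] by blast
      then show ?thesis using X[OF ch_less[OF k]] by (simp add: degree_load_ch[OF k])
    qed
    have "load F k ?c + F k = 0" if "B = 0" using B0 that k by (auto simp: load_def)
    then have B0c: "B = 0 \<Longrightarrow> load F k ?c + F k = 0" .
    \<comment> \<open>The number of ends at \<open>ch k\<close> may exceed \<open>B\<close>. A
      smaller number of the same parity is used instead, which can only lower the charge since
      \<open>cf\<close> is nonnegative.\<close>
    obtain q where q: "q \<le> X ?c" "q \<le> load F k ?c + F k" "q \<le> B" "even (q + (load F k ?c + F k))"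
      "\<forall>f\<in>insert (F k) (?Fs ?c). 2 * f \<le> q + (load F k ?c + F k)"
    proof (rule parity_cut[of "insert (F k) (?Fs ?c)" "load F k ?c + F k" B, OF _ Xc fX B0c])
      show "\<forall>f\<in>insert (F k) (?Fs ?c). f \<le> load F k ?c + F k \<and> f \<le> B"
        using bnd[of ?c] FB[OF k] by (auto intro: trans_le_add1)
    qed
    obtain rc where rc: "rc \<in> reachable F k ?c" "F k \<le> rc + q" "rc \<le> F k + q"
      by (rule parity_step[OF _ bnd[of ?c] FB[OF k] q(2,3)])
        (use q(4,5) in \<open>simp_all add: reachable_def add.assoc\<close>)
    define z' where "z' = z(?p := r, ?c := rc)"
    have "z' v \<in> reachable F k v" if "v \<in> rest k" for v
    proof (cases "v = ?p \<or> v = ?c")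
      case True
      then show ?thesis using r rc ch_neq_pa[OF k] by (auto simp: z'_def)
    next
      case False
      then have "z v \<in> reachable F (Suc k) v" using Suc.prems that by (auto simp: rest_Suc[OF k])
      moreover have "{j. j < Suc k \<and> pa j = v} = {j. j < k \<and> pa j = v}"
        using False by (auto simp: less_Suc_eq)
      ultimately show ?thesis using False by (simp add: z'_def reachable_def load_def)
    qed
    then have IH: "2 * (\<Sum>v\<in>rest k. A k v (z' v)) \<le>
        2 * (\<Sum>j<k. w j * real (F j)) + cf * ((\<Sum>j<k. real (X (ch j))) + (\<Sum>v\<in>rest k. real (z' v)))"
      using Suc by simp
    define i where "i = (r + F k - z ?p) div 2"
    have "even (r + F k - z ?p)"
      using r(1) zp(3) r(4) unfolding reachable_def by auto
    then have i: "z ?p + 2 * i = r + F k" using r(4) by (simp add: i_def)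
    have step: "A (Suc k) ?p (z ?p) \<le> A k ?p r + A k ?c rc + w k * real (F k) + cf * real (F k - rc) - cf * real i"
      using i r rc F[OF k] by (intro A_Suc_le) (auto simp: reachable_def k)
    \<comment> \<open>The difference of \<open>rc\<close> and \<open>F k\<close> consists of paths
      closed at \<open>ch k\<close> or of paths started there, in either case at most
      \<open>q\<close> ends. A started path weighs two halves, and a join saves two halves.\<close>
    have "real r + real rc + 2 * real (F k - rc) - 2 * real i \<le> real (X ?c) + real (z ?p)"
      using i q(1) rc(2,3) by (cases "rc \<le> F k") (auto simp: of_nat_diff)
    then have "cf * (real r + real rc + 2 * real (F k - rc) - 2 * real i) \<le> cf * (real (X ?c) + real (z ?p))"
      using cf_nonneg by (rule mult_left_mono)
    moreover have "(\<Sum>v\<in>rest k. A k v (z' v)) =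
        A k ?c rc + A k ?p r + (\<Sum>v\<in>rest k - {?c, ?p}. A (Suc k) v (z v))"
      using ch_neq_pa[OF k] by (subst sum_rest[OF k]) (auto simp: z'_def intro!: sum.cong)
    moreover have "(\<Sum>v\<in>rest (Suc k). A (Suc k) v (z v)) =
        A (Suc k) ?p (z ?p) + (\<Sum>v\<in>rest k - {?c, ?p}. A (Suc k) v (z v))"
      by (rule sum_rest[OF k])
    moreover have "(\<Sum>v\<in>rest k. real (z' v)) = real rc + real r + (\<Sum>v\<in>rest k - {?c, ?p}. real (z v))"
      using ch_neq_pa[OF k] by (subst sum_rest[OF k]) (auto simp: z'_def intro!: sum.cong)
    moreover have "(\<Sum>v\<in>rest (Suc k). real (z v)) = real (z ?p) + (\<Sum>v\<in>rest k - {?c, ?p}. real (z v))"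
      by (rule sum_rest[OF k])
    ultimately show ?case using IH step by (simp add: algebra_simps del: A.simps)
  qed
  have root_bnd: "\<forall>f\<in>F ` {j. j < m \<and> pa j = root}. f \<le> load F m root \<and> f \<le> B"
    using load_bounds[of F m _ root] F by auto
  have Xr: "even (X root + load F m root)"
    "\<forall>f\<in>F ` {j. j < m \<and> pa j = root}. 2 * f \<le> X root + load F m root"
    using X[OF root_less] N by (auto simp: degree_load_root)
  have B0r: "B = 0 \<Longrightarrow> load F m root = 0" using B0 by (auto simp: load_def)
  obtain q where q: "q \<le> X root" "q \<in> reachable F m root"
    by (rule parity_cut[OF root_bnd Xr B0r]) (simp_all add: reachable_def)
  have "2 * A m root q \<le> 2 * (\<Sum>j<m. w j * real (F j)) + cf * ((\<Sum>j<m. real (X (ch j))) + real q)"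
    using main[of m "\<lambda>_. q"] q by (simp add: rest_m)
  also have "\<dots> \<le> 2 * (\<Sum>j<m. w j * real (F j)) + cf * ((\<Sum>j<m. real (X (ch j))) + real (X root))"
    using q(1) cf_nonneg by (simp add: mult_left_mono)
  also have "(\<Sum>j<m. real (X (ch j))) = (\<Sum>v\<in>ch ` {..<m}. real (X v))"
    using ch_inj by (subst sum.reindex) (auto intro: inj_onI)
  also have "(\<Sum>v\<in>ch ` {..<m}. real (X v)) + real (X root) = (\<Sum>v\<in>insert root (ch ` {..<m}). real (X v))"
    using root_iff[OF root_less] by (subst sum.insert) auto
  also have "insert root (ch ` {..<m}) = {..<n}"
    using root_iff root_less ch_less by fastforce
  finally show ?thesis using that[of q] q(2) by (auto simp: reachable_def X_def)
qed

end

context peel_dp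
begin

subsection \<open>Backtracking\<close>

text \<open>A table solution as data: \<open>z k v\<close> is the open count at \<open>v\<close>
  before step \<open>k\<close>, \<open>F k\<close> the frequency of the edge and \<open>i k\<close>
  the number of joins. Besides the bound \<open>B\<close>, nothing ties \<open>z\<close> at
  \<open>ch k\<close> after step \<open>k\<close> to its earlier value.\<close>

definition trace :: "(nat \<Rightarrow> nat \<Rightarrow> nat) \<Rightarrow> (nat \<Rightarrow> nat) \<Rightarrow> (nat \<Rightarrow> nat) \<Rightarrow> bool" where
  "trace z F i \<longleftrightarrow> (\<forall>k v. z k v \<le> B) \<and> (\<forall>k<m. lo k \<le> F k \<and> F k \<le> hi k \<and> i k \<le> F k \<and> i k \<le> z k (pa k) \<and>
     z (Suc k) (pa k) + 2 * i k = z k (pa k) + F k \<and>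
     (\<forall>v. v \<noteq> ch k \<longrightarrow> v \<noteq> pa k \<longrightarrow> z (Suc k) v = z k v) \<and>
     A (Suc k) (pa k) (z (Suc k) (pa k)) = A k (pa k) (z k (pa k)) + A k (ch k) (z k (ch k)) +
       w k * real (F k) + cf * real (F k - z k (ch k)) - cf * real (i k))"

text \<open>Telescoping the recurrence isolates the number of paths as the factor of
  \<open>cf\<close>: the initial one-vertex paths, plus those started, minus one for every join.
  Integers are used because a step may join more than it starts.\<close>

lemma trace_cost:
  assumes "trace z F i" "k \<le> m"
  shows "(\<Sum>v\<in>rest k. A k v (z k v)) = (\<Sum>j<k. w j * real (F j)) +
    cf * real_of_int (int (\<Sum>v<n. z 0 v) + (\<Sum>j<k. int (F j - z j (ch j)) - int (i j)))"
  using assms(2)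
proof (induction k)
  case 0
  then show ?case by (simp add: sum_distrib_left)
next
  case (Suc k)
  then have k: "k < m" by simp
  have "(\<Sum>v\<in>rest k - {ch k, pa k}. A (Suc k) v (z (Suc k) v)) = (\<Sum>v\<in>rest k - {ch k, pa k}. A k v (z k v))"
    using assms(1) k by (auto simp: trace_def intro!: sum.cong)
  moreover have "A (Suc k) (pa k) (z (Suc k) (pa k)) = A k (pa k) (z k (pa k)) + A k (ch k) (z k (ch k)) +
       w k * real (F k) + cf * real (F k - z k (ch k)) - cf * real (i k)"
    using assms(1) k by (simp add: trace_def)
  ultimately show ?case
    using Suc sum_rest(1)[OF k, of "\<lambda>v. A k v (z k v)"] sum_rest(2)[OF k, of "\<lambda>v. A (Suc k) v (z (Suc k) v)"]
    by (simp add: algebra_simps del: A.simps)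
qed

definition optimal_tables :: "(nat \<Rightarrow> nat \<Rightarrow> nat \<times> nat) \<Rightarrow> (nat \<Rightarrow> nat \<Rightarrow> nat) \<Rightarrow> bool" where
  "optimal_tables g h \<longleftrightarrow> (\<forall>k<m.
     (\<forall>q\<le>B. g k q \<in> choices k q \<and> A (Suc k) (pa k) q = join (A k) k q (g k q)) \<and>
     (\<forall>F\<le>B. h k F \<le> B \<and> up (A k) k F = A k (ch k) (h k F) + cf * real (F - h k F) + w k * real F))"

text \<open>Steps are undone from the last to the first, so after \<open>t\<close> rounds the counts
  are those before step \<open>m - t\<close>. The only count given at the outset is the one at the
  root.\<close>

primrec backtrack :: "(nat \<Rightarrow> nat \<Rightarrow> nat \<times> nat) \<Rightarrow> (nat \<Rightarrow> nat \<Rightarrow> nat) \<Rightarrow> nat \<Rightarrow> nat \<Rightarrow> nat \<Rightarrow> nat" where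
  "backtrack g h r 0 = (\<lambda>_. 0)(root := r)"
| "backtrack g h r (Suc t) = (let k = m - Suc t; q = backtrack g h r t (pa k); x = g k q in
     (backtrack g h r t)(pa k := q + 2 * snd x - fst x, ch k := h k (fst x)))"

lemma trace_backtrack:
  assumes "optimal_tables g h" "r \<le> B"
  defines "z \<equiv> \<lambda>k. backtrack g h r (m - k)"
  shows "trace z (\<lambda>k. fst (g k (z (Suc k) (pa k)))) (\<lambda>k. snd (g k (z (Suc k) (pa k))))"
proof -
  have B: "backtrack g h r t v \<le> B" if "t \<le> m" for t v
    using that
  proof (induction t arbitrary: v)
    case 0
    then show ?case using assms(2) by simp
  next
    case (Suc t)
    let ?k = "m - Suc t"
    let ?q = "backtrack g h r t (pa ?k)"
    have k: "?k < m" using Suc.prems by simp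
    have q: "?q \<le> B" using Suc by simp
    then have "g ?k ?q \<in> choices ?k ?q" using assms(1) k by (simp add: optimal_tables_def)
    then have g: "?q + 2 * snd (g ?k ?q) - fst (g ?k ?q) \<le> B" "fst (g ?k ?q) \<le> B"
      using hi_B[OF k] by (auto simp: choices_def)
    then have "h ?k (fst (g ?k ?q)) \<le> B" using assms(1) k by (simp add: optimal_tables_def)
    with g Suc show ?case by (simp add: Let_def)
  qed
  show ?thesis unfolding trace_def
  proof (intro conjI allI impI)
    show "z k v \<le> B" for k v using B unfolding z_def by simp
    fix k assume k: "k < m"
    let ?q = "z (Suc k) (pa k)"
    let ?x = "g k ?q"
    have "m - k = Suc (m - Suc k)" "m - Suc (m - Suc k) = k" using k by auto
    then have z: "z k = (z (Suc k))(pa k := ?q + 2 * snd ?x - fst ?x, ch k := h k (fst ?x))"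
      unfolding z_def by (simp add: Let_def)
    have q: "?q \<le> B" using B unfolding z_def by simp
    then have x: "?x \<in> choices k ?q" "A (Suc k) (pa k) ?q = join (A k) k ?q ?x"
      using assms(1) k by (auto simp: optimal_tables_def)
    then show x': "lo k \<le> fst ?x" "fst ?x \<le> hi k" "snd ?x \<le> fst ?x" by (auto simp: choices_def)
    show "snd ?x \<le> z k (pa k)" "?q + 2 * snd ?x = z k (pa k) + fst ?x"
      using x(1) ch_neq_pa[OF k] unfolding z by (auto simp: choices_def)
    show "z (Suc k) v = z k v" if "v \<noteq> ch k" "v \<noteq> pa k" for v using that unfolding z by simp
    have "up (A k) k (fst ?x) = A k (ch k) (h k (fst ?x)) + cf * real (fst ?x - h k (fst ?x)) + w k * real (fst ?x)"
      using assms(1) k x'(2) hi_B[OF k] by (simp add: optimal_tables_def)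
    then show "A (Suc k) (pa k) ?q = A k (pa k) (z k (pa k)) + A k (ch k) (z k (ch k)) +
       w k * real (fst ?x) + cf * real (fst ?x - z k (ch k)) - cf * real (snd ?x)"
      using x(2) ch_neq_pa[OF k] unfolding z by (simp add: join_def)
  qed
qed

end

section \<open>Paths in the rooted tree\<close>

context peeling
begin

definition R :: "(nat \<times> nat) set" where
  "R = {(ch k, pa k) | k. k < m}"

lemma single_valued_R: "single_valued R"
  by (auto simp: single_valued_def R_def dest: ch_inj)

text \<open>A proper ancestor is removed later than \<open>x\<close> or never. The removal time is
  thus a rank for \<open>R\<close>, which yields acyclicity.\<close>

lemma trancl_R:
  assumes "(x, y) \<in> R\<^sup>+"
  obtains k where "k < m" "x = ch k" "\<And>j. j \<le> k \<Longrightarrow> y \<noteq> ch j"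
proof -
  have "\<exists>k<m. x = ch k \<and> (\<forall>j\<le>k. y \<noteq> ch j)"
    using assms
  proof (induction rule: trancl_induct)
    case (base y)
    then obtain k where k: "k < m" "x = ch k" "y = pa k" by (auto simp: R_def)
    then have "\<forall>j\<le>k. y \<noteq> ch j" using ch_later[of _ k] ch_neq_pa[of k] by (metis le_neq_implies_less)
    with k show ?case by blast
  next
    case (step y z)
    from step(2) obtain l where l: "l < m" "y = ch l" "z = pa l" by (auto simp: R_def)
    from step(3) obtain k where k: "k < m" "x = ch k" "\<forall>j\<le>k. y \<noteq> ch j" by blast
    with l have "k < l" using not_le by blast
    have "z \<noteq> ch j" if "j \<le> l" for j using ch_later[of j l] ch_neq_pa[of l] l that by (metis le_neq_implies_less)
    then have "\<forall>j\<le>k. z \<noteq> ch j" using \<open>k < l\<close> by simp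
    with k show ?case by blast
  qed
  then show ?thesis using that by blast
qed

lemma acyclic_R: "(x, x) \<notin> R\<^sup>+"
  using trancl_R by blast

lemma R_comparable: "(s, x) \<in> R\<^sup>* \<Longrightarrow> (s, y) \<in> R\<^sup>* \<Longrightarrow> (x, y) \<in> R\<^sup>* \<or> (y, x) \<in> R\<^sup>*"
  using single_valued_confluent[OF single_valued_R] by blast

lemma R_less: "(s, t) \<in> R\<^sup>* \<Longrightarrow> s < n \<Longrightarrow> t < n"
  by (induction rule: rtrancl_induct) (auto simp: R_def pa_less)

text \<open>The top \<open>t\<close> is left out, so an arm consists of the children of its edges:
  edge \<open>j\<close> lies on the way from \<open>s\<close> up to \<open>t\<close> iff
  \<open>ch j\<close> belongs to the arm.\<close>

definition arm :: "nat \<Rightarrow> nat \<Rightarrow> nat set" where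
  "arm s t = {x. (s, x) \<in> R\<^sup>* \<and> (x, t) \<in> R\<^sup>+}"

lemma arm_refl [simp]: "arm s s = {}"
  using acyclic_R by (auto simp: arm_def dest: rtrancl_trancl_trancl)

lemma R_ch: "k < m \<Longrightarrow> (ch k, pa k) \<in> R"
  by (auto simp: R_def)

lemma ch_trancl: "k < m \<Longrightarrow> (ch k, x) \<in> R\<^sup>+ \<Longrightarrow> (pa k, x) \<in> R\<^sup>*"
  by (metis R_ch single_valuedD single_valued_R tranclD)

lemma arm_pa:
  assumes "k < m" "(s, ch k) \<in> R\<^sup>*"
  shows "arm s (pa k) = insert (ch k) (arm s (ch k))"
proof (intro equalityI subsetI)
  fix x assume "x \<in> arm s (pa k)"
  then have x: "(s, x) \<in> R\<^sup>*" "(x, pa k) \<in> R\<^sup>+" by (auto simp: arm_def)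
  from R_comparable[OF x(1) assms(2)] show "x \<in> insert (ch k) (arm s (ch k))"
  proof
    assume "(x, ch k) \<in> R\<^sup>*"
    then show ?thesis using x(1) by (auto simp: arm_def rtrancl_eq_or_trancl)
  next
    assume *: "(ch k, x) \<in> R\<^sup>*"
    have "(ch k, x) \<notin> R\<^sup>+"
      using ch_trancl[OF assms(1)] x(2) acyclic_R by (meson rtrancl_trancl_trancl)
    with * show ?thesis by (auto simp: rtrancl_eq_or_trancl)
  qed
next
  fix x assume "x \<in> insert (ch k) (arm s (ch k))"
  then show "x \<in> arm s (pa k)"
    using assms R_ch[OF assms(1)] by (auto simp: arm_def)
qed

lemma arm_less: "s < n \<Longrightarrow> x \<in> arm s t \<Longrightarrow> x < n"
  by (auto simp: arm_def intro: R_less)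

text \<open>A triple \<open>(s, s', t)\<close> stands for the path from \<open>s\<close> up to \<open>t\<close> and from there down to \<open>s'\<close>.\<close>

definition valid :: "nat \<times> nat \<times> nat \<Rightarrow> bool" where
  "valid = (\<lambda>(a, b, t). a < n \<and> b < n \<and> (a, t) \<in> R\<^sup>* \<and> (b, t) \<in> R\<^sup>* \<and> arm a t \<inter> arm b t = {})"

definition covers :: "nat \<Rightarrow> nat \<times> nat \<times> nat \<Rightarrow> bool" where
  "covers j = (\<lambda>(a, b, t). ch j \<in> arm a t \<union> arm b t)"

text \<open>Sorting the endpoints gives a path and its reversal the same table cell.\<close>

definition norm3 :: "nat \<Rightarrow> nat \<Rightarrow> nat \<Rightarrow> nat \<times> nat \<times> nat" where
  "norm3 a b t = (if b < a then (b, a, t) else (a, b, t))"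

lemma valid_norm3 [simp]: "valid (norm3 a b t) = valid (a, b, t)"
  and covers_norm3 [simp]: "covers j (norm3 a b t) = covers j (a, b, t)"
  by (auto simp: norm3_def valid_def covers_def)

text \<open>Two tops are comparable as ancestors of \<open>a\<close>. If they differed, the lower
  one would lie in both arms below the higher one, against disjointness. Hence one stored top per
  pair of endpoints suffices.\<close>

lemma valid_unique:
  assumes "valid (a, b, t)" "valid (a, b, t')"
  shows "t = t'"
proof -
  have "t1 = t2" if v: "valid (a, b, t1)" "valid (a, b, t2)" and "(t1, t2) \<in> R\<^sup>*" for t1 t2
  proof (rule ccontr)
    assume "t1 \<noteq> t2"
    with that have "(t1, t2) \<in> R\<^sup>+" by (simp add: rtrancl_eq_or_trancl)
    then have "t1 \<in> arm a t2 \<inter> arm b t2" using v(1) by (auto simp: arm_def valid_def)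
    with v(2) show False by (auto simp: valid_def)
  qed
  moreover have "(t, t') \<in> R\<^sup>* \<or> (t', t) \<in> R\<^sup>*" using R_comparable assms by (auto simp: valid_def)
  ultimately show ?thesis using assms by blast
qed

subsection \<open>Configurations of finished and open paths\<close>

definition total :: "(nat \<Rightarrow> nat list \<Rightarrow> nat) \<Rightarrow> (nat \<Rightarrow> nat list) \<Rightarrow> nat" where
  "total f op = (\<Sum>v<n. f v (op v))"

text \<open>The update is written with sums on both sides to avoid subtraction of naturals.\<close>

lemma total_upd: "v < n \<Longrightarrow> total f (op(v := xs)) + f v (op v) = total f op + f v xs"
proof -
  assume v: "v < n"
  have "(\<Sum>u\<in>{..<n} - {v}. f u ((op(v := xs)) u)) = (\<Sum>u\<in>{..<n} - {v}. f u (op u))"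
    by (intro sum.cong) auto
  then show ?thesis using v by (simp add: total_def sum.remove[of "{..<n}" v])
qed

definition count :: "nat \<Rightarrow> (nat \<times> nat \<times> nat) list \<Rightarrow> (nat \<Rightarrow> nat list) \<Rightarrow> nat" where
  "count j fin op = length (filter (covers j) fin) + total (\<lambda>v xs. length (filter (\<lambda>s. ch j \<in> arm s v) xs)) op"

text \<open>
  In the middle of step \<open>k\<close>, \<open>q\<close> paths already contain its edge, and open paths consist of
  edges of the steps before \<open>k'\<close>; there are \<open>N\<close> paths altogether.
\<close>

definition config :: "(nat \<Rightarrow> nat) \<Rightarrow> nat \<Rightarrow> nat \<Rightarrow> nat \<Rightarrow> int \<Rightarrow> (nat \<times> nat \<times> nat) list \<Rightarrow> (nat \<Rightarrow> nat list) \<Rightarrow> bool" where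
  "config F k k' q N fin op \<longleftrightarrow>
     (\<forall>x\<in>set fin. valid x) \<and>
     (\<forall>v. \<forall>s\<in>set (op v). s < n \<and> v < n \<and> (s, v) \<in> R\<^sup>* \<and> arm s v \<subseteq> ch ` {..<k'}) \<and>
     (\<forall>j<m. count j fin op = (if j < k then F j else if j = k then q else 0)) \<and>
     int (length fin + total (\<lambda>_. length) op) = N"

lemma config_open:
  "config F k k' q N fin op \<Longrightarrow> s \<in> set (op v) \<Longrightarrow>
    s < n \<and> v < n \<and> (s, v) \<in> R\<^sup>* \<and> arm s v \<subseteq> ch ` {..<k'}"
  by (simp add: config_def)

lemma config_init:
  assumes "\<And>v. v \<ge> n \<Longrightarrow> op v = []" "\<And>v. set (op v) \<subseteq> {v}"
  shows "config F 0 0 0 (int (\<Sum>v<n. length (op v))) [] op"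
proof -
  have *: "s = v \<and> v < n" if "s \<in> set (op v)" for s v
    using that assms[of v] by (cases "v < n") auto
  then have "filter (\<lambda>s. ch j \<in> arm s v) (op v) = []" for j v
    unfolding filter_empty_conv by (metis arm_refl empty_iff)
  moreover have "(s, v) \<in> R\<^sup>* \<and> arm s v \<subseteq> X" if "s \<in> set (op v)" for s v X
    using *[OF that] by simp
  ultimately show ?thesis using * unfolding config_def
    by (simp add: count_def total_def) blast
qed

text \<open>An open path is vertical with upper end \<open>v\<close>; finished there, it has top
  \<open>v\<close> and an empty first arm.\<close>

lemma config_close:
  assumes "config F k k' q N fin op" "op v = xs @ [s]"
  shows "config F k k' q N (norm3 v s v # fin) (op(v := xs))"
proof -
  have s: "s < n" "v < n" "(s, v) \<in> R\<^sup>*"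
    using config_open[OF assms(1), of s v] assms(2) by auto
  have "covers j (norm3 v s v) \<longleftrightarrow> ch j \<in> arm s v" for j
    by (simp only: covers_norm3) (simp add: covers_def)
  then have "count j (norm3 v s v # fin) (op(v := xs)) = count j fin op" for j
    using total_upd[OF s(2), of "\<lambda>v xs. length (filter (\<lambda>s. ch j \<in> arm s v) xs)" op xs] assms(2)
    by (simp add: count_def split: if_splits)
  moreover have "length (norm3 v s v # fin) + total (\<lambda>_. length) (op(v := xs)) = length fin + total (\<lambda>_. length) op"
    using total_upd[OF s(2), of "\<lambda>_. length" op xs] assms(2) by simp
  moreover have "valid (norm3 v s v)" using s by (simp only: valid_norm3) (simp add: valid_def)
  moreover have "u \<in> set ((op(v := xs)) x) \<Longrightarrow> u \<in> set (op x)" for u x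
    using assms(2) by (auto split: if_splits)
  ultimately show ?thesis using assms(1) unfolding config_def
    by (simp del: fun_upd_apply) blast
qed

lemma config_start:
  assumes "config F k k' q N fin op" "v < n"
  shows "config F k k' q (N + 1) fin (op(v := op v @ [v]))"
proof -
  have "count j fin (op(v := op v @ [v])) = count j fin op" for j
    using total_upd[OF assms(2), of "\<lambda>v xs. length (filter (\<lambda>s. ch j \<in> arm s v) xs)" op "op v @ [v]"]
    by (simp add: count_def)
  moreover have "total (\<lambda>_. length) (op(v := op v @ [v])) = total (\<lambda>_. length) op + 1"
    using total_upd[OF assms(2), of "\<lambda>_. length" op "op v @ [v]"] by simp
  ultimately show ?thesis using assms by (auto simp: config_def)
qed

text \<open>The open path at \<open>pa k\<close> uses only edges of earlier steps, so it avoids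
  \<open>ch k\<close>. A vertex shared by both arms would lie below \<open>ch k\<close> and put
  \<open>ch k\<close> on that path. Therefore the union is again a simple path, and two paths become
  one.\<close>

lemma config_join:
  assumes "config F k k q N fin op" "k < m" "op (pa k) = ys @ [y]" "op (ch k) = zs @ [z]"
  shows "config F k k (Suc q) (N - 1) (norm3 y z (pa k) # fin) (op(pa k := ys, ch k := zs))"
proof -
  let ?p = "pa k" and ?c = "ch k"
  have y: "y < n" "?p < n" "(y, ?p) \<in> R\<^sup>*" "arm y ?p \<subseteq> ch ` {..<k}"
    and z: "z < n" "?c < n" "(z, ?c) \<in> R\<^sup>*"
    using config_open[OF assms(1), of y ?p] config_open[OF assms(1), of z ?c] assms(3,4) by auto
  have cp: "?c \<noteq> ?p" using ch_neq_pa[OF assms(2)] by simp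
  have "?c \<noteq> ch j" if "j < k" for j using ch_later[OF that assms(2)] by simp
  then have cy: "?c \<notin> arm y ?p" using y(4) by auto
  have az: "arm z ?p = insert ?c (arm z ?c)" using arm_pa[OF assms(2) z(3)] .
  have disj: "arm y ?p \<inter> arm z ?p = {}"
  proof (rule ccontr)
    assume "arm y ?p \<inter> arm z ?p \<noteq> {}"
    then obtain x where x: "x \<in> arm y ?p" "x \<in> arm z ?c" using az cy by auto
    then have "?c \<in> arm y ?p" using R_ch[OF assms(2)]
      by (auto simp: arm_def intro: rtrancl_trans trancl_into_rtrancl)
    with cy show False by simp
  qed
  have cz: "?c \<notin> arm z ?c" using acyclic_R by (auto simp: arm_def)
  have "valid (y, z, ?p)" using y z disj R_ch[OF assms(2)] by (auto simp: valid_def)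
  moreover have "count j (norm3 y z ?p # fin) (op(?p := ys, ?c := zs)) = count j fin op + (if j = k then 1 else 0)"
    if "j < m" for j
  proof -
    let ?f = "\<lambda>v xs. length (filter (\<lambda>s. ch j \<in> arm s v) xs)"
    have "total ?f (op(?p := ys, ?c := zs)) + ?f ?p (op ?p) + ?f ?c (op ?c) = total ?f op + ?f ?p ys + ?f ?c zs"
      using total_upd[OF y(2), of ?f op ys] total_upd[OF z(2), of ?f "op(?p := ys)" zs] cp by simp
    moreover have "ch j = ?c \<longleftrightarrow> j = k" using ch_inj assms(2) that by blast
    then have "(if covers j (y, z, ?p) then 1 else 0) = (if ch j \<in> arm y ?p then 1 else 0) +
        (if ch j \<in> arm z ?c then 1 else 0) + (if j = k then 1 else 0 :: nat)"
      using disj cy cz by (auto simp: covers_def az)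
    ultimately show ?thesis
      by (simp add: count_def assms(3,4) split: if_splits)
  qed
  moreover have "u \<in> set ((op(?p := ys, ?c := zs)) x) \<Longrightarrow> u \<in> set (op x)" for u x
    using assms(3,4) by (auto split: if_splits)
  moreover have "total (\<lambda>_. length) (op(?p := ys, ?c := zs)) + 2 = total (\<lambda>_. length) op"
    using total_upd[OF y(2), of "\<lambda>_. length" op ys]
      total_upd[OF z(2), of "\<lambda>_. length" "op(?p := ys)" zs] cp assms(3,4) by simp
  ultimately show ?thesis using assms(1) unfolding config_def
    by (simp del: fun_upd_apply) (metis Suc_eq_plus1)
qed

text \<open>After a move, paths open at \<open>pa k\<close> contain edge \<open>k\<close>, hence the
  bound \<open>Suc k\<close>. All joins of the step must therefore be made before the first
  move.\<close>

lemma config_move: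
  assumes "config F k (Suc k) q N fin op" "k < m" "op (ch k) = zs @ [z]"
  shows "config F k (Suc k) (Suc q) N fin (op(pa k := op (pa k) @ [z], ch k := zs))"
proof -
  let ?p = "pa k" and ?c = "ch k"
  have z: "z < n" "?c < n" "(z, ?c) \<in> R\<^sup>*" "arm z ?c \<subseteq> ch ` {..<Suc k}"
    using config_open[OF assms(1), of z ?c] assms(3) by auto
  have cp: "?c \<noteq> ?p" using ch_neq_pa[OF assms(2)] by simp
  have p: "?p < n" using pa_less[OF assms(2)] .
  have az: "arm z ?p = insert ?c (arm z ?c)" using arm_pa[OF assms(2) z(3)] .
  have cz: "?c \<notin> arm z ?c" using acyclic_R by (auto simp: arm_def)
  have "count j fin (op(?p := op ?p @ [z], ?c := zs)) = count j fin op + (if j = k then 1 else 0)"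
    if "j < m" for j
  proof -
    let ?f = "\<lambda>v xs. length (filter (\<lambda>s. ch j \<in> arm s v) xs)"
    have "total ?f (op(?p := op ?p @ [z], ?c := zs)) + ?f ?p (op ?p) + ?f ?c (op ?c) =
        total ?f op + ?f ?p (op ?p @ [z]) + ?f ?c zs"
      using total_upd[OF p, of ?f op "op ?p @ [z]"] total_upd[OF z(2), of ?f "op(?p := op ?p @ [z])" zs] cp by simp
    moreover have "ch j = ?c \<longleftrightarrow> j = k" using ch_inj assms(2) that by blast
    ultimately show ?thesis using cz unfolding count_def by (auto simp: az assms(3) split: if_splits)
  qed
  moreover have "total (\<lambda>_. length) (op(?p := op ?p @ [z], ?c := zs)) = total (\<lambda>_. length) op"
    using total_upd[OF p, of "\<lambda>_. length" op "op ?p @ [z]"]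
      total_upd[OF z(2), of "\<lambda>_. length" "op(?p := op ?p @ [z])" zs] cp assms(3) by simp
  moreover have "(z, ?p) \<in> R\<^sup>*" "arm z ?p \<subseteq> ch ` {..<Suc k}"
    using z R_ch[OF assms(2)] by (auto simp: az)
  moreover have "s < n \<and> v < n \<and> (s, v) \<in> R\<^sup>* \<and> arm s v \<subseteq> ch ` {..<Suc k}"
    if "s \<in> set ((op(?p := op ?p @ [z], ?c := zs)) v)" for s v
  proof -
    from that have "s \<in> set (op v) \<or> v = ?p \<and> s = z" using assms(3) cp by (auto split: if_splits)
    then show ?thesis using config_open[OF assms(1)] calculation z(1) p by blast
  qed
  ultimately show ?thesis using assms by (simp add: config_def)
qed

lemma config_mono: "config F k k' q N fin op \<Longrightarrow> k' \<le> k'' \<Longrightarrow> config F k k'' q N fin op"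
  by (fastforce simp: config_def)

lemma config_next:
  assumes "config F k k' (F k) N fin op"
  shows "config F (Suc k) k' 0 N fin op"
  using assms by (auto simp: config_def less_Suc_eq)

end

section \<open>Lines and their endpoints\<close>

lemma path_edges_Nil [simp]: "path_edges [] = {}"
  and path_edges_single [simp]: "path_edges [x] = {}"
  by (auto simp: path_edges_def)

lemma path_edges_Cons [simp]: "path_edges (x # y # p) = insert {x, y} (path_edges (y # p))"
proof (intro equalityI subsetI)
  fix e assume "e \<in> path_edges (x # y # p)"
  then obtain i where i: "e = {(x # y # p) ! i, (x # y # p) ! Suc i}" "Suc i < length (x # y # p)"
    by (auto simp: path_edges_def)
  then show "e \<in> insert {x, y} (path_edges (y # p))"
    by (cases i) (auto simp: path_edges_def)
next
  fix e assume "e \<in> insert {x, y} (path_edges (y # p))"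
  then consider "e = {x, y}" | i where "e = {(y # p) ! i, (y # p) ! Suc i}" "Suc i < length (y # p)"
    by (auto simp: path_edges_def)
  then show "e \<in> path_edges (x # y # p)"
  proof cases
    case 1
    then show ?thesis unfolding path_edges_def by (intro CollectI exI[of _ 0]) auto
  next
    case 2
    then show ?thesis unfolding path_edges_def by (intro CollectI exI[of _ "Suc i"]) auto
  qed
qed

lemma path_edges_append: "path_edges (p @ x # q) = path_edges (p @ [x]) \<union> path_edges (x # q)"
proof (induction p)
  case (Cons y p)
  then show ?case by (cases p) auto
qed simp

lemma path_edges_rev [simp]: "path_edges (rev p) = path_edges p"
proof (induction p)
  case (Cons x p)
  show ?case
  proof (cases p)
    case (Cons y q)
    then show ?thesis
      using \<open>path_edges (rev p) = path_edges p\<close> path_edges_append[of "rev q" y "[x]"] by (simp add: insert_commute)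
  qed simp
qed simp

lemma path_edges_subset: "e \<in> path_edges p \<Longrightarrow> e \<subseteq> set p"
  by (auto simp: path_edges_def)

lemma finite_path_edges [simp]: "finite (path_edges p)"
  by (rule finite_subset[of _ "Pow (set p)"]) (auto dest: path_edges_subset)

lemma path_edges_fresh: "x \<notin> set p \<Longrightarrow> x \<in> e \<Longrightarrow> e \<notin> path_edges p"
  using path_edges_subset by blast

lemma card_path_edges: "distinct p \<Longrightarrow> p \<noteq> [] \<Longrightarrow> card (path_edges p) + 1 = length p"
proof (induction p)
  case (Cons x p)
  show ?case
  proof (cases p)
    case (Cons y q)
    then have "{x, y} \<notin> path_edges p" using Cons.prems path_edges_fresh[of x p] by auto
    then show ?thesis using Cons.IH Cons.prems Cons by simp
  qed simp
qed simp

text \<open>Every visited vertex has two slots, each filled by an edge or by an end of the path; a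
  one-vertex path has both its ends there. The identity serves to count path ends in the lower bound
  and to recover the endpoints from a line.\<close>

lemma path_degree:
  assumes "distinct p" "p \<noteq> []"
  shows "card {e \<in> path_edges p. v \<in> e} + of_bool (v = hd p) + of_bool (v = last p) = 2 * of_bool (v \<in> set p)"
  using assms
proof (induction p)
  case (Cons x p)
  show ?case
  proof (cases p)
    case Nil
    then show ?thesis by simp
  next
    case (Cons y q)
    let ?S = "{e \<in> path_edges p. v \<in> e}"
    have fresh: "{x, y} \<notin> path_edges p" using Cons.prems path_edges_fresh[of x p] Cons by auto
    have "{e \<in> path_edges (x # p). v \<in> e} = (if v \<in> {x, y} then insert {x, y} ?S else ?S)"
      using Cons by auto
    then have "card {e \<in> path_edges (x # p). v \<in> e} = card ?S + of_bool (v \<in> {x, y})"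
      using fresh by (auto simp: card_insert_if)
    moreover have "card ?S + of_bool (v = y) + of_bool (v = last p) = 2 * of_bool (v \<in> set p)"
      using Cons.IH Cons.prems Cons by simp
    moreover have "x \<notin> set p" "last p \<in> set p" "y \<in> set p" "last (x # p) = last p" "x \<noteq> y"
      using Cons.prems Cons by auto
    ultimately show ?thesis by (cases "v = x"; cases "v = y") auto
  qed
qed simp

lemma lines_pathE:
  assumes "l \<in> lines I"
  obtains p where "simple_path I p" "fst l = set p" "snd l = path_edges p"
  using assms by (auto simp: lines_def path_line_def)

lemma finite_lines:
  assumes "finite (verts I)"
  shows "finite (lines I)"
proof -
  have "{p. simple_path I p} \<subseteq> {p. set p \<subseteq> verts I \<and> length p \<le> card (verts I)}"
    using assms by (auto simp: simple_path_def) (metis card_mono distinct_card)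
  then show ?thesis
    using finite_lists_length_le[OF assms] unfolding lines_def by (meson finite_imageI finite_subset)
qed

section \<open>Optimality of the dynamic program\<close>

locale lp_peeling = peeling +
  fixes I :: "nat lp_instance" and B :: nat
  assumes verts: "verts I = {..<n}"
    and edges: "edges I = (\<lambda>k. {ch k, pa k}) ` {..<m}"
    and bounds: "e \<in> edges I \<Longrightarrow> fmin I e \<le> fmax I e \<and> 0 \<le> fmax I e \<and> fmax I e \<le> int B"
    and cfix_nonneg: "cfix I \<ge> 0"
    and dfix_0: "dfix I = 0"
begin

definition edge :: "nat \<Rightarrow> nat set" where "edge k = {ch k, pa k}"

lemma edges': "edges I = edge ` {..<m}"
  by (simp add: edges edge_def)

lemma edge_inj: "inj_on edge {..<m}"
proof -
  have "edge j \<noteq> edge k" if "j < k" "k < m" for j k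
    using ch_later[OF that] by (auto simp: edge_def doubleton_eq_iff)
  then show ?thesis by (intro inj_onI) (metis lessThan_iff linorder_neqE_nat)
qed

text \<open>Negative lower bounds are allowed. Since frequencies are nonnegative, \<open>nat\<close>
  may raise them to 0, while the assumed \<open>0 \<le> fmax I e\<close> makes the conversion of
  upper bounds faithful.\<close>

abbreviation "lo \<equiv> \<lambda>k. nat (fmin I (edge k))"
abbreviation "hi \<equiv> \<lambda>k. nat (fmax I (edge k))"
abbreviation "wt \<equiv> \<lambda>k. ecost I (edge k)"

sublocale peel_dp n m root ch pa B lo hi wt "cfix I"
proof
  show "lo k \<le> hi k" "hi k \<le> B" if "k < m" for k
    using bounds[of "edge k"] that by (auto simp: edges')
qed (rule cfix_nonneg)

lemma sum_line_edges:
  assumes "S \<subseteq> edges I"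
  shows "sum g S = (\<Sum>k<m. if edge k \<in> S then g (edge k) else 0)"
proof -
  have "S = edge ` {k. k < m \<and> edge k \<in> S}" using assms by (auto simp: edges')
  moreover have "inj_on edge {k. k < m \<and> edge k \<in> S}" by (rule inj_on_subset[OF edge_inj]) auto
  ultimately have "sum g S = (\<Sum>k | k < m \<and> edge k \<in> S. g (edge k))" by (metis (no_types, lifting) sum.reindex_cong)
  also have "\<dots> = (\<Sum>k<m. if edge k \<in> S then g (edge k) else 0)"
    by (simp add: sum.inter_filter[symmetric] lessThan_def)
  finally show ?thesis .
qed

lemma lines_edges: "l \<in> lines I \<Longrightarrow> snd l \<subseteq> edges I"
  by (auto elim!: lines_pathE simp: simple_path_def)

text \<open>The path-free bound is applied to the edge and vertex visit counts of the concept;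
  \<open>path_degree\<close>, summed over the lines, supplies its degree hypothesis.\<close>

lemma lower_bound:
  assumes "feasible I L f"
  obtains r where "r \<le> B" "A m root r \<le> concept_cost I L f"
proof -
  define F where "F k = (\<Sum>l\<in>L. if edge k \<in> snd l then f l else 0)" for k
  define N where "N v = (\<Sum>l\<in>L. if v \<in> fst l then f l else 0)" for v
  have L: "L \<subseteq> lines I" using assms by (simp add: feasible_def)
  have finL: "finite L" using L finite_lines[of I] verts by (auto intro: finite_subset)
  have Fsum: "(\<Sum>l | l \<in> L \<and> edge k \<in> snd l. int (f l)) = int (F k)" for k
    using finL by (auto simp: F_def sum.inter_filter intro!: sum.cong)
  have F: "lo k \<le> F k \<and> F k \<le> hi k" if "k < m" for k
  proof -
    have "edge k \<in> edges I" using that by (simp add: edges')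
    then have "fmin I (edge k) \<le> int (F k)" "int (F k) \<le> fmax I (edge k)"
      using assms Fsum[of k] by (auto simp: feasible_def)
    then show ?thesis by linarith
  qed
  have vl: "v \<in> fst l" if "l \<in> L" "edge k \<in> snd l" "v \<in> edge k" for l k v
    using that L by (auto elim!: lines_pathE dest!: path_edges_subset)
  have FN: "F k \<le> N (ch k) \<and> F k \<le> N (pa k)" if "k < m" for k
    using vl unfolding F_def N_def by (auto intro!: sum_mono simp: edge_def)
  have deg: "degree_load F v = (\<Sum>l\<in>L. f l * card {e \<in> snd l. v \<in> e})" for v
  proof -
    have "degree_load F v = (\<Sum>k<m. if v \<in> edge k then F k else 0)"
      unfolding degree_load_def by (subst sum.inter_filter[symmetric]) (auto simp: edge_def intro!: sum.cong)
    also have "\<dots> = (\<Sum>k<m. \<Sum>l\<in>L. if v \<in> edge k \<and> edge k \<in> snd l then f l else 0)"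
      by (auto simp: F_def intro!: sum.cong)
    also have "\<dots> = (\<Sum>l\<in>L. \<Sum>k<m. if v \<in> edge k \<and> edge k \<in> snd l then f l else 0)"
      by (rule sum.swap)
    also have "\<dots> = (\<Sum>l\<in>L. \<Sum>e\<in>{e \<in> snd l. v \<in> e}. f l)"
    proof (rule sum.cong)
      fix l assume "l \<in> L"
      then have "{e \<in> snd l. v \<in> e} \<subseteq> edges I" using L lines_edges by blast
      from sum_line_edges[OF this, of "\<lambda>_. f l"]
      show "(\<Sum>k<m. if v \<in> edge k \<and> edge k \<in> snd l then f l else 0) = (\<Sum>e\<in>{e \<in> snd l. v \<in> e}. f l)"
        by (simp add: conj_commute)
    qed simp
    also have "\<dots> = (\<Sum>l\<in>L. f l * card {e \<in> snd l. v \<in> e})" by (simp add: mult.commute)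
    finally show ?thesis .
  qed
  have d2: "degree_load F v \<le> 2 * N v" for v
  proof -
    have "f l * card {e \<in> snd l. v \<in> e} \<le> 2 * (if v \<in> fst l then f l else 0)" if l: "l \<in> L" for l
    proof -
      obtain p where p: "simple_path I p" "fst l = set p" "snd l = path_edges p"
        using l L lines_pathE by blast
      then have "card {e \<in> snd l. v \<in> e} \<le> 2 * of_bool (v \<in> fst l)"
        using path_degree[of p v] by (auto simp: simple_path_def)
      then have "f l * card {e \<in> snd l. v \<in> e} \<le> f l * (2 * of_bool (v \<in> fst l))" by (rule mult_left_mono) simp
      also have "\<dots> = 2 * (if v \<in> fst l then f l else 0)" by simp
      finally show ?thesis .
    qed
    then show ?thesis unfolding deg N_def sum_distrib_left by (rule sum_mono)
  qed
  have sumN: "(\<Sum>v<n. N v) = (\<Sum>l\<in>L. f l * card (fst l))"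
  proof -
    have "(\<Sum>v<n. N v) = (\<Sum>l\<in>L. \<Sum>v<n. if v \<in> fst l then f l else 0)"
      unfolding N_def by (rule sum.swap)
    also have "\<dots> = (\<Sum>l\<in>L. f l * card (fst l))"
    proof (rule sum.cong)
      fix l assume "l \<in> L"
      then have "l \<in> lines I" using L by blast
      then have "{v \<in> {..<n}. v \<in> fst l} = fst l"
        by (auto elim!: lines_pathE simp: simple_path_def verts)
      then show "(\<Sum>v<n. if v \<in> fst l then f l else 0) = f l * card (fst l)"
        by (simp add: sum.inter_filter[symmetric] mult.commute)
    qed simp
    finally show ?thesis .
  qed
  have sumg: "(\<Sum>k<m. g (edge k) * real (F k)) = (\<Sum>l\<in>L. real (f l) * (\<Sum>e\<in>snd l. g e))" for g
  proof -
    have "(\<Sum>k<m. g (edge k) * real (F k)) = (\<Sum>k<m. \<Sum>l\<in>L. if edge k \<in> snd l then real (f l) * g (edge k) else 0)"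
      by (auto simp: F_def sum_distrib_left of_nat_sum intro!: sum.cong)
    also have "\<dots> = (\<Sum>l\<in>L. \<Sum>k<m. if edge k \<in> snd l then real (f l) * g (edge k) else 0)" by (rule sum.swap)
    also have "\<dots> = (\<Sum>l\<in>L. real (f l) * (\<Sum>e\<in>snd l. g e))"
      using L lines_edges
      by (auto simp: sum_distrib_left subset_eq sum_line_edges[of _ "\<lambda>e. real (f _) * g e"] intro!: sum.cong)
    finally show ?thesis .
  qed
  have sumdeg: "(\<Sum>v<n. degree_load F v) = 2 * (\<Sum>k<m. F k)"
  proof -
    have "(\<Sum>v<n. degree_load F v) = (\<Sum>v<n. \<Sum>k<m. if v \<in> edge k then F k else 0)"
      unfolding degree_load_def by (subst sum.inter_filter[symmetric]) (auto simp: edge_def intro!: sum.cong)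
    also have "\<dots> = (\<Sum>k<m. \<Sum>v<n. if v \<in> edge k then F k else 0)" by (rule sum.swap)
    also have "\<dots> = (\<Sum>k<m. 2 * F k)"
    proof (rule sum.cong)
      fix k assume "k \<in> {..<m}"
      then have "{v \<in> {..<n}. v \<in> edge k} = {ch k, pa k}" "ch k \<noteq> pa k"
        using ch_less pa_less ch_neq_pa by (auto simp: edge_def)
      then show "(\<Sum>v<n. if v \<in> edge k then F k else 0) = 2 * F k"
        by (simp add: sum.inter_filter[symmetric])
    qed simp
    finally show ?thesis by (simp add: sum_distrib_left)
  qed
  \<comment> \<open>The excess is twice the number of vertex visits minus twice the number of edge
    visits. A path has one more vertex than edges, so every line contributes exactly 2 for each unit
    of frequency.\<close>
  have "real (\<Sum>v<n. 2 * N v - degree_load F v) = 2 * (\<Sum>v<n. real (N v)) - real (\<Sum>v<n. degree_load F v)"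
    using d2 by (simp add: of_nat_diff sum_subtractf sum_distrib_left)
  also have "\<dots> = 2 * real (\<Sum>v<n. N v) - 2 * (\<Sum>k<m. 1 * real (F k))"
    by (simp add: sumdeg)
  also have "\<dots> = 2 * (\<Sum>l\<in>L. real (f l) * (real (card (fst l)) - (\<Sum>e\<in>snd l. 1)))"
    unfolding sumN sumg[of "\<lambda>_. 1"] by (simp add: sum_subtractf algebra_simps)
  also have "\<dots> = 2 * (\<Sum>l\<in>L. real (f l))"
  proof -
    have "real (card (fst l)) - (\<Sum>e\<in>snd l. 1) = 1" if l: "l \<in> L" for l
    proof -
      obtain p where p: "simple_path I p" "fst l = set p" "snd l = path_edges p"
        using l L lines_pathE by blast
      then show ?thesis using card_path_edges[of p] distinct_card[of p] by (simp add: simple_path_def)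
    qed
    then show ?thesis by simp
  qed
  finally have X: "real (\<Sum>v<n. 2 * N v - degree_load F v) = 2 * (\<Sum>l\<in>L. real (f l))" .
  have cost: "concept_cost I L f = (\<Sum>k<m. wt k * real (F k)) + cfix I * (\<Sum>l\<in>L. real (f l))"
    unfolding concept_cost_def dfix_0 sumg[of "ecost I"]
    by (simp add: sum.distrib sum_distrib_left algebra_simps)
  from dp_lower_bound[OF F FN d2] obtain r where "r \<le> B"
    "2 * A m root r \<le> 2 * (\<Sum>j<m. wt j * real (F j)) + cfix I * real (\<Sum>v<n. 2 * N v - degree_load F v)"
    by blast
  then show ?thesis using that[of r] unfolding X cost by simp
qed

text \<open>The construction yields paths with repetitions. With no fixed cost per distinct line,
  turning repetitions into frequencies leaves the cost unchanged.\<close>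

lemma concept_of_list:
  assumes ls: "set ls \<subseteq> lines I"
    and F: "\<And>k. k < m \<Longrightarrow> length (filter (\<lambda>l. edge k \<in> snd l) ls) = F k"
    and lohi: "\<And>k. k < m \<Longrightarrow> lo k \<le> F k \<and> F k \<le> hi k"
  shows "feasible I (set ls) (count_list ls)"
    and "concept_cost I (set ls) (count_list ls) = cfix I * real (length ls) + (\<Sum>k<m. wt k * real (F k))"
proof -
  have gen: "(\<Sum>l\<in>set xs. real (count_list xs l) * g l) = (\<Sum>l\<leftarrow>xs. g l)" for xs :: "nat line list" and g
  proof -
    \<comment> \<open>A fixed superset \<open>X\<close> as index set keeps the sum stable when the
      list grows in the induction.\<close>
    have "(\<Sum>l\<in>X. real (count_list xs l) * g l) = (\<Sum>l\<leftarrow>xs. g l)" if "finite X" "set xs \<subseteq> X" for X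
      using that(2)
    proof (induction xs)
      case (Cons x xs)
      have "(\<Sum>l\<in>X. real (count_list (x # xs) l) * g l) =
          (\<Sum>l\<in>X. (if l = x then g l else 0) + real (count_list xs l) * g l)"
        by (intro sum.cong) (auto simp: algebra_simps)
      then show ?case using Cons that(1) by (simp add: sum.distrib)
    qed simp
    then show ?thesis by blast
  qed
  have cnt: "(\<Sum>l | l \<in> set ls \<and> P l. int (count_list ls l)) = int (length (filter P ls))" for P
  proof -
    have "(\<Sum>l | l \<in> set ls \<and> P l. int (count_list ls l)) = (\<Sum>l\<in>set ls. int (count_list ls l * (if P l then 1 else 0)))"
      by (subst sum.inter_filter) (auto intro!: sum.cong)
    also have "\<dots> = int (\<Sum>l\<leftarrow>ls. if P l then 1 else 0)"
      by (simp only: sum_list_map_eq_sum_count of_nat_sum)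
    also have "(\<Sum>l\<leftarrow>ls. if P l then 1 else 0) = length (filter P ls)" by (induction ls) auto
    finally show ?thesis .
  qed
  have "fmin I (edge k) \<le> int (F k) \<and> int (F k) \<le> fmax I (edge k)" if "k < m" for k
    using lohi[OF that] bounds[of "edge k"] that by (auto simp: edges' nat_le_iff le_nat_iff)
  then show "feasible I (set ls) (count_list ls)"
    unfolding feasible_def using ls F by (auto simp: cnt edges')
  have "(\<Sum>l\<leftarrow>ls. cfix I + (\<Sum>e\<in>snd l. ecost I e)) = cfix I * real (length ls) + (\<Sum>k<m. wt k * real (length (filter (\<lambda>l. edge k \<in> snd l) ls)))"
    using ls
  proof (induction ls)
    case (Cons l ls)
    have "(\<Sum>e\<in>snd l. ecost I e) = (\<Sum>k<m. if edge k \<in> snd l then wt k else 0)"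
      using Cons.prems by (intro sum_line_edges lines_edges) auto
    moreover have "(\<Sum>k<m. wt k * real (length (filter (\<lambda>l. edge k \<in> snd l) (l # ls)))) =
        (\<Sum>k<m. if edge k \<in> snd l then wt k else 0) + (\<Sum>k<m. wt k * real (length (filter (\<lambda>l. edge k \<in> snd l) ls)))"
      unfolding sum.distrib[symmetric] by (rule sum.cong) (auto simp: algebra_simps)
    ultimately show ?case using Cons by (simp add: algebra_simps)
  qed simp
  then show "concept_cost I (set ls) (count_list ls) = cfix I * real (length ls) + (\<Sum>k<m. wt k * real (F k))"
    unfolding concept_cost_def dfix_0 gen using F by simp
qed

subsection \<open>The paths of a configuration\<close>

fun is_arm :: "nat list \<Rightarrow> nat \<Rightarrow> nat \<Rightarrow> bool" where
  "is_arm [] s t \<longleftrightarrow> s = t"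
| "is_arm (x # xs) s t \<longleftrightarrow> x = s \<and> (\<exists>k<m. s = ch k \<and> is_arm xs (pa k) t)"

lemma is_arm_exists: "(s, t) \<in> R\<^sup>* \<Longrightarrow> \<exists>xs. is_arm xs s t"
proof (induction rule: converse_rtrancl_induct)
  case base
  then show ?case using is_arm.simps(1) by blast
next
  case (step y z)
  then obtain k xs where "k < m" "y = ch k" "z = pa k" "is_arm xs z t" by (auto simp: R_def)
  then have "is_arm (y # xs) y t" by auto
  then show ?case by blast
qed

lemma is_arm_R: "is_arm xs s t \<Longrightarrow> (s, t) \<in> R\<^sup>*"
  by (induction xs s t rule: is_arm.induct) (auto intro: converse_rtrancl_into_rtrancl R_ch)

lemma arm_start: "k < m \<Longrightarrow> (pa k, t) \<in> R\<^sup>* \<Longrightarrow> arm (ch k) t = insert (ch k) (arm (pa k) t)"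
proof (intro equalityI subsetI)
  fix x assume k: "k < m" "(pa k, t) \<in> R\<^sup>*"
  {
    assume "x \<in> arm (ch k) t"
    then show "x \<in> insert (ch k) (arm (pa k) t)"
      using ch_trancl[OF k(1)] by (auto simp: arm_def rtrancl_eq_or_trancl)
  next
    assume "x \<in> insert (ch k) (arm (pa k) t)"
    then show "x \<in> arm (ch k) t" using R_ch[OF k(1)] k(2)
      by (auto simp: arm_def intro: converse_rtrancl_into_rtrancl rtrancl_into_trancl2)
  }
qed

lemma is_arm_set: "is_arm xs s t \<Longrightarrow> set xs = arm s t"
  by (induction xs s t rule: is_arm.induct) (auto simp: arm_start is_arm_R)

lemma is_arm_distinct: "is_arm xs s t \<Longrightarrow> distinct xs"
proof (induction xs s t rule: is_arm.induct)
  case (2 x xs s t)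
  then obtain k where k: "k < m" "s = ch k" "x = s" "is_arm xs (pa k) t" by auto
  have "ch k \<notin> arm (pa k) t"
    using R_ch[OF k(1)] acyclic_R by (auto simp: arm_def dest: rtrancl_into_trancl2)
  with 2 k show ?case by (auto simp: is_arm_set dest: ch_inj)
qed simp

lemma is_arm_unique: "is_arm xs s t \<Longrightarrow> is_arm ys s t \<Longrightarrow> xs = ys"
proof (induction xs s t arbitrary: ys rule: is_arm.induct)
  case (1 s t)
  then show ?case using is_arm_set[of ys s t] by auto
next
  case (2 x xs s t)
  then obtain k where k: "k < m" "s = ch k" "x = s" "is_arm xs (pa k) t" by auto
  have "s \<in> arm s t" using is_arm_set[OF 2(2)] k by auto
  then have "ys \<noteq> []" using is_arm_set[OF 2(3)] by auto
  then obtain y zs where ys: "ys = y # zs" by (cases ys) auto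
  with 2(3) k have "y = x" "is_arm zs (pa k) t" by (auto dest: ch_inj)
  with 2(1) k ys show ?case by blast
qed

lemma is_arm_hd: "is_arm xs s t \<Longrightarrow> hd (xs @ t # zs) = s"
  by (cases xs) auto

lemma is_arm_edges: "is_arm xs s t \<Longrightarrow> path_edges (xs @ [t]) = edge ` {k. k < m \<and> ch k \<in> set xs}"
proof (induction xs s t rule: is_arm.induct)
  case (2 x xs s t)
  then obtain k where k: "k < m" "s = ch k" "x = s" "is_arm xs (pa k) t" by auto
  have "path_edges (x # xs @ [t]) = insert (edge k) (path_edges (xs @ [t]))"
    using k(2,3) is_arm_hd[OF k(4), of "[]"] by (cases xs) (simp_all add: edge_def)
  moreover have "path_edges (xs @ [t]) = edge ` {k. k < m \<and> ch k \<in> set xs}" using 2(1) k by blast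
  moreover have "{j. j < m \<and> ch j \<in> set (x # xs)} = insert k {j. j < m \<and> ch j \<in> set xs}"
    using k by (auto dest: ch_inj)
  ultimately show ?case by simp
qed simp

definition arm_list :: "nat \<Rightarrow> nat \<Rightarrow> nat list" where
  "arm_list s t = (SOME xs. is_arm xs s t)"

lemma is_arm_arm_list: "(s, t) \<in> R\<^sup>* \<Longrightarrow> is_arm (arm_list s t) s t"
  unfolding arm_list_def by (rule someI_ex[OF is_arm_exists])

definition path_of :: "nat \<times> nat \<times> nat \<Rightarrow> nat list" where
  "path_of = (\<lambda>(a, b, t). arm_list a t @ t # rev (arm_list b t))"

lemma
  assumes "valid (a, b, t)"
  shows simple_path_of: "simple_path I (path_of (a, b, t))"
    and path_edges_of: "path_edges (path_of (a, b, t)) = edge ` {k. k < m \<and> covers k (a, b, t)}"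
    and hd_path_of: "hd (path_of (a, b, t)) = a"
    and last_path_of: "last (path_of (a, b, t)) = b"
proof -
  have v: "a < n" "b < n" "(a, t) \<in> R\<^sup>*" "(b, t) \<in> R\<^sup>*" "arm a t \<inter> arm b t = {}"
    using assms by (auto simp: valid_def)
  note a = is_arm_arm_list[OF v(3)] and b = is_arm_arm_list[OF v(4)]
  have "path_edges (path_of (a, b, t)) = path_edges (arm_list a t @ [t]) \<union> path_edges (rev (arm_list b t @ [t]))"
    unfolding path_of_def using path_edges_append[of "arm_list a t" t "rev (arm_list b t)"] by simp
  also have "\<dots> = edge ` {k. k < m \<and> covers k (a, b, t)}"
    unfolding path_edges_rev is_arm_edges[OF a] is_arm_edges[OF b] is_arm_set[OF a] is_arm_set[OF b]
    by (auto simp: covers_def)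
  finally show e: "path_edges (path_of (a, b, t)) = edge ` {k. k < m \<and> covers k (a, b, t)}" .
  have "t \<notin> arm a t" "t \<notin> arm b t" using acyclic_R by (auto simp: arm_def)
  then have "distinct (path_of (a, b, t))"
    using v(5) is_arm_distinct[OF a] is_arm_distinct[OF b]
    by (auto simp: path_of_def is_arm_set[OF a] is_arm_set[OF b])
  moreover have "set (path_of (a, b, t)) \<subseteq> {..<n}"
    using arm_less[OF v(1), of _ t] arm_less[OF v(2), of _ t] R_less[OF v(3,1)]
    by (auto simp: path_of_def is_arm_set[OF a] is_arm_set[OF b])
  ultimately show "simple_path I (path_of (a, b, t))"
    unfolding simple_path_def e verts edges' by (auto simp: path_of_def)
  show "hd (path_of (a, b, t)) = a" using is_arm_hd[OF a] by (simp add: path_of_def)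
  have "last (path_of (a, b, t)) = hd (rev (path_of (a, b, t)))" by (simp add: hd_rev)
  also have "rev (path_of (a, b, t)) = arm_list b t @ t # rev (arm_list a t)" by (simp add: path_of_def)
  also have "hd \<dots> = b" using is_arm_hd[OF b] .
  finally show "last (path_of (a, b, t)) = b" .
qed

text \<open>The degrees in a line determine its unordered pair of endpoints.\<close>

lemma path_line_of_inj:
  assumes "valid (a, b, t)" "valid (a', b', t')" "a \<le> b" "a' \<le> b'"
    and "path_line (path_of (a, b, t)) = path_line (path_of (a', b', t'))"
  shows "(a, b, t) = (a', b', t')"
proof -
  let ?p = "path_of (a, b, t)" and ?q = "path_of (a', b', t')"
  have p: "distinct ?p" "?p \<noteq> []" "hd ?p = a" "last ?p = b"
    using simple_path_of[OF assms(1)] hd_path_of[OF assms(1)] last_path_of[OF assms(1)] by (auto simp: simple_path_def)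
  have q: "distinct ?q" "?q \<noteq> []" "hd ?q = a'" "last ?q = b'"
    using simple_path_of[OF assms(2)] hd_path_of[OF assms(2)] last_path_of[OF assms(2)] by (auto simp: simple_path_def)
  have eq: "set ?p = set ?q" "path_edges ?p = path_edges ?q" using assms(5) by (auto simp: path_line_def)
  have "of_bool (v = a) + of_bool (v = b) = (of_bool (v = a') + of_bool (v = b') :: nat)" for v
    using path_degree[OF p(1,2), of v] path_degree[OF q(1,2), of v] unfolding p(3,4) q(3,4) eq by simp
  note this[of a] this[of b] this[of a']
  then have "a = a' \<and> b = b'" using assms(3,4)
    by (cases "a = a'"; cases "b = b'"; cases "a = b'"; cases "b = a'") (simp_all add: of_bool_def split: if_splits)
  then show ?thesis using assms(1,2) valid_unique by blast
qed

text \<open>Upper and lower bound meet at the root: the finished paths realise the root value of the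
  trace, and every feasible concept costs at least some root value, hence at least the least
  one.\<close>

theorem optimal_of_config:
  assumes "trace z F i" "config F m k' 0 (int (\<Sum>v<n. z 0 v) + (\<Sum>j<m. int (F j - z j (ch j)) - int (i j))) fin op"
    and "\<And>v. op v = []"
    and "\<And>r. r \<le> B \<Longrightarrow> A m root (z m root) \<le> A m root r"
  defines "ls \<equiv> map (path_line \<circ> path_of) fin"
  shows "optimal I (set ls) (count_list ls)"
    and "concept_cost I (set ls) (count_list ls) = A m root (z m root)"
proof -
  have val: "\<And>x. x \<in> set fin \<Longrightarrow> valid x" using assms(2) by (auto simp: config_def)
  have tot: "total f op = 0" if "\<And>v. f v [] = 0" for f
    using that assms(3) by (simp add: total_def)
  have N: "int (length fin) = int (\<Sum>v<n. z 0 v) + (\<Sum>j<m. int (F j - z j (ch j)) - int (i j))"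
    using assms(2) by (simp add: config_def tot)
  have "count j fin op = F j" if "j < m" for j using assms(2) that by (simp add: config_def)
  then have cnt: "length (filter (covers j) fin) = F j" if "j < m" for j
    using that by (simp add: count_def tot)
  have ls: "set ls \<subseteq> lines I"
    using val simple_path_of by (auto simp: ls_def lines_def)
  have "length (filter (\<lambda>l. edge k \<in> snd l) ls) = F k" if k: "k < m" for k
  proof -
    have "edge k \<in> snd (path_line (path_of x)) \<longleftrightarrow> covers k x" if "x \<in> set fin" for x
    proof -
      obtain a b t where x: "x = (a, b, t)" by (metis prod_cases3)
      have "edge k = edge j \<longleftrightarrow> k = j" if "j < m" for j
        using edge_inj k that by (auto simp: inj_on_def)
      then show ?thesis
        using path_edges_of[of a b t] val[OF that] k unfolding x path_line_def by auto
    qed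
    then have "filter (\<lambda>x. edge k \<in> snd (path_line (path_of x))) fin = filter (covers k) fin"
      by (intro filter_cong) auto
    then show ?thesis using cnt[OF k] by (simp add: ls_def filter_map o_def)
  qed
  moreover have "lo k \<le> F k \<and> F k \<le> hi k" if "k < m" for k using assms(1) that by (simp add: trace_def)
  ultimately have feas: "feasible I (set ls) (count_list ls)"
    and cost: "concept_cost I (set ls) (count_list ls) = cfix I * real (length ls) + (\<Sum>k<m. wt k * real (F k))"
    using concept_of_list[OF ls] by blast+
  have "real (length ls) = real_of_int (int (length fin))" by (simp add: ls_def)
  also note N
  finally have "concept_cost I (set ls) (count_list ls) = (\<Sum>v\<in>rest m. A m v (z m v))"
    unfolding cost trace_cost[OF assms(1) order_refl] by simp
  then show c: "concept_cost I (set ls) (count_list ls) = A m root (z m root)" by (simp add: rest_m)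
  show "optimal I (set ls) (count_list ls)"
    unfolding optimal_def
  proof (intro conjI allI impI feas)
    fix L' f' assume "feasible I L' f'"
    then obtain r where "r \<le> B" "A m root r \<le> concept_cost I L' f'" by (rule lower_bound)
    then show "concept_cost I (set ls) (count_list ls) \<le> concept_cost I L' f'"
      using assms(4)[of r] c by simp
  qed
qed

end

section \<open>Trees\<close>

lemma wf_edge:
  assumes "lp_instance_wf I" "e \<in> edges I" "a \<in> e"
  obtains w where "e = {a, w}" "w \<noteq> a" "a \<in> verts I" "w \<in> verts I"
proof -
  have "card e = 2" "e \<subseteq> verts I" using assms by (auto simp: lp_instance_wf_def)
  then obtain x y where "e = {x, y}" "x \<noteq> y" by (auto simp: card_2_iff)
  with \<open>e \<subseteq> verts I\<close> assms(3) show ?thesis by (auto intro: that)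
qed

text \<open>Take a longest path with edges in \<open>E\<close>. A second edge of \<open>E\<close> at
  its first vertex would either prolong it or close a cycle with an initial piece of it.\<close>

lemma leaf_exists:
  assumes wf: "lp_instance_wf I" and tree: "tree I" and E: "E \<subseteq> edges I" "E \<noteq> {}"
  obtains a where "card {e \<in> E. a \<in> e} = 1"
proof -
  let ?P = "\<lambda>p. simple_path I p \<and> path_edges p \<subseteq> E \<and> 2 \<le> length p"
  have fin: "finite (verts I)" using wf by (simp add: lp_instance_wf_def)
  obtain e where e: "e \<in> E" using E by blast
  then have "card e = 2" using E(1) wf by (auto simp: lp_instance_wf_def)
  then obtain x where x: "x \<in> e" by (metis card.empty equals0I zero_neq_numeral)
  obtain y where "e = {x, y}" "y \<noteq> x" "x \<in> verts I" "y \<in> verts I"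
    by (rule wf_edge[OF wf _ x]) (use E e in auto)
  then have ex: "?P [x, y]" using e E by (auto simp: simple_path_def)
  have "length p < Suc (card (verts I))" if "?P p" for p
    using that card_mono[OF fin, of "set p"] distinct_card[of p] by (auto simp: simple_path_def)
  then obtain p where p: "?P p" "\<And>q. ?P q \<Longrightarrow> length q \<le> length p"
    using ex_has_greatest_nat[of ?P "[x, y]" length] ex by blast
  then obtain a b q where pq: "p = a # b # q" by (cases p; cases "tl p") auto
  have "e = {a, b}" if e: "e \<in> E" "a \<in> e" for e
  proof (rule ccontr)
    assume neq: "e \<noteq> {a, b}"
    obtain w where w: "e = {a, w}" "w \<noteq> a" "w \<in> verts I"
      by (rule wf_edge[OF wf _ e(2)]) (use E e in auto)
    show False
    proof (cases "w \<in> set p")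
      case False
      then have "?P (w # p)" using p(1) w pq e E by (auto simp: simple_path_def insert_commute)
      then show False using p(2) by fastforce
    next
      case True
      with w neq pq have "w \<in> set q" by auto
      then obtain q1 q2 where q: "q = q1 @ w # q2" by (auto simp: in_set_conv_decomp)
      let ?c = "a # b # q1 @ [w]"
      have "path_edges ?c \<subseteq> path_edges p"
        using path_edges_append[of "a # b # q1" w q2] by (auto simp: pq q)
      then have "simple_path I ?c" using p(1) by (auto simp: simple_path_def pq q)
      moreover have "{last ?c, hd ?c} \<in> edges I" using w e E by (auto simp: insert_commute)
      moreover have "3 \<le> length ?c" by simp
      ultimately show False using tree unfolding tree_def by blast
    qed
  qed
  then have "\<And>e. e \<in> E \<and> a \<in> e \<Longrightarrow> e = {a, b}" by blast
  moreover have "{a, b} \<in> E" using p(1) pq by auto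
  ultimately have "{e \<in> E. a \<in> e} = {{a, b}}" by (intro set_eqI iffI) simp_all
  then show ?thesis using that[of a] by simp
qed

text \<open>Removing an edge at a leaf of the remaining edge set also removes a vertex from its
  union. The bound is one weaker than the exact count, which is enough for the running time.\<close>

lemma card_edges_le:
  assumes "lp_instance_wf I" "tree I"
  shows "card (edges I) \<le> card (verts I)"
proof -
  have fin: "finite (verts I)" "edges I \<subseteq> Pow (verts I)"
    using assms(1) by (auto simp: lp_instance_wf_def)
  then have finE: "finite (edges I)" by (meson finite_Pow_iff finite_subset)
  have "card E \<le> card (\<Union>E)" if "E \<subseteq> edges I" for E
    using that
  proof (induction "card E" arbitrary: E)
    case (Suc k)
    have "\<Union>E \<subseteq> verts I" using Suc.prems fin(2) by blast
    then have f: "finite E" "finite (\<Union>E)"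
      using finite_subset[OF Suc.prems finE] finite_subset[OF _ fin(1)] by auto
    have "E \<noteq> {}" using Suc.hyps(2) by auto
    then obtain a where "card {e \<in> E. a \<in> e} = 1" using leaf_exists[OF assms Suc.prems] by blast
    then obtain e where e: "{e \<in> E. a \<in> e} = {e}" by (auto simp: card_1_singleton_iff)
    then have "e \<in> E" "a \<in> e" by auto
    have "k = card (E - {e})" using Suc.hyps(2) \<open>e \<in> E\<close> f by simp
    then have "card (E - {e}) \<le> card (\<Union>(E - {e}))" using Suc.hyps(1) Suc.prems by blast
    also have "\<dots> \<le> card (\<Union>E - {a})" using e f by (intro card_mono) auto
    also have "\<dots> < card (\<Union>E)" using \<open>e \<in> E\<close> \<open>a \<in> e\<close> f by (intro psubset_card_mono) auto
    finally show ?case using \<open>k = _\<close> Suc.hyps(2) by simp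
  qed simp
  from this[OF order_refl] show ?thesis
    using fin(2) card_mono[OF fin(1), of "\<Union>(edges I)"] by (meson Sup_le_iff PowD order_trans subset_eq)
qed

text \<open>On a path between two remaining vertices the edge eliminated first would have its child in the interior.\<close>

lemma remaining_unique:
  fixes ch pa :: "nat \<Rightarrow> nat"
  assumes tree: "tree I" and E: "edges I \<subseteq> (\<lambda>k. {ch k, pa k}) ` {..<m}"
    and later: "\<And>k j. k < j \<Longrightarrow> j < m \<Longrightarrow> ch k \<noteq> ch j \<and> ch k \<noteq> pa j"
    and uv: "u \<in> verts I" "v \<in> verts I" "\<forall>k<m. u \<noteq> ch k" "\<forall>k<m. v \<noteq> ch k"
  shows "u = v"
proof (rule ccontr)
  assume neq: "u \<noteq> v"
  obtain p where p: "simple_path I p" "hd p = u" "last p = v" using tree uv(1,2) unfolding tree_def by blast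
  have d: "distinct p" "p \<noteq> []" "path_edges p \<subseteq> edges I" using p by (auto simp: simple_path_def)
  let ?K = "\<lambda>k. k < m \<and> {ch k, pa k} \<in> path_edges p"
  have "u \<in> set p" using d p by auto
  then have "card {e \<in> path_edges p. u \<in> e} = 1" using path_degree[OF d(1,2), of u] p neq by auto
  then obtain e where "e \<in> path_edges p" by (force simp: card_1_singleton_iff)
  then have "\<exists>k. ?K k" using d(3) E by fastforce
  then obtain k where k: "?K k" "\<And>j. ?K j \<Longrightarrow> k \<le> j"
    using exists_least_iff[of ?K] by (metis not_le)
  have "ch k \<in> set p" using k path_edges_subset by fastforce
  moreover have "ch k \<noteq> hd p" "ch k \<noteq> last p" using p(2,3) uv(3,4) k(1) by metis+
  ultimately have "card {e \<in> path_edges p. ch k \<in> e} = 2"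
    using path_degree[OF d(1,2), of "ch k"] by simp
  then obtain e1 e2 where "{e \<in> path_edges p. ch k \<in> e} = {e1, e2}" "e1 \<noteq> e2" by (auto simp: card_2_iff)
  then have "e1 \<in> {e \<in> path_edges p. ch k \<in> e}" "e2 \<in> {e \<in> path_edges p. ch k \<in> e}" "e1 \<noteq> e2" by auto
  then obtain e where e: "e \<in> path_edges p" "ch k \<in> e" "e \<noteq> {ch k, pa k}"
  proof (cases "e1 = {ch k, pa k}")
    case True
    then show thesis using that[of e2] \<open>e2 \<in> _\<close> \<open>e1 \<noteq> e2\<close> by simp
  next
    case False
    then show thesis using that[of e1] \<open>e1 \<in> _\<close> by simp
  qed
  then have "e \<in> (\<lambda>k. {ch k, pa k}) ` {..<m}" using d(3) E by (meson subsetD)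
  then obtain j where j: "j < m" "e = {ch j, pa j}" by (elim imageE) simp
  then have "k \<le> j" using k(2) e(1) by simp
  moreover have "j \<noteq> k" using e(3) j(2) by auto
  ultimately have "k < j" by simp
  from later[OF this j(1)] e(2) j(2) show False by simp
qed

section \<open>The first program: minimum cost\<close>

locale lp_input =
  fixes I :: "nat lp_instance" and es :: "(nat \<times> nat) list" and n m :: nat
  assumes wf: "lp_instance_wf I" and tree: "tree I" and edge_list: "edge_list I es"
    and dfix0: "dfix I = 0" and n_def: "n = card (verts I)" and m_def: "m = length es"
begin

definition endpoints :: "nat \<Rightarrow> nat set" where
  "endpoints e = {fst (es ! e), snd (es ! e)}"

lemma verts_eq: "verts I = {..<n}"
  using edge_list by (simp add: edge_list_def n_def)

lemma n_pos: "n \<ge> 1"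
  using tree wf unfolding n_def tree_def lp_instance_wf_def by (simp add: Suc_le_eq card_gt_0_iff)

lemma edges_eq: "edges I = endpoints ` {..<m}"
proof -
  have "edges I = set (map (\<lambda>(u, v). {u, v}) es)" using edge_list by (simp add: edge_list_def)
  also have "\<dots> = endpoints ` {..<m}"
    by (force simp: endpoints_def m_def set_conv_nth case_prod_beta)
  finally show ?thesis .
qed

lemma endpoints_inj: "inj_on endpoints {..<m}"
proof -
  let ?es = "map (\<lambda>(u, v). {u, v}) es"
  have "distinct ?es" using edge_list unfolding edge_list_def by blast
  then have "map (\<lambda>(u, v). {u, v}) es ! i \<noteq> map (\<lambda>(u, v). {u, v}) es ! j"
    if "i < m" "j < m" "i \<noteq> j" for i j
    using that nth_eq_iff_index_eq[of "map (\<lambda>(u, v). {u, v}) es" i j] by (simp add: m_def)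
  moreover have "map (\<lambda>(u, v). {u, v}) es ! i = endpoints i" if "i < m" for i
    using that by (simp add: m_def endpoints_def case_prod_beta)
  ultimately show ?thesis by (intro inj_onI) (metis lessThan_iff)
qed

lemma endpoints_props:
  assumes "e < m"
  shows "fst (es ! e) < n" "snd (es ! e) < n" "fst (es ! e) \<noteq> snd (es ! e)"
proof -
  have e: "endpoints e \<in> edges I" using assms by (simp add: edges_eq)
  then have "card (endpoints e) = 2" "endpoints e \<subseteq> {..<n}"
    using wf verts_eq by (auto simp: lp_instance_wf_def)
  then show "fst (es ! e) < n" "snd (es ! e) < n" "fst (es ! e) \<noteq> snd (es ! e)"
    by (simp_all add: endpoints_def card_insert_if split: if_splits)
qed

lemma m_le_n: "m \<le> n"
  using card_edges_le[OF wf tree] endpoints_inj by (simp add: edges_eq card_image n_def)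

definition holds_input :: "state \<Rightarrow> bool" where
  "holds_input s \<longleftrightarrow> ints s ''n'' 0 = int n \<and> ints s ''m'' 0 = int m \<and>
     (\<forall>e<m. ints s ''u'' (int e) = int (fst (es ! e)) \<and> ints s ''v'' (int e) = int (snd (es ! e)) \<and>
       ints s ''fmin'' (int e) = fmin I (endpoints e) \<and> ints s ''fmax'' (int e) = fmax I (endpoints e) \<and>
       reals s ''c'' (int e) = ecost I (endpoints e)) \<and>
     reals s ''cfix'' 0 = cfix I"

lemma holds_input_init: "holds_input (input_state I es)"
  by (simp add: holds_input_def input_state_def array_of_def n_def[symmetric] m_def[symmetric] endpoints_def case_prod_beta)

lemma holds_input_frame:
  assumes "holds_input s" "frame X Y s s'"
    "X \<inter> {''n'', ''m'', ''u'', ''v'', ''fmin'', ''fmax''} = {}" "Y \<inter> {''c'', ''cfix''} = {}"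
  shows "holds_input s'"
proof -
  show ?thesis using assms(1,3,4)
    by (simp add: holds_input_def frame_ints[OF assms(2)] frame_reals[OF assms(2)])
qed

end

lemma tr_step:
  assumes "loop_free P" "tr Q (effect P s) T' R" "max_time P + T' \<le> T"
  shows "tr (Seq P Q) s T R"
  by (rule tr_mono[OF tr_Seq[OF tr_effect[OF assms(1) order_refl]]]) (use assms in auto)

section \<open>Testing the upper bounds and finding the largest one\<close>

definition Check_body :: com where
  "Check_body = Seq
    (If (ILess (IRead ''fmax'' (Var ''i'')) (Const 0)) (Set ''feasible'' (Const 0)) Skip)
    (If (ILess (Var ''B'') (IRead ''fmax'' (Var ''i''))) (Set ''B'' (IRead ''fmax'' (Var ''i''))) Skip)"

definition Check :: com where
  "Check = Seq (Seq (Set ''feasible'' (Const 1)) (Set ''B'' (Const 0)))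
    (For ''i'' (Const 0) (Var ''m'')
      Check_body)"

lemma Check_body_wr [simp]: "iwr Check_body = {''feasible'', ''B''}" "rwr Check_body = {}"
  by (auto simp: Check_body_def)

lemma Check_wr [simp]: "iwr Check = {''feasible'', ''B'', ''i''}" "rwr Check = {}"
  by (auto simp: Check_def)

context lp_input
begin

text \<open>A negative upper bound excludes any concept. If there is none, feasibility is plausible
  from two-vertex lines, one per edge with frequency \<open>fmax\<close>, but it is obtained later
  from the constructed optimum. The computed \<open>B\<close> may be smaller than
  \<open>b\<close>.\<close>

lemma tr_Check:
  assumes inp: "holds_input s" and b: "\<And>e. e \<in> edges I \<Longrightarrow> fmax I e \<le> int b"
  shows "tr Check s (200 * n) (\<lambda>s'.
    ints s' ''feasible'' 0 = (if \<forall>e\<in>edges I. 0 \<le> fmax I e then 1 else 0) \<and>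
    (\<exists>B\<le>b. ints s' ''B'' 0 = int B \<and> (\<forall>e\<in>edges I. fmax I e \<le> int B)))"
  unfolding Check_def
proof (rule tr_step)
  let ?s = "effect (Seq (Set ''feasible'' (Const 1)) (Set ''B'' (Const 0))) s"
  let ?J = "\<lambda>j s'. ints s' ''feasible'' 0 = (if \<forall>e<j. 0 \<le> fmax I (endpoints e) then 1 else 0) \<and>
    0 \<le> ints s' ''B'' 0 \<and> ints s' ''B'' 0 \<le> int b \<and> (\<forall>e<j. fmax I (endpoints e) \<le> ints s' ''B'' 0)"
  show "tr (For ''i'' (Const 0) (Var ''m'')
      Check_body)
    ?s ((100 + 50) * (n * 1)) (\<lambda>s'.
    ints s' ''feasible'' 0 = (if \<forall>e\<in>edges I. 0 \<le> fmax I e then 1 else 0) \<and>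
    (\<exists>B\<le>b. ints s' ''B'' 0 = int B \<and> (\<forall>e\<in>edges I. fmax I e \<le> int B)))"
  proof (rule tr_For[where l = 0 and h = m and J = ?J and K = 100 and X = 1 and Y = n])
    fix j s'
    assume j: "j < m" "?J j s'" "ints s' ''i'' 0 = int j" and fr: "framed_loop ''i'' Check_body ?s s'"
    have f: "ints s' ''fmax'' (int j) = fmax I (endpoints j)"
      using inp j by (simp add: frame_ints[OF fr] holds_input_def)
    have "fmax I (endpoints j) \<le> int b" using b j by (simp add: edges_eq)
    then show "tr Check_body s' (100 * 1)
           (\<lambda>s''. ?J (Suc j) (iupdate s'' ''i'' 0 (int (Suc j))))"
      using j f by (intro tr_effect) (auto simp: less_Suc_eq Check_body_def)
  next
    fix s' assume "?J m s'"
    then show "ints s' ''feasible'' 0 = (if \<forall>e\<in>edges I. 0 \<le> fmax I e then 1 else 0) \<and>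
      (\<exists>B\<le>b. ints s' ''B'' 0 = int B \<and> (\<forall>e\<in>edges I. fmax I e \<le> int B))"
      by (auto simp: edges_eq intro: exI[of _ "nat (ints s' ''B'' 0)"])
  qed (use inp n_pos m_le_n in \<open>auto simp: holds_input_def edges_eq frame_ints\<close>)
qed (use n_pos in simp_all)

end

text \<open>Integer expressions have no multiplication, so the offsets \<open>i * W\<close> of the
  rows of a two-dimensional table are tabulated by repeated addition.\<close>

definition Rows :: "string \<Rightarrow> string \<Rightarrow> com" where
  "Rows a x = Seq (IWrite a (Const 0) (Const 0)) (For ''i'' (Const 0) (Var ''n'')
     (IWrite a (IAdd (Var ''i'') (Const 1)) (IAdd (IRead a (Var ''i'')) (Var x))))"

lemma Rows_wr [simp]: "iwr (Rows a x) = {a, ''i''}" "rwr (Rows a x) = {}"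
  by (auto simp: Rows_def)

section \<open>A leaf elimination order in linear time\<close>

definition Degrees_body :: com where
  "Degrees_body =
     Seq (Set ''x'' (IRead ''u'' (Var ''i''))) (Seq (Set ''y'' (IRead ''v'' (Var ''i'')))
     (Seq (Seq (IWrite ''deg'' (Var ''x'') (IAdd (IRead ''deg'' (Var ''x'')) (Const 1)))
               (IWrite ''sm'' (Var ''x'') (IAdd (IRead ''sm'' (Var ''x'')) (Var ''i''))))
          (Seq (IWrite ''deg'' (Var ''y'') (IAdd (IRead ''deg'' (Var ''y'')) (Const 1)))
               (IWrite ''sm'' (Var ''y'') (IAdd (IRead ''sm'' (Var ''y'')) (Var ''i''))))))"

definition Degrees :: com where
  "Degrees = For ''i'' (Const 0) (Var ''m'') Degrees_body"

lemma Degrees_wr [simp]: "iwr Degrees_body = {''x'', ''y'', ''deg'', ''sm''}" "rwr Degrees_body = {}"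
  "iwr Degrees = {''i'', ''x'', ''y'', ''deg'', ''sm''}" "rwr Degrees = {}"
  by (auto simp: Degrees_def Degrees_body_def)

text \<open>
  The remaining edges at a vertex are represented by their number and the sum of their indices,
  from which the index of the last one can be read off. After a leaf is removed, its neighbour is
  visited next; otherwise the scan of all vertices goes on.
\<close>

definition Peel_record :: com where
  "Peel_record =
     Seq (Set ''e'' (IRead ''sm'' (Var ''x'')))
     (Seq (Set ''y'' (ISub (IAdd (IRead ''u'' (Var ''e'')) (IRead ''v'' (Var ''e''))) (Var ''x'')))
     (Seq (IWrite ''ch'' (Var ''k'') (Var ''x'')) (Seq (IWrite ''pa'' (Var ''k'') (Var ''y''))
     (Seq (IWrite ''ed'' (Var ''k'') (Var ''e'')) (Seq (IWrite ''par'' (Var ''x'') (Var ''y''))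
     (Seq (Inc ''k'') (Set ''root'' (Var ''y''))))))))"

definition Peel_detach :: com where
  "Peel_detach =
     Seq (Seq (IWrite ''deg'' (Var ''x'') (ISub (IRead ''deg'' (Var ''x'')) (Const 1)))
              (IWrite ''sm'' (Var ''x'') (ISub (IRead ''sm'' (Var ''x'')) (Var ''e''))))
     (Seq (Seq (IWrite ''deg'' (Var ''y'') (ISub (IRead ''deg'' (Var ''y'')) (Const 1)))
               (IWrite ''sm'' (Var ''y'') (ISub (IRead ''sm'' (Var ''y'')) (Var ''e''))))
          (Set ''x'' (Var ''y'')))"

definition Peel_step :: com where
  "Peel_step = Seq Peel_record Peel_detach"

definition Peel_body :: com where
  "Peel_body = If (And (ILess (Const 0) (IRead ''deg'' (Var ''x''))) (ILess (IRead ''deg'' (Var ''x'')) (Const 2)))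
     Peel_step (Seq (Inc ''i'') (Set ''x'' (Var ''i'')))"

definition Peel :: com where
  "Peel = Seq (Seq (Set ''i'' (Const 0)) (Seq (Set ''x'' (Const 0)) (Seq (Set ''k'' (Const 0)) (Set ''root'' (Const 0)))))
     (While (ILess (Var ''i'') (Var ''n'')) Peel_body)"

lemma Peel_wr [simp]:
  "iwr Peel_body = {''i'', ''x'', ''y'', ''e'', ''k'', ''root'', ''ch'', ''pa'', ''ed'', ''par'', ''deg'', ''sm''}"
  "rwr Peel_body = {}"
  "iwr Peel = {''i'', ''x'', ''y'', ''e'', ''k'', ''root'', ''ch'', ''pa'', ''ed'', ''par'', ''deg'', ''sm''}"
  "rwr Peel = {}"
  by (auto simp: Peel_def Peel_body_def Peel_step_def Peel_record_def Peel_detach_def)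

lemma Peel_body_time: "loop_free Peel_body" "max_time Peel_body \<le> 200"
  by (simp_all add: Peel_body_def Peel_step_def Peel_record_def Peel_detach_def)

context lp_input
begin

lemma tr_Rows:
  assumes "holds_input s" "ints s x 0 = int W" "a \<noteq> x" "x \<noteq> ''i''" "a \<noteq> ''i''" "a \<noteq> ''n''"
  shows "tr (Rows a x) s (100 * n) (\<lambda>s'. \<forall>i\<le>n. ints s' a (int i) = int (i * W))"
  unfolding Rows_def
proof (rule tr_step)
  let ?s = "effect (IWrite a (Const 0) (Const 0)) s"
  let ?J = "\<lambda>j s'. \<forall>i\<le>j. ints s' a (int i) = int (i * W)"
  show "tr (For ''i'' (Const 0) (Var ''n'')
     (IWrite a (IAdd (Var ''i'') (Const 1)) (IAdd (IRead a (Var ''i'')) (Var x)))) ?s ((20 + 50) * (n * 1))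
     (\<lambda>s'. \<forall>i\<le>n. ints s' a (int i) = int (i * W))"
  proof (rule tr_For[where l = 0 and h = n and J = ?J and K = 20 and X = 1 and Y = n])
    fix j s' assume fr: "framed_loop ''i'' (IWrite a (IAdd (Var ''i'') (Const 1)) (IAdd (IRead a (Var ''i'')) (Var x))) ?s s'"
      and j: "?J j s'" "ints s' ''i'' 0 = int j"
    have "ints s' x 0 = int W" using assms by (simp add: frame_ints[OF fr])
    then show "tr (IWrite a (IAdd (Var ''i'') (Const 1)) (IAdd (IRead a (Var ''i'')) (Var x))) s' (20 * 1)
      (\<lambda>s''. ?J (Suc j) (iupdate s'' ''i'' 0 (int (Suc j))))"
      using j assms by (intro tr_effect) (auto simp: le_Suc_eq algebra_simps)
  qed (use assms n_pos in \<open>auto simp: holds_input_def frame_ints\<close>)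
qed (use n_pos in simp_all)

definition incident :: "nat set \<Rightarrow> nat \<Rightarrow> nat set" where
  "incident E v = {e \<in> E. v \<in> endpoints e}"

definition degrees :: "nat set \<Rightarrow> state \<Rightarrow> bool" where
  "degrees E s \<longleftrightarrow> (\<forall>v<n. ints s ''deg'' (int v) = int (card (incident E v)) \<and>
     ints s ''sm'' (int v) = int (\<Sum>(incident E v)))"

lemma finite_incident [simp]: "finite E \<Longrightarrow> finite (incident E v)"
  by (simp add: incident_def)

lemma incident_insert: "incident (insert e E) v = (if v \<in> endpoints e then insert e (incident E v) else incident E v)"
  and incident_remove: "incident (E - {e}) v = (if v \<in> endpoints e then incident E v - {e} else incident E v)"
  by (auto simp: incident_def)

lemma tr_Degrees:
  assumes "holds_input s" "ints s ''deg'' = (\<lambda>_. 0)" "ints s ''sm'' = (\<lambda>_. 0)"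
  shows "tr Degrees s (200 * n) (degrees {..<m})"
  unfolding Degrees_def
proof (rule tr_For[where l = 0 and h = m and J = "\<lambda>j. degrees {..<j}" and K = 100 and X = 1 and Y = n])
  show "degrees {..<0} (iupdate s ''i'' 0 (int 0))"
    using assms by (simp add: degrees_def incident_def)
next
  fix j s'
  assume fr: "framed_loop ''i'' Degrees_body s s'"
    and j: "j < m" "degrees {..<j} s'" "ints s' ''i'' 0 = int j"
  have uv: "ints s' ''u'' (int j) = int (fst (es ! j))" "ints s' ''v'' (int j) = int (snd (es ! j))"
    using assms(1) j(1) by (simp_all add: frame_ints[OF fr] holds_input_def)
  have "j \<notin> incident {..<j} v" for v by (simp add: incident_def)
  then show "tr Degrees_body s' (100 * 1) (\<lambda>s''. degrees {..<Suc j} (iupdate s'' ''i'' 0 (int (Suc j))))"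
    using j uv endpoints_props(3)[OF j(1)]
    by (intro tr_effect) (auto simp: Degrees_body_def degrees_def lessThan_Suc incident_insert, auto simp: endpoints_def)
qed (use assms n_pos m_le_n in \<open>auto simp: holds_input_def frame_ints\<close>)

text \<open>\<open>E\<close> holds the indices of the remaining edges. The vertex \<open>r\<close>,
  the neighbour of the leaf removed last, is never itself a removed leaf so far, so it is the root
  once no edge is left.\<close>

definition peeled :: "(nat \<Rightarrow> nat) \<Rightarrow> (nat \<Rightarrow> nat) \<Rightarrow> (nat \<Rightarrow> nat) \<Rightarrow> nat \<Rightarrow> nat set \<Rightarrow> nat \<Rightarrow> bool" where
  "peeled ch pa ed k E r \<longleftrightarrow> E \<subseteq> {..<m} \<and> ed ` {..<k} \<union> E = {..<m} \<and> k + card E = m \<and> r < n \<and>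
     (\<forall>j<k. ch j < n \<and> pa j < n \<and> ch j \<noteq> pa j \<and> endpoints (ed j) = {ch j, pa j} \<and>
       (\<forall>e\<in>E. ch j \<notin> endpoints e) \<and> r \<noteq> ch j \<and> (\<forall>i<j. ch i \<noteq> ch j \<and> ch i \<noteq> pa j))"

lemma peeled_step:
  assumes "peeled ch pa ed k E r" "incident E x = {e}" "endpoints e = {x, y}"
  shows "peeled (ch(k := x)) (pa(k := y)) (ed(k := e)) (Suc k) (E - {e}) y"
proof -
  have e: "e \<in> E" "\<And>e'. e' \<in> E \<Longrightarrow> x \<in> endpoints e' \<Longrightarrow> e' = e" using assms(2) by (auto simp: incident_def)
  have E: "E \<subseteq> {..<m}" "ed ` {..<k} \<union> E = {..<m}" "k + card E = m" and
    old: "\<And>j. j < k \<Longrightarrow> ch j < n \<and> pa j < n \<and> ch j \<noteq> pa j \<and> endpoints (ed j) = {ch j, pa j} \<and>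
       (\<forall>e\<in>E. ch j \<notin> endpoints e) \<and> r \<noteq> ch j \<and> (\<forall>i<j. ch i \<noteq> ch j \<and> ch i \<noteq> pa j)"
    using assms(1) by (simp_all add: peeled_def)
  have "e < m" using e E by auto
  from endpoints_props[OF this] have xy: "x < n" "y < n" "x \<noteq> y"
    using assms(3) by (auto simp: endpoints_def doubleton_eq_iff)
  have fin: "finite E" using E finite_subset by blast
  have c: "Suc k + card (E - {e}) = m" using E(3) card.remove[OF fin e(1)] by simp
  have "(ed(k := e)) ` {..<Suc k} = insert e (ed ` {..<k})"
    by (auto simp: lessThan_Suc image_iff)
  then have u: "(ed(k := e)) ` {..<Suc k} \<union> (E - {e}) = ed ` {..<k} \<union> E" using e(1) by auto
  have nx: "ch j \<noteq> x \<and> ch j \<noteq> y" if "j < k" for j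
  proof -
    have "ch j \<notin> endpoints e" using old[OF that] e(1) by blast
    then show ?thesis by (simp add: assms(3))
  qed
  show ?thesis unfolding peeled_def
  proof (intro conjI allI impI ballI)
    show "E - {e} \<subseteq> {..<m}" using E by auto
    fix j assume "j < Suc k"
    then have "j = k \<or> j < k" by auto
    then have "(ch(k := x)) j < n \<and> (pa(k := y)) j < n \<and> (ch(k := x)) j \<noteq> (pa(k := y)) j \<and>
      endpoints ((ed(k := e)) j) = {(ch(k := x)) j, (pa(k := y)) j} \<and> y \<noteq> (ch(k := x)) j \<and>
      (\<forall>e\<in>E - {e}. (ch(k := x)) j \<notin> endpoints e)"
    proof
      assume j: "j = k"
      then show ?thesis using xy assms(3) e(2) by (simp add: eq_commute[of x y]) blast
    next
      assume j: "j < k"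
      then show ?thesis using old[OF j] nx[OF j] by (simp add: eq_commute[of y])
    qed
    then show "(ch(k := x)) j < n" "(pa(k := y)) j < n" "(ch(k := x)) j \<noteq> (pa(k := y)) j"
      "endpoints ((ed(k := e)) j) = {(ch(k := x)) j, (pa(k := y)) j}" "y \<noteq> (ch(k := x)) j"
      "\<And>e'. e' \<in> E - {e} \<Longrightarrow> (ch(k := x)) j \<notin> endpoints e'"
      by blast+
    fix i assume "i < j"
    with \<open>j = k \<or> j < k\<close> show "(ch(k := x)) i \<noteq> (ch(k := x)) j" "(ch(k := x)) i \<noteq> (pa(k := y)) j"
      using old[of j] nx[of i] by auto
  qed (use u E(2) c xy in simp_all)
qed

text \<open>Every nonempty set of tree edges has a vertex of degree one, so the absence of leaves
  means that all edges are gone.\<close>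

lemma peeled_finished:
  assumes "peeled ch pa ed k E r" "\<forall>v<n. card (incident E v) \<noteq> 1"
  shows "E = {}" "k = m"
proof -
  have E: "E \<subseteq> {..<m}" "k + card E = m" using assms(1) by (auto simp: peeled_def)
  show "E = {}"
  proof (rule ccontr)
    assume "E \<noteq> {}"
    then obtain a where a: "card {e \<in> endpoints ` E. a \<in> e} = 1"
      using leaf_exists[OF wf tree, of "endpoints ` E"] E by (auto simp: edges_eq)
    have "{e \<in> endpoints ` E. a \<in> e} = endpoints ` incident E a" by (auto simp: incident_def)
    moreover have "inj_on endpoints (incident E a)"
      by (rule inj_on_subset[OF endpoints_inj]) (use E in \<open>auto simp: incident_def\<close>)
    ultimately have c: "card (incident E a) = 1" using a by (simp add: card_image)
    then obtain e where "e \<in> incident E a" by (auto simp: card_1_singleton_iff)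
    then have "a < n" using endpoints_props[of e] E by (auto simp: incident_def endpoints_def)
    with assms(2) c show False by blast
  qed
  then show "k = m" using E by simp
qed

text \<open>The order properties are read off \<open>peeled\<close>; only the uniqueness of the
  remaining vertex needs the tree once more, through \<open>remaining_unique\<close>.\<close>

lemma peeled_peeling:
  assumes "peeled ch pa ed m {} r"
  shows "peeling n m r ch pa" "edges I = (\<lambda>k. {ch k, pa k}) ` {..<m}"
proof -
  have old: "\<And>j. j < m \<Longrightarrow> ch j < n \<and> pa j < n \<and> ch j \<noteq> pa j \<and> endpoints (ed j) = {ch j, pa j} \<and>
       r \<noteq> ch j \<and> (\<forall>i<j. ch i \<noteq> ch j \<and> ch i \<noteq> pa j)" and r: "r < n" and ed: "ed ` {..<m} = {..<m}"
    using assms by (simp_all add: peeled_def)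
  have "edges I = endpoints ` ed ` {..<m}" by (simp add: edges_eq ed)
  also have "\<dots> = (\<lambda>k. {ch k, pa k}) ` {..<m}" unfolding image_image using old by (intro image_cong) auto
  finally show E: "edges I = (\<lambda>k. {ch k, pa k}) ` {..<m}" .
  have later: "ch i \<noteq> ch j \<and> ch i \<noteq> pa j" if "i < j" "j < m" for i j using old[OF that(2)] that(1) by blast
  have rch: "r \<noteq> ch j" if "j < m" for j using old[OF that] by blast
  have uniq: "v = r" if "v < n" "\<forall>k<m. v \<noteq> ch k" for v
    by (rule remaining_unique[OF tree equalityD1[OF E] later]) (use rch that r verts_eq in simp_all)
  show "peeling n m r ch pa"
  proof
    show "ch k < n" "pa k < n" "ch k \<noteq> pa k" if "k < m" for k using old[OF that] by blast+
    show "ch k \<noteq> ch j \<and> ch k \<noteq> pa j" if "k < j" "j < m" for k j using later that .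
    show "r < n" by (rule r)
    show "(\<forall>k<m. v \<noteq> ch k) \<longleftrightarrow> v = r" if "v < n" for v using uniq[OF that] rch by blast
  qed
qed

definition holds_peeling :: "(nat \<Rightarrow> nat) \<Rightarrow> (nat \<Rightarrow> nat) \<Rightarrow> (nat \<Rightarrow> nat) \<Rightarrow> nat \<Rightarrow> nat \<Rightarrow> state \<Rightarrow> bool" where
  "holds_peeling ch pa ed k r s \<longleftrightarrow> ints s ''root'' 0 = int r \<and> (\<forall>j<k. ints s ''ch'' (int j) = int (ch j) \<and>
     ints s ''pa'' (int j) = int (pa j) \<and> ints s ''ed'' (int j) = int (ed j) \<and>
     ints s ''par'' (int (ch j)) = int (pa j))"

lemma effect_Peel_step:
  assumes "holds_peeling ch pa ed k r s" "degrees E s" "incident E x = {e}" "endpoints e = {x, y}" "x < n" "y < n" "x \<noteq> y"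
    "\<forall>j<k. ch j \<noteq> x" "ints s ''x'' 0 = int x" "ints s ''k'' 0 = int k"
    "ints s ''u'' (int e) = int (fst (es ! e))" "ints s ''v'' (int e) = int (snd (es ! e))" "finite E" "e \<in> E"
  defines "s' \<equiv> effect Peel_step s"
  shows "holds_peeling (ch(k := x)) (pa(k := y)) (ed(k := e)) (Suc k) y s'" "degrees (E - {e}) s'"
    "ints s' ''x'' 0 = int y" "ints s' ''k'' 0 = int (Suc k)" "ints s' ''i'' = ints s ''i''"
proof -
  have sm: "ints s ''sm'' (int x) = int e" using assms by (simp add: degrees_def)
  have "fst (es ! e) = x \<and> snd (es ! e) = y \<or> fst (es ! e) = y \<and> snd (es ! e) = x"
    using assms(4) by (auto simp: endpoints_def doubleton_eq_iff)
  then have y: "ints s ''u'' (int e) + ints s ''v'' (int e) - int x = int y" using assms by auto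
  define s1 where "s1 = effect Peel_record s"
  have s1: "ints s1 = (ints s)(''e'' := (ints s ''e'')(0 := int e), ''y'' := (ints s ''y'')(0 := int y),
      ''ch'' := (ints s ''ch'')(int k := int x), ''pa'' := (ints s ''pa'')(int k := int y),
      ''ed'' := (ints s ''ed'')(int k := int e), ''par'' := (ints s ''par'')(int x := int y),
      ''k'' := (ints s ''k'')(0 := int (Suc k)), ''root'' := (ints s ''root'')(0 := int y))"
    using sm y assms(9,10) by (simp add: s1_def Peel_record_def add.commute)
  have s': "ints s' = (ints s1)(''deg'' := (ints s ''deg'')(int x := ints s ''deg'' (int x) - 1, int y := ints s ''deg'' (int y) - 1),
      ''sm'' := (ints s ''sm'')(int x := ints s ''sm'' (int x) - int e, int y := ints s ''sm'' (int y) - int e),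
      ''x'' := (ints s ''x'')(0 := int y))"
    using assms(7,9) by (simp add: s'_def Peel_step_def s1_def[symmetric] s1 Peel_detach_def)
  show "holds_peeling (ch(k := x)) (pa(k := y)) (ed(k := e)) (Suc k) y s'"
    using assms(1,8) unfolding holds_peeling_def s' s1 by (auto simp: less_Suc_eq)
  show "ints s' ''x'' 0 = int y" "ints s' ''k'' 0 = int (Suc k)" "ints s' ''i'' = ints s ''i''"
    unfolding s' s1 by simp_all
  have "e \<in> incident E y" using assms by (auto simp: incident_def)
  then have "card (incident E y) = Suc (card (incident E y - {e}))" "sum int (incident E y) = int e + sum int (incident E y - {e})"
    using card.remove[of "incident E y" e] sum.remove[of "incident E y" e int] assms(13) by simp_all
  then show "degrees (E - {e}) s'"
    using assms(2-4,7) unfolding degrees_def s' s1 by (auto simp: incident_remove)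
qed

lemma tr_Peel:
  assumes inp: "holds_input s" and "degrees {..<m} s"
  shows "tr Peel s (1000 * n) (\<lambda>s'. \<exists>ch pa ed r. peeled ch pa ed m {} r \<and> holds_peeling ch pa ed m r s')"
  unfolding Peel_def
proof (rule tr_step)
  let ?s = "effect (Seq (Set ''i'' (Const 0)) (Seq (Set ''x'' (Const 0)) (Seq (Set ''k'' (Const 0)) (Set ''root'' (Const 0))))) s"
  \<comment> \<open>All vertices up to the scan position \<open>i\<close>, except possibly the
    current \<open>x\<close>, are no leaves. Removing the leaf \<open>x\<close> can turn only its
    neighbour into a leaf, and that neighbour becomes the current vertex. The value \<open>n\<close>
    for both \<open>i\<close> and \<open>x\<close> marks the end.\<close>
  let ?J = "\<lambda>s'. \<exists>ch pa ed r k E i x. peeled ch pa ed k E r \<and> holds_peeling ch pa ed k r s' \<and> degrees E s' \<and>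
    ints s' ''i'' 0 = int i \<and> ints s' ''x'' 0 = int x \<and> ints s' ''k'' 0 = int k \<and>
    (i < n \<and> x < n \<or> i = n \<and> x = n) \<and> (\<forall>v\<le>i. v \<noteq> x \<longrightarrow> card (incident E v) \<noteq> 1)"
  \<comment> \<open>Each round advances the scan or removes an edge, which gives at most
    \<open>n + m \<le> 2 * n\<close> rounds.\<close>
  let ?\<mu> = "\<lambda>s'. nat (int n - ints s' ''i'' 0) + nat (int m - ints s' ''k'' 0)"
  show "tr (While (ILess (Var ''i'') (Var ''n'')) Peel_body) ?s ((200 + 42) * (2 * n))
    (\<lambda>s'. \<exists>ch pa ed r. peeled ch pa ed m {} r \<and> holds_peeling ch pa ed m r s')"
  proof (rule tr_While'[where J = ?J and \<mu> = ?\<mu> and K = 200 and Y = "2 * n"])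
    have "peeled ch pa ed 0 {..<m} 0" for ch pa ed using n_pos by (simp add: peeled_def)
    moreover have "holds_peeling ch pa ed 0 0 ?s" for ch pa ed by (simp add: holds_peeling_def)
    moreover have "degrees {..<m} ?s" using assms(2) by (simp add: degrees_def)
    moreover have "ints ?s ''i'' 0 = int 0 \<and> ints ?s ''x'' 0 = int 0 \<and> ints ?s ''k'' 0 = int 0" by simp
    ultimately show "?J ?s" using n_pos
      by (intro exI[of _ 0] exI[of _ "{..<m}"] exI[of _ "\<lambda>_. 0"] conjI) (auto simp del: effect.simps)
  next
    fix s'
    assume J: "?J s'" and fr: "framed Peel_body ?s s'" and b: "bval (ILess (Var ''i'') (Var ''n'')) s'"
    have inp': "holds_input s'" using inp by (rule holds_input_frame[where X = "iwr Peel_body" and Y = "{}"])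
      (use fr in \<open>auto simp: frame_def\<close>)
    from J obtain ch pa ed r k E i x where
      p: "peeled ch pa ed k E r" "holds_peeling ch pa ed k r s'" "degrees E s'"
      and v: "ints s' ''i'' 0 = int i" "ints s' ''x'' 0 = int x" "ints s' ''k'' 0 = int k"
      and ix: "i < n \<and> x < n \<or> i = n \<and> x = n" and dn: "\<forall>v\<le>i. v \<noteq> x \<longrightarrow> card (incident E v) \<noteq> 1"
      by (elim exE conjE) (rule that; assumption)
    have "i < n" using b inp' v by (simp add: holds_input_def)
    with ix have x: "x < n" by auto
    have E: "E \<subseteq> {..<m}" "finite E" "k + card E = m" using p(1) finite_subset by (auto simp: peeled_def)
    show "tr Peel_body s' 200 (\<lambda>s''. ?J s'' \<and> ?\<mu> s'' < ?\<mu> s')"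
    proof (cases "card (incident E x) = 1")
      case True
      then obtain e where e: "incident E x = {e}" by (auto simp: card_1_singleton_iff)
      then have eE: "e \<in> E" "x \<in> endpoints e" "e < m" using E by (auto simp: incident_def)
      then obtain y where y: "endpoints e = {x, y}" "y \<noteq> x" "y < n"
        using wf_edge[OF wf, of "endpoints e" x] by (auto simp: edges_eq verts_eq)
      have uv: "ints s' ''u'' (int e) = int (fst (es ! e))" "ints s' ''v'' (int e) = int (snd (es ! e))"
        using inp' eE by (simp_all add: holds_input_def)
      have "\<forall>j<k. ch j \<noteq> x" using p(1) eE by (auto simp: peeled_def)
      note st = effect_Peel_step[OF p(2,3) e y(1) x y(3) y(2)[symmetric] this v(2,3) uv E(2) eE(1)]
      have "card E > 0" using eE E by (auto simp: card_gt_0_iff)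
      then have "k < m" using E by linarith
      have "\<forall>v\<le>i. v \<noteq> y \<longrightarrow> card (incident (E - {e}) v) \<noteq> 1"
        using dn e y by (auto simp: incident_remove)
      then have "?J (effect Peel_step s')"
        using peeled_step[OF p(1) e y(1)] st v \<open>i < n\<close> y(3) by metis
      moreover have "effect Peel_body s' = effect Peel_step s'"
        using p(3) x True v unfolding Peel_body_def by (simp add: degrees_def)
      ultimately show ?thesis
        using st v \<open>k < m\<close> by (intro tr_effect[OF Peel_body_time]) simp
    next
      case False
      have eff: "effect Peel_body s' = iupdate (iupdate s' ''i'' 0 (int (Suc i))) ''x'' 0 (int (Suc i))" (is "_ = ?t")
      proof -
        have "\<not> (0 < card (incident E x) \<and> card (incident E x) < 2)" using False by linarith
        then show ?thesis using p(3) x v unfolding Peel_body_def by (auto simp: degrees_def add.commute)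
      qed
      have t: "holds_peeling ch pa ed k r ?t" "degrees E ?t" using p by (simp_all add: holds_peeling_def degrees_def)
      have t': "ints ?t ''i'' 0 = int (Suc i)" "ints ?t ''x'' 0 = int (Suc i)" "ints ?t ''k'' 0 = int k"
        using v by simp_all
      have dn': "\<forall>v\<le>Suc i. v \<noteq> Suc i \<longrightarrow> card (incident E v) \<noteq> 1"
        using dn False by (metis le_Suc_eq)
      have ix': "Suc i < n \<and> Suc i < n \<or> Suc i = n \<and> Suc i = n" using \<open>i < n\<close> by linarith
      have "?J ?t"
        by (intro exI conjI) (rule p(1) t t' ix' dn')+
      then show ?thesis using v \<open>i < n\<close> unfolding eff[symmetric]
        by (intro tr_effect[OF Peel_body_time]) (simp add: eff)
    qed
  next
    fix s' assume J: "?J s'" and b: "\<not> bval (ILess (Var ''i'') (Var ''n'')) s'"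
      and fr: "framed Peel_body ?s s'"
    have "ints s' ''n'' 0 = int n" using inp by (simp add: frame_ints[OF fr] holds_input_def)
    with b have ni: "\<not> ints s' ''i'' 0 < int n" by simp
    from J obtain ch pa ed r k E i x where P: "peeled ch pa ed k E r" "holds_peeling ch pa ed k r s'"
      "ints s' ''i'' 0 = int i" "i < n \<and> x < n \<or> i = n \<and> x = n" "\<forall>v\<le>i. v \<noteq> x \<longrightarrow> card (incident E v) \<noteq> 1"
      by (elim exE conjE) (rule that; assumption)
    have "i = n" "x = n" using P(3,4) ni by linarith+
    with P(5) have "\<forall>v\<le>n. v \<noteq> n \<longrightarrow> card (incident E v) \<noteq> 1" by simp
    then have "\<forall>v<n. card (incident E v) \<noteq> 1" by (simp add: less_imp_le)
    note fin = peeled_finished[OF P(1) this]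
    show "\<exists>ch pa ed r. peeled ch pa ed m {} r \<and> holds_peeling ch pa ed m r s'"
      using P(1,2) unfolding fin by (intro exI conjI)
  qed (use n_pos m_le_n in auto)
qed (use n_pos in simp_all)

end

section \<open>The recurrence evaluated in memory\<close>

definition Init_A :: com where
  "Init_A = For ''a'' (Const 0) (Var ''n'') (For ''r'' (Const 0) (Var ''W'')
     (RWrite ''A'' (IAdd (IRead ''row'' (Var ''a'')) (Var ''r'')) (RMul (RRead ''cfix'' (Const 0)) (OfInt (Var ''r'')))))"

definition Load :: com where
  "Load = Seq (Set ''x'' (IRead ''ch'' (Var ''k''))) (Seq (Set ''y'' (IRead ''pa'' (Var ''k''))) (Seq (Set ''e'' (IRead ''ed'' (Var ''k'')))
     (Seq (Set ''rx'' (IRead ''row'' (Var ''x''))) (Seq (Set ''ry'' (IRead ''row'' (Var ''y''))) (Seq (Set ''rk'' (IRead ''row'' (Var ''k'')))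
     (Seq (Set ''hi1'' (IAdd (IRead ''fmax'' (Var ''e'')) (Const 1))) (Seq (Set ''lo'' (IRead ''fmin'' (Var ''e'')))
       (If (ILess (Var ''lo'') (Const 0)) (Set ''lo'' (Const 0)) Skip))))))))"

text \<open>Machine subtraction is not truncated, so the number of paths to be started is computed
  by a case distinction.\<close>

definition Up_inner :: com where
  "Up_inner = Seq (If (ILess (Var ''r'') (Var ''F''))
       (RWrite ''t'' (Const 0) (RMul (RRead ''cfix'' (Const 0)) (OfInt (ISub (Var ''F'') (Var ''r'')))))
       (RWrite ''t'' (Const 0) (OfInt (Const 0))))
     (Minimize (RAdd (RRead ''A'' (IAdd (Var ''rx'') (Var ''r''))) (RRead ''t'' (Const 0))) (Var ''r'') (Const 0))"

definition Up_min :: com where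
  "Up_min = Seq (Set ''has'' (Const 0)) (For ''r'' (Const 0) (Var ''W'') Up_inner)"

definition Up_store :: com where
  "Up_store = Seq (RWrite ''D'' (Var ''F'') (RAdd (RRead ''best'' (Const 0)) (RMul (RRead ''c'' (Var ''e'')) (OfInt (Var ''F'')))))
     (IWrite ''da'' (IAdd (Var ''rk'') (Var ''F'')) (Var ''a1''))"

definition Up :: com where
  "Up = For ''F'' (Const 0) (Var ''W'') (Seq Up_min Up_store)"

text \<open>Here \<open>r\<close> is the count taken from \<open>pa k\<close>. The tests
  \<open>d \<le> r\<close> and \<open>r < W\<close> are the membership conditions of
  \<open>choices\<close> that the loop ranges do not enforce.\<close>

definition Join_inner :: com where
  "Join_inner = Seq (Set ''r'' (ISub (IAdd (Var ''q'') (IAdd (Var ''d'') (Var ''d''))) (Var ''F'')))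
     (If (And (Not (ILess (Var ''r'') (Var ''d''))) (ILess (Var ''r'') (Var ''W'')))
       (Minimize (RSub (RAdd (RRead ''A'' (IAdd (Var ''ry'') (Var ''r''))) (RRead ''D'' (Var ''F'')))
         (RMul (RRead ''cfix'' (Const 0)) (OfInt (Var ''d'')))) (Var ''F'') (Var ''d''))
       Skip)"

definition Join_min :: com where
  "Join_min = Seq (Set ''has'' (Const 0)) (For ''F'' (Var ''lo'') (Var ''hi1'')
     (For ''d'' (Const 0) (IAdd (Var ''F'') (Const 1)) Join_inner))"

definition Join_store :: com where
  "Join_store = Seq (RWrite ''T'' (Var ''q'') (RRead ''best'' (Const 0)))
     (Seq (IWrite ''af'' (IAdd (Var ''rk'') (Var ''q'')) (Var ''a1'')) (IWrite ''am'' (IAdd (Var ''rk'') (Var ''q'')) (Var ''a2'')))"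

definition Join :: com where
  "Join = For ''q'' (Const 0) (Var ''W'') (Seq Join_min Join_store)"

text \<open>Every \<open>q\<close> reads the old row of \<open>pa k\<close>, so the new values are
  collected in \<open>T\<close> and written back only when all are known.\<close>

definition Copy :: com where
  "Copy = For ''q'' (Const 0) (Var ''W'') (RWrite ''A'' (IAdd (Var ''ry'') (Var ''q'')) (RRead ''T'' (Var ''q'')))"

definition DP :: com where
  "DP = For ''k'' (Const 0) (Var ''m'') (Seq Load (Seq Up (Seq Join Copy)))"

definition Root :: com where
  "Root = Seq (Seq (Set ''has'' (Const 0)) (Set ''rx'' (IRead ''row'' (Var ''root''))))
     (For ''r'' (Const 0) (Var ''W'') (Minimize (RRead ''A'' (IAdd (Var ''rx'') (Var ''r''))) (Var ''r'') (Const 0)))"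

lemma DP_wr [simp]:
  "iwr Init_A = {''a'', ''r''}" "rwr Init_A = {''A''}"
  "iwr Load = {''x'', ''y'', ''e'', ''rx'', ''ry'', ''rk'', ''lo'', ''hi1''}" "rwr Load = {}"
  "iwr Up_inner = {''has'', ''a1'', ''a2''}" "rwr Up_inner = {''t'', ''cand'', ''best''}"
  "iwr Up_min = {''has'', ''a1'', ''a2'', ''r''}" "rwr Up_min = {''t'', ''cand'', ''best''}"
  "iwr Up_store = {''da''}" "rwr Up_store = {''D''}"
  "iwr Up = {''F'', ''has'', ''a1'', ''a2'', ''r'', ''da''}" "rwr Up = {''t'', ''cand'', ''best'', ''D''}"
  "iwr Join_inner = {''r'', ''has'', ''a1'', ''a2''}" "rwr Join_inner = {''cand'', ''best''}"
  "iwr Join_min = {''has'', ''F'', ''d'', ''r'', ''a1'', ''a2''}" "rwr Join_min = {''cand'', ''best''}"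
  "iwr Join_store = {''af'', ''am''}" "rwr Join_store = {''T''}"
  "iwr Join = {''q'', ''has'', ''F'', ''d'', ''r'', ''a1'', ''a2'', ''af'', ''am''}" "rwr Join = {''cand'', ''best'', ''T''}"
  "iwr Copy = {''q''}" "rwr Copy = {''A''}"
  "iwr Root = {''has'', ''rx'', ''r'', ''a1'', ''a2''}" "rwr Root = {''cand'', ''best''}"
  by (auto simp: Init_A_def Load_def Up_inner_def Up_min_def Up_store_def Up_def Join_inner_def Join_min_def
    Join_store_def Join_def Copy_def Root_def)

lemma DP_wr2 [simp]:
  "iwr DP = {''k'', ''x'', ''y'', ''e'', ''rx'', ''ry'', ''rk'', ''lo'', ''hi1'', ''F'', ''has'', ''a1'', ''a2'', ''r'', ''da'',
    ''q'', ''d'', ''af'', ''am''}"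
  "rwr DP = {''t'', ''cand'', ''best'', ''D'', ''T'', ''A''}"
  by (auto simp: DP_def)

locale lp_run = lp_input I es n m + lp_peeling n m root ch pa I B
  for I es n m root ch pa B +
  fixes ed :: "nat \<Rightarrow> nat"
  assumes ed: "k < m \<Longrightarrow> ed k < m \<and> endpoints (ed k) = edge k"
begin

definition idx :: "nat \<Rightarrow> nat \<Rightarrow> int" where "idx v r = int (v * Suc B + r)"

lemma idx_0 [simp]: "idx v 0 + int r = idx v r"
  by (simp add: idx_def)

lemma idx_eq [simp]: "r \<le> B \<Longrightarrow> r' \<le> B \<Longrightarrow> idx v r = idx v' r' \<longleftrightarrow> v = v' \<and> r = r'"
proof -
  assume r: "r \<le> B" "r' \<le> B"
  have "v = v' \<and> r = r'" if "v * Suc B + r = v' * Suc B + r'"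
  proof -
    have "(v * Suc B + r) div Suc B = (v' * Suc B + r') div Suc B"
      "(v * Suc B + r) mod Suc B = (v' * Suc B + r') mod Suc B" using that by simp_all
    then show ?thesis using r by (simp only: div_mult_self3 mod_mult_self3) simp
  qed
  then show ?thesis unfolding idx_def of_nat_eq_iff by blast
qed

definition ready :: "state \<Rightarrow> bool" where
  "ready s \<longleftrightarrow> holds_input s \<and> holds_peeling ch pa ed m root s \<and> ints s ''B'' 0 = int B \<and> ints s ''W'' 0 = int (Suc B) \<and>
     (\<forall>i\<le>n. ints s ''row'' (int i) = idx i 0)"

lemma ready_frame:
  assumes "ready s" "frame X Y s s'"
    "X \<inter> {''n'', ''m'', ''u'', ''v'', ''fmin'', ''fmax'', ''ch'', ''pa'', ''ed'', ''par'', ''root'', ''B'', ''W'', ''row''} = {}"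
    "Y \<inter> {''c'', ''cfix''} = {}"
  shows "ready s'"
  using assms(1,3,4) holds_input_frame[OF _ assms(2)]
  by (simp add: ready_def holds_peeling_def frame_ints[OF assms(2)])

definition loaded :: "nat \<Rightarrow> state \<Rightarrow> bool" where
  "loaded k s \<longleftrightarrow> ready s \<and> k < m \<and> ints s ''e'' 0 = int (ed k) \<and> ints s ''lo'' 0 = int (lo k) \<and> ints s ''hi1'' 0 = int (Suc (hi k)) \<and>
     ints s ''rx'' 0 = idx (ch k) 0 \<and> ints s ''ry'' 0 = idx (pa k) 0 \<and> ints s ''rk'' 0 = idx k 0"

lemma loaded_frame:
  assumes "loaded k s" "frame X Y s s'"
    "X \<inter> {''n'', ''m'', ''u'', ''v'', ''fmin'', ''fmax'', ''ch'', ''pa'', ''ed'', ''par'', ''root'', ''B'', ''W'', ''row'',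
      ''e'', ''lo'', ''hi1'', ''rx'', ''ry'', ''rk''} = {}"
    "Y \<inter> {''c'', ''cfix''} = {}"
  shows "loaded k s'"
  using assms(1,3,4) ready_frame[OF _ assms(2)]
  by (simp add: loaded_def frame_ints[OF assms(2)])

lemma readyD:
  assumes "ready s"
  shows "ints s ''n'' 0 = int n" "ints s ''m'' 0 = int m" "ints s ''W'' 0 = int (Suc B)" "ints s ''B'' 0 = int B"
    "reals s ''cfix'' 0 = cfix I" "ints s ''root'' 0 = int root" "v \<le> n \<Longrightarrow> ints s ''row'' (int v) = idx v 0"
    "k < m \<Longrightarrow> ints s ''ch'' (int k) = int (ch k)" "k < m \<Longrightarrow> ints s ''pa'' (int k) = int (pa k)"
    "k < m \<Longrightarrow> ints s ''ed'' (int k) = int (ed k)" "k < m \<Longrightarrow> ints s ''par'' (int (ch k)) = int (pa k)"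
    "k < m \<Longrightarrow> ints s ''fmin'' (int (ed k)) = fmin I (edge k)" "k < m \<Longrightarrow> ints s ''fmax'' (int (ed k)) = fmax I (edge k)"
    "k < m \<Longrightarrow> reals s ''c'' (int (ed k)) = wt k"
  using assms ed by (simp_all add: ready_def holds_input_def holds_peeling_def)

lemma loadedD:
  assumes "loaded k s"
  shows "ready s" "k < m" "ints s ''e'' 0 = int (ed k)" "ints s ''lo'' 0 = int (lo k)" "ints s ''hi1'' 0 = int (Suc (hi k))"
    "ints s ''rx'' 0 = idx (ch k) 0" "ints s ''ry'' 0 = idx (pa k) 0" "ints s ''rk'' 0 = idx k 0"
  using assms by (simp_all add: loaded_def)

definition holds_A :: "(nat \<Rightarrow> nat \<Rightarrow> real) \<Rightarrow> state \<Rightarrow> bool" where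
  "holds_A a s \<longleftrightarrow> (\<forall>v<n. \<forall>r\<le>B. reals s ''A'' (idx v r) = a v r)"

lemma tr_Init_A:
  assumes "ready s"
  shows "tr Init_A s (200 * (n * Suc B)) (holds_A (A 0))"
  unfolding Init_A_def
proof (rule tr_For[where l = 0 and h = n and K = 70 and X = "Suc B" and Y = n
      and J = "\<lambda>j s'. \<forall>v<j. \<forall>r\<le>B. reals s' ''A'' (idx v r) = cfix I * real r"])
  let ?J = "\<lambda>j s'. \<forall>v<j. \<forall>r\<le>B. reals s' ''A'' (idx v r) = cfix I * real r"
  let ?b = "RWrite ''A'' (IAdd (IRead ''row'' (Var ''a'')) (Var ''r'')) (RMul (RRead ''cfix'' (Const 0)) (OfInt (Var ''r'')))"
  let ?f = "For ''r'' (Const 0) (Var ''W'') ?b"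
  fix j s'
  assume j: "j < n" "?J j s'" "ints s' ''a'' 0 = int j"
    and fr: "framed_loop ''a'' ?f s s'"
  have R: "ready s'" by (rule ready_frame[OF assms fr]) simp_all
  show "tr ?f s' (70 * Suc B) (\<lambda>s''. \<forall>v<Suc j. \<forall>r\<le>B. reals (iupdate s'' ''a'' 0 (int (Suc j))) ''A'' (idx v r) = cfix I * real r)"
  proof (rule tr_For[where l = 0 and h = "Suc B" and K = 20 and X = 1 and Y = "Suc B"
      and J = "\<lambda>i s''. (?J j s'') \<and> (\<forall>r<i. reals s'' ''A'' (idx j r) = cfix I * real r)"])
    fix i s''
    assume i: "i < Suc B" "(?J j s'') \<and> (\<forall>r<i. reals s'' ''A'' (idx j r) = cfix I * real r)"
      "ints s'' ''r'' 0 = int i" and fr2: "framed_loop ''r'' ?b s' s''"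
    have R2: "ready s''" by (rule ready_frame[OF R fr2]) simp_all
    have a: "ints s'' ''a'' 0 = int j" using j(3) by (simp add: frame_ints[OF fr2])
    show "tr ?b s'' (20 * 1) (\<lambda>s'''. (?J j (iupdate s''' ''r'' 0 (int (Suc i)))) \<and>
      (\<forall>r<Suc i. reals (iupdate s''' ''r'' 0 (int (Suc i))) ''A'' (idx j r) = cfix I * real r))"
    proof (rule tr_effect)
      have "i \<le> B" "j \<le> n" using i j(1) by simp_all
      then show "(?J j (iupdate (effect ?b s'') ''r'' 0 (int (Suc i)))) \<and>
      (\<forall>r<Suc i. reals (iupdate (effect ?b s'') ''r'' 0 (int (Suc i))) ''A'' (idx j r) = cfix I * real r)"
        using i a by (auto simp: readyD[OF R2] less_Suc_eq)
    qed simp_all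
  next
    fix s'' :: state assume "(?J j s'') \<and> (\<forall>r<Suc B. reals s'' ''A'' (idx j r) = cfix I * real r)"
    then show "\<forall>v<Suc j. \<forall>r\<le>B. reals (iupdate s'' ''a'' 0 (int (Suc j))) ''A'' (idx v r) = cfix I * real r"
      by (auto simp: less_Suc_eq[of _ j])
  qed (use R j in \<open>simp_all add: readyD ready_frame\<close>)
next
  fix j s' assume "framed_loop ''a'' (For ''r'' (Const 0) (Var ''W'') (RWrite ''A'' (IAdd (IRead ''row'' (Var ''a'')) (Var ''r'')) (RMul (RRead ''cfix'' (Const 0)) (OfInt (Var ''r''))))) s s'"
  from ready_frame[OF assms this] show "ival (Var ''n'') s' = int n" by (simp add: readyD)
qed (use n_pos in \<open>simp_all add: holds_A_def\<close>)

lemma tr_Load: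
  assumes "ready s" "k < m" "ints s ''k'' 0 = int k"
  shows "tr Load s 100 (\<lambda>s'. loaded k s')"
proof (rule tr_mono[OF tr_frame[OF tr_effect[where P = Load and s = s and Q = "(=) (effect Load s)", OF _ order_refl]]])
  fix s' assume s': "effect Load s = s' \<and> framed Load s s'"
  have "ready s'" by (rule ready_frame[OF assms(1) conjunct2[OF s']]) simp_all
  moreover have "ints s' ''e'' 0 = int (ed k) \<and> ints s' ''lo'' 0 = int (lo k) \<and> ints s' ''hi1'' 0 = int (Suc (hi k)) \<and>
     ints s' ''rx'' 0 = idx (ch k) 0 \<and> ints s' ''ry'' 0 = idx (pa k) 0 \<and> ints s' ''rk'' 0 = idx k 0"
    unfolding conjunct1[OF s', symmetric]
    using assms(2,3) ch_less[OF assms(2)] pa_less[OF assms(2)] m_le_n bounds[of "edge k"]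
    by (simp add: Load_def readyD[OF assms(1)] edges' add.commute)
  ultimately show "loaded k s'" using assms(2) by (simp add: loaded_def)
qed (simp_all add: Load_def)

lemma tr_Up_min:
  assumes "loaded k s" "holds_A a s" "F \<le> B" "ints s ''F'' 0 = int F"
  shows "tr Up_min s (200 * Suc B) (running_min ({..B} \<times> {0}) (\<lambda>x. a (ch k) (fst x) + cfix I * real (F - fst x)))"
  unfolding Up_min_def
proof (rule tr_step)
  let ?f = "\<lambda>x :: nat \<times> nat. a (ch k) (fst x) + cfix I * real (F - fst x)"
  let ?s = "effect (Set ''has'' (Const 0)) s"
  have L: "loaded k ?s" by (rule loaded_frame[OF assms(1), of "{''has''}" "{}"]) (simp_all add: frame_def)
  show "tr (For ''r'' (Const 0) (Var ''W'') Up_inner) ?s ((100 + 50) * (Suc B * 1)) (running_min ({..B} \<times> {0}) ?f)"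
  proof (rule tr_For[where l = 0 and h = "Suc B" and K = 100 and X = 1 and Y = "Suc B"
      and J = "\<lambda>j. running_min ({..<j} \<times> {0}) ?f"])
    show "running_min ({..<0} \<times> {0}) ?f (iupdate ?s ''r'' 0 (int 0))" by (simp add: running_min_def)
  next
    fix j s' assume fr: "framed_loop ''r'' Up_inner ?s s'"
    have R: "ready s'" by (rule loadedD(1)[OF loaded_frame[OF L fr]]) simp_all
    then show "ival (Var ''W'') s' = int (Suc B)" by (simp add: readyD)
  next
    fix j s'
    assume j: "j < Suc B" "running_min ({..<j} \<times> {0}) ?f s'" "ints s' ''r'' 0 = int j"
      and fr: "framed_loop ''r'' Up_inner ?s s'"
    have L': "loaded k s'" by (rule loaded_frame[OF L fr]) simp_all
    note R' = readyD[OF loadedD(1)[OF L']]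
    have F: "ints s' ''F'' 0 = int F" using assms(4) by (simp add: frame_ints[OF fr])
    have A: "reals s' ''A'' (idx (ch k) j) = a (ch k) j"
      using assms(1,2) j(1) ch_less[of k] by (simp add: frame_reals[OF fr] holds_A_def loaded_def)
    define t where "t = effect (If (ILess (Var ''r'') (Var ''F''))
       (RWrite ''t'' (Const 0) (RMul (RRead ''cfix'' (Const 0)) (OfInt (ISub (Var ''F'') (Var ''r'')))))
       (RWrite ''t'' (Const 0) (OfInt (Const 0)))) s'"
    have t: "ints t = ints s'" "reals t ''t'' 0 = cfix I * real (F - j)" "reals t ''A'' = reals s' ''A''" "reals t ''best'' = reals s' ''best''"
      using j F R' by (simp_all add: t_def of_nat_diff)
    define M where "M = Minimize (RAdd (RRead ''A'' (IAdd (Var ''rx'') (Var ''r''))) (RRead ''t'' (Const 0))) (Var ''r'') (Const 0)"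
    have e: "effect Up_inner s' = effect M t" by (simp only: Up_inner_def effect.simps(4) t_def M_def)
    have "running_min (insert (j, 0) ({..<j} \<times> {0})) ?f (effect M t)" unfolding M_def
    proof (rule running_min_Minimize)
      show "running_min ({..<j} \<times> {0}) ?f t" by (rule running_min_cong[OF j(2)]) (simp_all add: t)
    qed (use t A j in \<open>simp_all add: loadedD[OF L']\<close>)
    moreover have "insert (j, 0) ({..<j} \<times> {0}) = {..<Suc j} \<times> {0 :: nat}" by auto
    ultimately have *: "running_min ({..<Suc j} \<times> {0}) ?f (effect Up_inner s')" by (simp only: e)
    show "tr Up_inner s' (100 * 1) (\<lambda>s''. running_min ({..<Suc j} \<times> {0}) ?f (iupdate s'' ''r'' 0 (int (Suc j))))"
    proof (rule tr_effect)
      show "running_min ({..<Suc j} \<times> {0}) ?f (iupdate (effect Up_inner s') ''r'' 0 (int (Suc j)))"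
        by (rule running_min_cong[OF *]) simp_all
    qed (simp_all add: Up_inner_def)
  qed (use assms in \<open>simp_all add: lessThan_Suc_atMost\<close>)
qed simp_all

lemma running_minD:
  assumes "running_min S f s" "finite S" "S \<noteq> {}"
  obtains x where "x \<in> S" "ints s ''a1'' 0 = int (fst x)" "ints s ''a2'' 0 = int (snd x)"
    "reals s ''best'' 0 = f x" "f x = Min (f ` S)"
proof -
  obtain x where x: "x \<in> S" "ints s ''a1'' 0 = int (fst x)" "ints s ''a2'' 0 = int (snd x)"
    "reals s ''best'' 0 = f x" "\<forall>y\<in>S. f x \<le> f y"
    using assms(1,3) by (auto simp: running_min_def)
  moreover have "Min (f ` S) = f x" using x assms(2) by (intro Min_eqI) auto
  ultimately show ?thesis using that by metis
qed

text \<open>Minimisers are stored in a row for the step \<open>k\<close>, not for a vertex: the row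
  of \<open>pa k\<close> in \<open>A\<close> is overwritten by later steps, but backtracking needs
  the choice of each step.\<close>

definition up_table :: "(nat \<Rightarrow> nat \<Rightarrow> real) \<Rightarrow> nat \<Rightarrow> nat \<Rightarrow> state \<Rightarrow> bool" where
  "up_table a k F s \<longleftrightarrow> (\<exists>r\<le>B. ints s ''da'' (idx k F) = int r \<and>
     up a k F = a (ch k) r + cfix I * real (F - r) + wt k * real F)"

definition join_table :: "(nat \<Rightarrow> nat \<Rightarrow> real) \<Rightarrow> nat \<Rightarrow> nat \<Rightarrow> state \<Rightarrow> bool" where
  "join_table a k q s \<longleftrightarrow> (\<exists>x\<in>choices k q. ints s ''af'' (idx k q) = int (fst x) \<and> ints s ''am'' (idx k q) = int (snd x) \<and>
     Min (join a k q ` choices k q) = join a k q x)"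

text \<open>Frames speak of whole arrays, so the survival of the rows of \<open>da\<close> that
  belong to other steps has to be stated separately.\<close>

lemma tr_Up:
  assumes "loaded k s" "holds_A a s"
  shows "tr Up s (400 * (Suc B * Suc B)) (\<lambda>s'. (\<forall>F\<le>B. reals s' ''D'' (int F) = up a k F \<and> up_table a k F s') \<and>
    (\<forall>k' F. k' \<noteq> k \<longrightarrow> F \<le> B \<longrightarrow> ints s' ''da'' (idx k' F) = ints s ''da'' (idx k' F)))"
  unfolding Up_def
proof (rule tr_For[where l = 0 and h = "Suc B" and K = 250 and X = "Suc B" and Y = "Suc B"
      and J = "\<lambda>j s'. (\<forall>F<j. reals s' ''D'' (int F) = up a k F \<and> up_table a k F s') \<and>
    (\<forall>k' F. k' \<noteq> k \<longrightarrow> F \<le> B \<longrightarrow> ints s' ''da'' (idx k' F) = ints s ''da'' (idx k' F))"])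
  fix j s' assume fr: "framed_loop ''F'' (Seq Up_min Up_store) s s'"
  have "ready s'" by (rule loadedD(1)[OF loaded_frame[OF assms(1) fr]]) simp_all
  then show "ival (Var ''W'') s' = int (Suc B)" by (simp add: readyD)
next
  fix j s'
  assume fr: "framed_loop ''F'' (Seq Up_min Up_store) s s'" and jB: "j < Suc B"
    and J: "(\<forall>F<j. reals s' ''D'' (int F) = up a k F \<and> up_table a k F s') \<and>
    (\<forall>k' F. k' \<noteq> k \<longrightarrow> F \<le> B \<longrightarrow> ints s' ''da'' (idx k' F) = ints s ''da'' (idx k' F))" and F: "ints s' ''F'' 0 = int j"
  have L: "loaded k s'" by (rule loaded_frame[OF assms(1) fr]) simp_all
  have A: "holds_A a s'" using assms(2) by (simp add: holds_A_def frame_reals[OF fr])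
  let ?f = "\<lambda>x :: nat \<times> nat. a (ch k) (fst x) + cfix I * real (j - fst x)"
  show "tr (Seq Up_min Up_store) s' (250 * Suc B) (\<lambda>s''. (\<forall>F<Suc j. reals (iupdate s'' ''F'' 0 (int (Suc j))) ''D'' (int F) = up a k F \<and>
      up_table a k F (iupdate s'' ''F'' 0 (int (Suc j)))) \<and>
    (\<forall>k' F. k' \<noteq> k \<longrightarrow> F \<le> B \<longrightarrow> ints (iupdate s'' ''F'' 0 (int (Suc j))) ''da'' (idx k' F) = ints s ''da'' (idx k' F)))"
  proof (rule tr_SeqI[OF tr_Up_min[OF L A _ F], where T' = 50])
    fix t assume m: "running_min ({..B} \<times> {0}) ?f t" and fr2: "framed Up_min s' t"
    have Lt: "loaded k t" by (rule loaded_frame[OF L fr2]) simp_all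
    note D = loadedD[OF Lt] readyD[OF loadedD(1)[OF Lt]]
    have t: "ints t ''F'' 0 = int j" "ints t ''da'' = ints s' ''da''" "reals t ''D'' = reals s' ''D''"
      using F by (simp_all add: frame_ints[OF fr2] frame_reals[OF fr2])
    obtain x where x: "x \<in> {..B} \<times> {0}" "ints t ''a1'' 0 = int (fst x)" "reals t ''best'' 0 = ?f x"
      "?f x = Min (?f ` ({..B} \<times> {0}))"
      by (rule running_minD[OF m]) auto
    have "?f ` ({..B} \<times> {0}) = (\<lambda>r. a (ch k) r + cfix I * real (j - r)) ` {..B}" by force
    then have upd: "up a k j = a (ch k) (fst x) + cfix I * real (j - fst x) + wt k * real j"
      unfolding up_def using x(4) by simp
    then show "tr Up_store t 50 (\<lambda>s''. (\<forall>F<Suc j. reals (iupdate s'' ''F'' 0 (int (Suc j))) ''D'' (int F) = up a k F \<and>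
      up_table a k F (iupdate s'' ''F'' 0 (int (Suc j)))) \<and>
      (\<forall>k' F. k' \<noteq> k \<longrightarrow> F \<le> B \<longrightarrow> ints (iupdate s'' ''F'' 0 (int (Suc j))) ''da'' (idx k' F) = ints s ''da'' (idx k' F)))"
      using J x(1-3) t jB by (intro tr_effect) (auto simp: Up_store_def D up_table_def less_Suc_eq)
  qed (use jB in simp_all)
qed (use assms in \<open>simp_all add: readyD loadedD less_Suc_eq_le up_table_def\<close>)

lemma tr_Join_min:
  assumes "loaded k s" "holds_A a s" "\<forall>F\<le>B. reals s ''D'' (int F) = up a k F" "q \<le> B" "ints s ''q'' 0 = int q"
  shows "tr Join_min s (250 * (Suc B * Suc B)) (running_min (choices k q) (join a k q))"
  unfolding Join_min_def
proof (rule tr_step)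
  let ?s = "effect (Set ''has'' (Const 0)) s"
  \<comment> \<open>The candidates seen so far form an initial segment of \<open>choices k q\<close>
    in the lexicographic order of the two loops.\<close>
  let ?S = "\<lambda>F i. {x \<in> choices k q. fst x < F \<or> fst x = F \<and> snd x < i}"
  let ?in = "For ''d'' (Const 0) (IAdd (Var ''F'') (Const 1)) Join_inner"
  have L: "loaded k ?s" by (rule loaded_frame[OF assms(1), of "{''has''}" "{}"]) (simp_all add: frame_def)
  have k: "k < m" using assms(1) by (simp add: loaded_def)
  show "tr (For ''F'' (Var ''lo'') (Var ''hi1'') ?in) ?s ((150 + 50) * (Suc B * Suc B)) (running_min (choices k q) (join a k q))"
  proof (rule tr_For[where l = "lo k" and h = "Suc (hi k)" and K = 150 and X = "Suc B" and Y = "Suc B"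
      and J = "\<lambda>F. running_min (?S F 0) (join a k q)"])
    have "?S (lo k) 0 = {}" by (auto simp: choices_def)
    then show "running_min (?S (lo k) 0) (join a k q) (iupdate ?s ''F'' 0 (int (lo k)))" by (simp add: running_min_def)
    have "?S (Suc (hi k)) 0 = choices k q" by (auto simp: choices_def)
    then show "\<And>s'. running_min (?S (Suc (hi k)) 0) (join a k q) s' \<Longrightarrow> running_min (choices k q) (join a k q) s'" by simp
    show "ival (Var ''lo'') ?s = int (lo k)" using loadedD[OF L] by simp
    show "lo k \<le> Suc (hi k)" using lo_hi[OF k] by simp
    show "Suc (hi k) - lo k \<le> Suc B" using hi_B[OF k] by simp
  next
    fix F s' assume fr: "framed_loop ''F'' ?in ?s s'"
    have L': "loaded k s'" by (rule loaded_frame[OF L fr]) simp_all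
    then show "ival (Var ''hi1'') s' = int (Suc (hi k))" using loadedD by simp
  next
    fix F s' assume fr: "framed_loop ''F'' ?in ?s s'" and F: "lo k \<le> F" "F < Suc (hi k)"
      and J: "running_min (?S F 0) (join a k q) s'" and iF: "ints s' ''F'' 0 = int F"
    have L': "loaded k s'" by (rule loaded_frame[OF L fr]) simp_all
    have FB: "F \<le> B" using F hi_B[OF k] by simp
    show "tr ?in s' (150 * Suc B) (\<lambda>s''. running_min (?S (Suc F) 0) (join a k q) (iupdate s'' ''F'' 0 (int (Suc F))))"
    proof (rule tr_For[where l = 0 and h = "Suc F" and K = 100 and X = 1 and Y = "Suc B"
        and J = "\<lambda>i. running_min (?S F i) (join a k q)"])
      show "running_min (?S F 0) (join a k q) (iupdate s' ''d'' 0 (int 0))" by (rule running_min_cong[OF J]) simp_all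
      have "?S (Suc F) 0 = ?S F (Suc F)" by (auto simp: choices_def)
      then show "\<And>s''. running_min (?S F (Suc F)) (join a k q) s'' \<Longrightarrow> running_min (?S (Suc F) 0) (join a k q) (iupdate s'' ''F'' 0 (int (Suc F)))"
        by (auto intro: running_min_cong)
    next
      fix i s'' assume fr2: "framed_loop ''d'' Join_inner s' s''"
      then show "ival (IAdd (Var ''F'') (Const 1)) s'' = int (Suc F)" using iF by (simp add: frame_ints[OF fr2])
    next
      fix i s'' assume fr2: "framed_loop ''d'' Join_inner s' s''" and i: "i < Suc F"
        and J2: "running_min (?S F i) (join a k q) s''" and id: "ints s'' ''d'' 0 = int i"
      have L2: "loaded k s''" by (rule loaded_frame[OF L' fr2]) simp_all
      note D = loadedD[OF L2] readyD[OF loadedD(1)[OF L2]]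
      have v: "ints s'' ''F'' 0 = int F" "ints s'' ''q'' 0 = int q" "reals s'' ''D'' (int F) = up a k F"
        using iF assms(3,5) FB by (simp_all add: frame_ints[OF fr2] frame_ints[OF fr] frame_reals[OF fr2] frame_reals[OF fr])
      have A: "reals s'' ''A'' (idx (pa k) r) = a (pa k) r" if "r \<le> B" for r
        using assms(2) that pa_less[OF k] by (simp add: holds_A_def frame_reals[OF fr2] frame_reals[OF fr])
      define t where "t = iupdate s'' ''r'' 0 (int q + (int i + int i) - int F)"
      define M where "M = Minimize (RSub (RAdd (RRead ''A'' (IAdd (Var ''ry'') (Var ''r''))) (RRead ''D'' (Var ''F'')))
         (RMul (RRead ''cfix'' (Const 0)) (OfInt (Var ''d'')))) (Var ''F'') (Var ''d'')"
      have ch: "(F, i) \<in> choices k q \<longleftrightarrow> F \<le> q + i \<and> q + 2 * i \<le> F + B" using F i by (auto simp: choices_def)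
      \<comment> \<open>The signed tests of the program agree with membership in
        \<open>choices\<close>: a negative \<open>r\<close> fails the first test because
        \<open>i\<close> is nonnegative.\<close>
      have bc: "(\<not> int q + (int i + int i) - int F < int i \<and> int q + (int i + int i) - int F < int (Suc B)) \<longleftrightarrow> (F, i) \<in> choices k q"
        unfolding ch by linarith
      have e: "effect Join_inner s'' = (if (F, i) \<in> choices k q then effect M t else t)"
        unfolding bc[symmetric] using v id by (simp add: Join_inner_def D t_def M_def)
      have "running_min (?S F (Suc i)) (join a k q) (effect Join_inner s'')"
      proof (cases "(F, i) \<in> choices k q")
        case True
        then have r: "int q + (int i + int i) - int F = int (q + 2 * i - F)" "q + 2 * i - F \<le> B" unfolding ch by auto
        have "running_min (insert (F, i) (?S F i)) (join a k q) (effect M t)" unfolding M_def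
        proof (rule running_min_Minimize)
          show "running_min (?S F i) (join a k q) t" by (rule running_min_cong[OF J2]) (simp_all add: t_def)
          show "rval (RSub (RAdd (RRead ''A'' (IAdd (Var ''ry'') (Var ''r''))) (RRead ''D'' (Var ''F'')))
            (RMul (RRead ''cfix'' (Const 0)) (OfInt (Var ''d'')))) t = join a k q (F, i)"
            using v id A[OF r(2)] unfolding t_def r(1) by (simp add: D join_def)
        qed (use v id in \<open>simp_all add: t_def\<close>)
        moreover have "insert (F, i) (?S F i) = ?S F (Suc i)" using True by auto
        ultimately show ?thesis using True e by simp
      next
        case False
        then have "?S F (Suc i) = ?S F i" by (auto simp: less_Suc_eq)
        then show ?thesis using False e running_min_cong[OF J2, of t] by (simp add: t_def)
      qed
      then have *: "running_min (?S F (Suc i)) (join a k q) (effect Join_inner s'')" .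
      show "tr Join_inner s'' (100 * 1) (\<lambda>s'''. running_min (?S F (Suc i)) (join a k q) (iupdate s''' ''d'' 0 (int (Suc i))))"
      proof (rule tr_effect)
        show "running_min (?S F (Suc i)) (join a k q) (iupdate (effect Join_inner s'') ''d'' 0 (int (Suc i)))"
          by (rule running_min_cong[OF *]) simp_all
      qed (simp_all add: Join_inner_def)
    qed (use FB in simp_all)
  qed simp_all
qed simp_all

end

context lp_run
begin

lemma tr_Join:
  assumes "loaded k s" "holds_A a s" "\<forall>F\<le>B. reals s ''D'' (int F) = up a k F"
  shows "tr Join s (400 * (Suc B * (Suc B * Suc B))) (\<lambda>s'.
    (\<forall>q\<le>B. reals s' ''T'' (int q) = Min (join a k q ` choices k q) \<and> join_table a k q s') \<and>
    (\<forall>k' q. k' \<noteq> k \<longrightarrow> q \<le> B \<longrightarrow> ints s' ''af'' (idx k' q) = ints s ''af'' (idx k' q) \<and> ints s' ''am'' (idx k' q) = ints s ''am'' (idx k' q)))"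
  unfolding Join_def
proof (rule tr_For[where l = 0 and h = "Suc B" and K = 300 and X = "Suc B * Suc B" and Y = "Suc B"
      and J = "\<lambda>j s'. (\<forall>q<j. reals s' ''T'' (int q) = Min (join a k q ` choices k q) \<and> join_table a k q s') \<and>
    (\<forall>k' q. k' \<noteq> k \<longrightarrow> q \<le> B \<longrightarrow> ints s' ''af'' (idx k' q) = ints s ''af'' (idx k' q) \<and> ints s' ''am'' (idx k' q) = ints s ''am'' (idx k' q))"])
  fix j s' assume fr: "framed_loop ''q'' (Seq Join_min Join_store) s s'"
  have "ready s'" by (rule loadedD(1)[OF loaded_frame[OF assms(1) fr]]) simp_all
  then show "ival (Var ''W'') s' = int (Suc B)" by (simp add: readyD)
next
  fix j s'
  assume fr: "framed_loop ''q'' (Seq Join_min Join_store) s s'" and jB: "j < Suc B"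
    and J: "(\<forall>q<j. reals s' ''T'' (int q) = Min (join a k q ` choices k q) \<and> join_table a k q s') \<and>
    (\<forall>k' q. k' \<noteq> k \<longrightarrow> q \<le> B \<longrightarrow> ints s' ''af'' (idx k' q) = ints s ''af'' (idx k' q) \<and> ints s' ''am'' (idx k' q) = ints s ''am'' (idx k' q))"
    and q: "ints s' ''q'' 0 = int j"
  have L: "loaded k s'" by (rule loaded_frame[OF assms(1) fr]) simp_all
  have A: "holds_A a s'" using assms(2) by (simp add: holds_A_def frame_reals[OF fr])
  have D: "\<forall>F\<le>B. reals s' ''D'' (int F) = up a k F" using assms(3) by (simp add: frame_reals[OF fr])
  have jB': "j \<le> B" using jB by simp
  have k: "k < m" using assms(1) by (simp add: loaded_def)
  show "tr (Seq Join_min Join_store) s' (300 * (Suc B * Suc B)) (\<lambda>s''.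
    (\<forall>q<Suc j. reals (iupdate s'' ''q'' 0 (int (Suc j))) ''T'' (int q) = Min (join a k q ` choices k q) \<and>
      join_table a k q (iupdate s'' ''q'' 0 (int (Suc j)))) \<and>
    (\<forall>k' q. k' \<noteq> k \<longrightarrow> q \<le> B \<longrightarrow> ints (iupdate s'' ''q'' 0 (int (Suc j))) ''af'' (idx k' q) = ints s ''af'' (idx k' q) \<and>
      ints (iupdate s'' ''q'' 0 (int (Suc j))) ''am'' (idx k' q) = ints s ''am'' (idx k' q)))"
  proof (rule tr_SeqI[OF tr_Join_min[OF L A D jB' q], where T' = 50])
    fix t assume mn: "running_min (choices k j) (join a k j) t" and fr2: "framed Join_min s' t"
    have Lt: "loaded k t" by (rule loaded_frame[OF L fr2]) simp_all
    note D = loadedD[OF Lt] readyD[OF loadedD(1)[OF Lt]]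
    have t: "ints t ''q'' 0 = int j" "ints t ''af'' = ints s' ''af''" "ints t ''am'' = ints s' ''am''" "reals t ''T'' = reals s' ''T''"
      using q by (simp_all add: frame_ints[OF fr2] frame_reals[OF fr2])
    obtain x where x: "x \<in> choices k j" "ints t ''a1'' 0 = int (fst x)" "ints t ''a2'' 0 = int (snd x)"
      "reals t ''best'' 0 = join a k j x" "join a k j x = Min (join a k j ` choices k j)"
      by (rule running_minD[OF mn finite_choices choices_nonempty[OF k jB']])
    have T: "ints (effect Join_store t) = (ints t)(''af'' := (ints s' ''af'')(idx k j := int (fst x)), ''am'' := (ints s' ''am'')(idx k j := int (snd x)))"
      "reals (effect Join_store t) = (reals t)(''T'' := (reals s' ''T'')(int j := Min (join a k j ` choices k j)))"
      using x t by (simp_all add: Join_store_def D)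
    have new: "join_table a k j (iupdate (effect Join_store t) ''q'' 0 (int (Suc j)))"
      unfolding join_table_def using x by (intro bexI[of _ x]) (simp_all add: T)
    have old: "join_table a k q (iupdate (effect Join_store t) ''q'' 0 (int (Suc j)))" if "q < j" for q
      using J that jB' by (auto simp: join_table_def T)
    show "tr Join_store t 50 (\<lambda>s''.
      (\<forall>q<Suc j. reals (iupdate s'' ''q'' 0 (int (Suc j))) ''T'' (int q) = Min (join a k q ` choices k q) \<and>
        join_table a k q (iupdate s'' ''q'' 0 (int (Suc j)))) \<and>
      (\<forall>k' q. k' \<noteq> k \<longrightarrow> q \<le> B \<longrightarrow> ints (iupdate s'' ''q'' 0 (int (Suc j))) ''af'' (idx k' q) = ints s ''af'' (idx k' q) \<and>
        ints (iupdate s'' ''q'' 0 (int (Suc j))) ''am'' (idx k' q) = ints s ''am'' (idx k' q)))"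
      using J new old jB' by (intro tr_effect) (simp add: Join_store_def, simp add: Join_store_def, auto simp: T less_Suc_eq)
  qed simp
qed (use assms in \<open>simp_all add: readyD loadedD less_Suc_eq_le join_table_def\<close>)

lemma tr_Copy:
  assumes "loaded k s" "holds_A a s" "\<forall>q\<le>B. reals s ''T'' (int q) = g q"
  shows "tr Copy s (100 * Suc B) (holds_A (a(pa k := g)))"
  unfolding Copy_def
proof (rule tr_For[where l = 0 and h = "Suc B" and K = 50 and X = 1 and Y = "Suc B"
      and J = "\<lambda>j s'. \<forall>v<n. \<forall>r\<le>B. reals s' ''A'' (idx v r) = (if v = pa k \<and> r < j then g r else a v r)"])
  let ?J = "\<lambda>j s'. \<forall>v<n. \<forall>r\<le>B. reals s' ''A'' (idx v r) = (if v = pa k \<and> r < j then g r else a v r)"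
  let ?b = "RWrite ''A'' (IAdd (Var ''ry'') (Var ''q'')) (RRead ''T'' (Var ''q''))"
  fix j s' assume fr: "framed_loop ''q'' ?b s s'"
  have L: "loaded k s'" by (rule loaded_frame[OF assms(1) fr]) simp_all
  then have "ready s'" by (rule loadedD)
  then show "ival (Var ''W'') s' = int (Suc B)" by (simp add: readyD)
  assume J: "?J j s'" and jB: "j < Suc B"
    and q: "ints s' ''q'' 0 = int j"
  have "reals s' ''T'' (int j) = g j" using assms(3) jB by (simp add: frame_reals[OF fr])
  then show "tr ?b s' (50 * 1) (\<lambda>s''. ?J (Suc j) (iupdate s'' ''q'' 0 (int (Suc j))))"
    using J q jB by (intro tr_effect) (auto simp: loadedD[OF L])
qed (use assms in \<open>auto simp: holds_A_def less_Suc_eq_le\<close>)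

definition tables :: "nat \<Rightarrow> state \<Rightarrow> bool" where
  "tables k s \<longleftrightarrow> (\<forall>j<k. \<forall>q\<le>B. up_table (A j) j q s \<and> join_table (A j) j q s)"

lemma tr_DP:
  assumes "ready s" "holds_A (A 0) s"
  shows "tr DP s (2000 * (n * (Suc B * (Suc B * Suc B)))) (\<lambda>s'. holds_A (A m) s' \<and> tables m s')"
  unfolding DP_def
proof (rule tr_For[where l = 0 and h = m and K = 1900 and X = "Suc B * (Suc B * Suc B)" and Y = n
      and J = "\<lambda>k s'. holds_A (A k) s' \<and> tables k s'"])
  let ?b = "Seq Load (Seq Up (Seq Join Copy))"
  fix k s' assume fr: "framed_loop ''k'' ?b s s'"
  have R: "ready s'" by (rule ready_frame[OF assms(1) fr]) simp_all
  then show "ival (Var ''m'') s' = int m" by (simp add: readyD)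
  assume k: "k < m" "ints s' ''k'' 0 = int k" and J: "holds_A (A k) s' \<and> tables k s'"
  let ?Q = "\<lambda>s''. holds_A (A (Suc k)) (iupdate s'' ''k'' 0 (int (Suc k))) \<and> tables (Suc k) (iupdate s'' ''k'' 0 (int (Suc k)))"
  let ?W = "Suc B" and ?W3 = "Suc B * (Suc B * Suc B)"
  have W: "1 \<le> ?W3" "?W \<le> ?W3" "?W * ?W \<le> ?W3" by (simp_all add: algebra_simps)
  show "tr ?b s' (1900 * ?W3) ?Q"
  proof (rule tr_SeqI[OF tr_Load[OF R k], where T' = "1800 * ?W3"])
    fix s1 assume L1: "loaded k s1" and f1: "framed Load s' s1"
    have A1: "holds_A (A k) s1" using J by (simp add: holds_A_def frame_reals[OF f1])
    show "tr (Seq Up (Seq Join Copy)) s1 (1800 * ?W3) ?Q"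
    proof (rule tr_SeqI[OF tr_Up[OF L1 A1], where T' = "1400 * ?W3"])
      fix s2 assume P2: "(\<forall>F\<le>B. reals s2 ''D'' (int F) = up (A k) k F \<and> up_table (A k) k F s2) \<and>
        (\<forall>k' F. k' \<noteq> k \<longrightarrow> F \<le> B \<longrightarrow> ints s2 ''da'' (idx k' F) = ints s1 ''da'' (idx k' F))"
        and f2: "framed Up s1 s2"
      have L2: "loaded k s2" by (rule loaded_frame[OF L1 f2]) simp_all
      have A2: "holds_A (A k) s2" using A1 by (simp add: holds_A_def frame_reals[OF f2])
      have D2: "\<forall>F\<le>B. reals s2 ''D'' (int F) = up (A k) k F" using P2 by simp
      show "tr (Seq Join Copy) s2 (1400 * ?W3) ?Q"
      proof (rule tr_SeqI[OF tr_Join[OF L2 A2 D2], where T' = "1000 * ?W3"])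
        fix s3 assume P3: "(\<forall>q\<le>B. reals s3 ''T'' (int q) = Min (join (A k) k q ` choices k q) \<and> join_table (A k) k q s3) \<and>
          (\<forall>k' q. k' \<noteq> k \<longrightarrow> q \<le> B \<longrightarrow> ints s3 ''af'' (idx k' q) = ints s2 ''af'' (idx k' q) \<and> ints s3 ''am'' (idx k' q) = ints s2 ''am'' (idx k' q))"
          and f3: "framed Join s2 s3"
        have L3: "loaded k s3" by (rule loaded_frame[OF L2 f3]) simp_all
        have A3: "holds_A (A k) s3" using A2 by (simp add: holds_A_def frame_reals[OF f3])
        have T3: "\<forall>q\<le>B. reals s3 ''T'' (int q) = (\<lambda>q. Min (join (A k) k q ` choices k q)) q" using P3 by simp
        show "tr Copy s3 (1000 * ?W3) ?Q"
        proof (rule tr_mono[OF tr_frame[OF tr_Copy[OF L3 A3 T3]]])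
          fix s4 assume P4: "holds_A ((A k)(pa k := \<lambda>q. Min (join (A k) k q ` choices k q))) s4 \<and> framed Copy s3 s4"
          note f4 = conjunct2[OF P4]
          have i4: "ints s4 ''da'' = ints s2 ''da''" "ints s4 ''af'' = ints s3 ''af''" "ints s4 ''am'' = ints s3 ''am''"
            "ints s2 ''af'' = ints s' ''af''" "ints s2 ''am'' = ints s' ''am''" "ints s1 ''da'' = ints s' ''da''"
            by (simp_all add: frame_ints[OF f4] frame_ints[OF f3] frame_ints[OF f2] frame_ints[OF f1])
          have "up_table (A j) j q s4 \<and> join_table (A j) j q s4" if "j < Suc k" "q \<le> B" for j q
          proof (cases "j = k")
            case True
            then show ?thesis using P2 P3 that(2) by (simp add: up_table_def join_table_def i4)
          next
            case False
            then have "up_table (A j) j q s' \<and> join_table (A j) j q s'" using J that by (simp add: tables_def)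
            moreover have "ints s4 ''da'' (idx j q) = ints s' ''da'' (idx j q)"
              "ints s4 ''af'' (idx j q) = ints s' ''af'' (idx j q)" "ints s4 ''am'' (idx j q) = ints s' ''am'' (idx j q)"
              using P2 P3 False that(2) by (simp_all add: i4)
            ultimately show ?thesis by (simp add: up_table_def join_table_def)
          qed
          then have "tables (Suc k) (iupdate s4 ''k'' 0 (int (Suc k)))"
            by (simp add: tables_def up_table_def join_table_def)
          moreover have "holds_A (A (Suc k)) (iupdate s4 ''k'' 0 (int (Suc k)))"
            using conjunct1[OF P4] by (simp add: holds_A_def)
          ultimately show "holds_A (A (Suc k)) (iupdate s4 ''k'' 0 (int (Suc k))) \<and> tables (Suc k) (iupdate s4 ''k'' 0 (int (Suc k)))" by blast
        next
          show "100 * Suc B \<le> 1000 * ?W3" by (rule mult_le_mono[OF _ W(2)]) simp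
        qed
      qed (use W in linarith)
    qed (use W in linarith)
  qed (use W in linarith)
qed (use assms m_le_n n_pos in \<open>simp_all add: tables_def holds_A_def\<close>)

lemma tr_Root:
  assumes "ready s" "holds_A (A m) s"
  shows "tr Root s (200 * Suc B) (\<lambda>s'. \<exists>r\<le>B. ints s' ''a1'' 0 = int r \<and> reals s' ''best'' 0 = A m root r \<and>
    (\<forall>r'\<le>B. A m root r \<le> A m root r'))"
  unfolding Root_def
proof (rule tr_step)
  let ?f = "\<lambda>x :: nat \<times> nat. A m root (fst x)"
  let ?b = "Minimize (RRead ''A'' (IAdd (Var ''rx'') (Var ''r''))) (Var ''r'') (Const 0)"
  let ?s = "effect (Seq (Set ''has'' (Const 0)) (Set ''rx'' (IRead ''row'' (Var ''root'')))) s"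
  have R: "ready ?s" by (rule ready_frame[OF assms(1), of "{''has'', ''rx''}" "{}"]) (simp_all add: frame_def)
  have rx: "ints ?s ''rx'' 0 = idx root 0" using root_less by (simp add: readyD[OF assms(1)])
  show "tr (For ''r'' (Const 0) (Var ''W'') ?b) ?s ((100 + 50) * (Suc B * 1))
    (\<lambda>s'. \<exists>r\<le>B. ints s' ''a1'' 0 = int r \<and> reals s' ''best'' 0 = A m root r \<and> (\<forall>r'\<le>B. A m root r \<le> A m root r'))"
  proof (rule tr_For[where l = 0 and h = "Suc B" and K = 100 and X = 1 and Y = "Suc B"
      and J = "\<lambda>j. running_min ({..<j} \<times> {0}) ?f"])
    show "running_min ({..<0} \<times> {0}) ?f (iupdate ?s ''r'' 0 (int 0))" by (simp add: running_min_def)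
  next
    fix j s' assume fr: "framed_loop ''r'' ?b ?s s'"
    have R': "ready s'" by (rule ready_frame[OF R fr]) simp_all
    then show "ival (Var ''W'') s' = int (Suc B)" by (simp add: readyD)
    assume j: "j < Suc B" "running_min ({..<j} \<times> {0}) ?f s'" "ints s' ''r'' 0 = int j"
    have "ints s' ''rx'' = ints ?s ''rx''" by (rule frame_ints[OF fr]) simp
    then have x: "ints s' ''rx'' 0 = idx root 0" using rx by simp
    have "reals s' ''A'' (idx root j) = A m root j"
      using assms(2) j(1) root_less by (simp add: frame_reals[OF fr] holds_A_def)
    then have "running_min (insert (j, 0) ({..<j} \<times> {0})) ?f (effect ?b s')"
      by (intro running_min_Minimize[OF j(2)]) (simp_all add: x j)
    moreover have "insert (j, 0) ({..<j} \<times> {0}) = {..<Suc j} \<times> {0 :: nat}" by auto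
    ultimately have *: "running_min ({..<Suc j} \<times> {0}) ?f (effect ?b s')" by simp
    show "tr ?b s' (100 * 1) (\<lambda>s''. running_min ({..<Suc j} \<times> {0}) ?f (iupdate s'' ''r'' 0 (int (Suc j))))"
    proof (rule tr_effect)
      show "running_min ({..<Suc j} \<times> {0}) ?f (iupdate (effect ?b s') ''r'' 0 (int (Suc j)))"
        by (rule running_min_cong[OF *]) simp_all
    qed simp_all
  next
    fix s' assume mn: "running_min ({..<Suc B} \<times> {0}) ?f s'"
    have fin: "finite ({..<Suc B} \<times> {0 :: nat})" "{..<Suc B} \<times> {0 :: nat} \<noteq> {}" by auto
    obtain x where x: "x \<in> {..<Suc B} \<times> {0}" "ints s' ''a1'' 0 = int (fst x)" "reals s' ''best'' 0 = ?f x"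
      "?f x = Min (?f ` ({..<Suc B} \<times> {0}))"
      by (rule running_minD[OF mn fin])
    have "A m root (fst x) \<le> A m root r" if "r \<le> B" for r
      unfolding x(4) using that by (intro Min_le) (auto intro!: image_eqI[of _ _ "(r, 0)"])
    then show "\<exists>r\<le>B. ints s' ''a1'' 0 = int r \<and> reals s' ''best'' 0 = A m root r \<and> (\<forall>r'\<le>B. A m root r \<le> A m root r')"
      using x by (intro exI[of _ "fst x"]) auto
  qed simp_all
qed simp_all

end

section \<open>Assembling the minimum cost computation\<close>

definition Solve :: com where
  "Solve = Seq (Set ''W'' (IAdd (Var ''B'') (Const 1))) (Seq (Rows ''row'' ''W'') (Seq Degrees (Seq Peel (Seq Init_A (Seq DP (Seq Root
     (Seq (RWrite ''cost'' (Const 0) (RRead ''best'' (Const 0))) (Set ''r0'' (Var ''a1''))))))))) "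

definition Min_cost :: com where
  "Min_cost = Seq Check (If (ILess (Const 0) (Var ''feasible'')) Solve Skip)"

lemma Solve_wr [simp]:
  "iwr Solve = {''W'', ''row'', ''i'', ''x'', ''y'', ''deg'', ''sm'', ''e'', ''k'', ''root'', ''ch'', ''pa'', ''ed'', ''par'',
    ''a'', ''r'', ''rx'', ''ry'', ''rk'', ''lo'', ''hi1'', ''F'', ''has'', ''a1'', ''a2'', ''da'', ''q'', ''d'', ''af'', ''am'', ''r0''}"
  "rwr Solve = {''A'', ''t'', ''cand'', ''best'', ''D'', ''T'', ''cost''}"
  by (auto simp: Solve_def)

context lp_run
begin

definition solved :: "nat \<Rightarrow> state \<Rightarrow> bool" where
  "solved r s \<longleftrightarrow> ready s \<and> tables m s \<and> r \<le> B \<and> ints s ''r0'' 0 = int r \<and> reals s ''cost'' 0 = A m root r \<and>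
     (\<forall>r'\<le>B. A m root r \<le> A m root r')"

lemma tables_frame:
  assumes "tables k s" "frame X Y s s'" "X \<inter> {''da'', ''af'', ''am''} = {}"
  shows "tables k s'"
  using assms(1,3) by (simp add: tables_def up_table_def join_table_def frame_ints[OF assms(2)])

lemma tr_DP_Root:
  assumes "ready s"
  shows "tr (Seq Init_A (Seq DP (Seq Root (Seq (RWrite ''cost'' (Const 0) (RRead ''best'' (Const 0))) (Set ''r0'' (Var ''a1''))))))
    s (3000 * (n * (Suc B * (Suc B * Suc B)))) (\<lambda>s'. \<exists>r. solved r s')"
proof (rule tr_SeqI[OF tr_Init_A[OF assms], where T' = "2300 * (n * (Suc B * (Suc B * Suc B)))"])
  let ?W3 = "n * (Suc B * (Suc B * Suc B))"
  have "1 * 1 \<le> ?W3" "1 * Suc B \<le> ?W3" by (rule mult_le_mono; use n_pos in simp)+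
  then have W: "1 \<le> ?W3" "Suc B \<le> ?W3" "n * Suc B \<le> ?W3" by simp_all
  let ?end = "Seq (RWrite ''cost'' (Const 0) (RRead ''best'' (Const 0))) (Set ''r0'' (Var ''a1''))"
  fix s1 assume A1: "holds_A (A 0) s1" and f1: "framed Init_A s s1"
  have R1: "ready s1" by (rule ready_frame[OF assms f1]) simp_all
  show "tr (Seq DP (Seq Root ?end)) s1 (2300 * ?W3) (\<lambda>s'. \<exists>r. solved r s')"
  proof (rule tr_SeqI[OF tr_DP[OF R1 A1], where T' = "300 * ?W3"])
    fix s2 assume P2: "holds_A (A m) s2 \<and> tables m s2" and f2: "framed DP s1 s2"
    have R2: "ready s2" by (rule ready_frame[OF R1 f2]) simp_all
    show "tr (Seq Root ?end) s2 (300 * ?W3) (\<lambda>s'. \<exists>r. solved r s')"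
    proof (rule tr_SeqI[OF tr_Root[OF R2 conjunct1[OF P2]], where T' = "20"])
      fix s3 assume P3: "\<exists>r\<le>B. ints s3 ''a1'' 0 = int r \<and> reals s3 ''best'' 0 = A m root r \<and> (\<forall>r'\<le>B. A m root r \<le> A m root r')"
        and f3: "framed Root s2 s3"
      have R3: "ready s3" by (rule ready_frame[OF R2 f3]) simp_all
      have T3: "tables m s3" by (rule tables_frame[OF conjunct2[OF P2] f3]) simp
      have f4: "frame {''r0''} {''cost''} s3 (effect ?end s3)" by (simp add: frame_def)
      have R4: "ready (effect ?end s3)" by (rule ready_frame[OF R3 f4]) simp_all
      have T4: "tables m (effect ?end s3)" by (rule tables_frame[OF T3 f4]) simp
      from P3 obtain r where "r \<le> B" "ints s3 ''a1'' 0 = int r" "reals s3 ''best'' 0 = A m root r" "\<forall>r'\<le>B. A m root r \<le> A m root r'"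
        by (elim exE conjE) (rule that; assumption)
      then have "solved r (effect ?end s3)" unfolding solved_def using R4 T4 by simp
      then show "tr ?end s3 20 (\<lambda>s'. \<exists>r. solved r s')" by (intro tr_effect) (simp_all only: exI, simp_all)
    next
      have "200 * Suc B \<le> 200 * ?W3" using W(2) by (rule mult_le_mono2)
      then show "200 * Suc B + 20 \<le> 300 * ?W3" using W(1) by linarith
    qed
  qed (use W in linarith)
next
  have "200 * (n * Suc B) \<le> 200 * (n * (Suc B * (Suc B * Suc B)))" by (intro mult_le_mono2) simp
  then show "200 * (n * Suc B) + 2300 * (n * (Suc B * (Suc B * Suc B))) \<le> 3000 * (n * (Suc B * (Suc B * Suc B)))" by linarith
qed

end

context lp_input
begin

text \<open>The elimination order is known only after \<open>Peel\<close> has run. The locale of the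
  dynamic program is therefore interpreted inside the proof, and its parameters are existential in
  the postcondition.\<close>

lemma tr_Solve:
  assumes inp: "holds_input s" and B: "ints s ''B'' 0 = int B" and zero: "ints s ''deg'' = (\<lambda>_. 0)" "ints s ''sm'' = (\<lambda>_. 0)"
    and bnd: "\<And>e. e \<in> edges I \<Longrightarrow> 0 \<le> fmax I e \<and> fmax I e \<le> int B"
  shows "tr Solve s (5000 * (n * (Suc B * (Suc B * Suc B)))) (\<lambda>s'. \<exists>root ch pa ed r.
    lp_run I es n m root ch pa B ed \<and> lp_run.solved I es n m root ch pa B ed r s')"
  unfolding Solve_def
proof (rule tr_step)
  let ?s = "effect (Set ''W'' (IAdd (Var ''B'') (Const 1))) s"
  let ?W3 = "n * (Suc B * (Suc B * Suc B))"
  let ?Q = "\<lambda>s'. \<exists>root ch pa ed r. lp_run I es n m root ch pa B ed \<and> lp_run.solved I es n m root ch pa B ed r s'"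
  let ?end = "Seq Init_A (Seq DP (Seq Root (Seq (RWrite ''cost'' (Const 0) (RRead ''best'' (Const 0))) (Set ''r0'' (Var ''a1'')))))"
  have W: "n \<le> ?W3" by simp
  have I0: "holds_input ?s" by (rule holds_input_frame[OF inp, of "{''W''}" "{}"]) (simp_all add: frame_def)
  have W0: "ints ?s ''W'' 0 = int (Suc B)" using B by simp
  show "tr (Seq (Rows ''row'' ''W'') (Seq Degrees (Seq Peel ?end))) ?s (4900 * ?W3) ?Q"
  proof (rule tr_SeqI[OF tr_Rows[OF I0 W0], where T' = "4400 * ?W3"])
    fix s1 assume r1: "\<forall>i\<le>n. ints s1 ''row'' (int i) = int (i * Suc B)" and f1: "framed (Rows ''row'' ''W'') ?s s1"
    have I1: "holds_input s1" by (rule holds_input_frame[OF I0 f1]) simp_all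
    have z1: "ints s1 ''deg'' = (\<lambda>_. 0)" "ints s1 ''sm'' = (\<lambda>_. 0)" using zero by (simp_all add: frame_ints[OF f1])
    show "tr (Seq Degrees (Seq Peel ?end)) s1 (4400 * ?W3) ?Q"
    proof (rule tr_SeqI[OF tr_Degrees[OF I1 z1], where T' = "4000 * ?W3"])
      fix s2 assume d2: "degrees {..<m} s2" and f2: "framed Degrees s1 s2"
      have I2: "holds_input s2" by (rule holds_input_frame[OF I1 f2]) simp_all
      show "tr (Seq Peel ?end) s2 (4000 * ?W3) ?Q"
      proof (rule tr_SeqI[OF tr_Peel[OF I2 d2], where T' = "3000 * ?W3"])
        fix s3 assume P: "\<exists>ch pa ed r. peeled ch pa ed m {} r \<and> holds_peeling ch pa ed m r s3" and f3: "framed Peel s2 s3"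
        have I3: "holds_input s3" by (rule holds_input_frame[OF I2 f3]) simp_all
        from P obtain ch pa ed root where p: "peeled ch pa ed m {} root" "holds_peeling ch pa ed m root s3" by blast
        note pp = peeled_peeling[OF p(1)]
        interpret peeling n m root ch pa by (rule pp(1))
        interpret lp_peeling n m root ch pa I B
          using pp(2) bnd wf dfix0 verts_eq by unfold_locales (auto simp: lp_instance_wf_def)
        interpret lp_run I es n m root ch pa B ed
        proof
          fix k assume k: "k < m"
          then have "ed k \<in> ed ` {..<m}" "endpoints (ed k) = {ch k, pa k}" using p(1) by (auto simp: peeled_def)
          then show "ed k < m \<and> endpoints (ed k) = edge k" using p(1) by (simp add: peeled_def edge_def)
        qed
        have "ready s3" unfolding ready_def
          using I3 p(2) r1 B by (simp add: frame_ints[OF f3] frame_ints[OF f2] frame_ints[OF f1] idx_def del: of_nat_mult of_nat_add)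
        from tr_DP_Root[OF this] show "tr ?end s3 (3000 * ?W3) ?Q"
          by (rule tr_mono) (use lp_run_axioms in blast)+
      next
        have "1000 * n \<le> 1000 * ?W3" using W by (rule mult_le_mono2)
        then show "1000 * n + 3000 * ?W3 \<le> 4000 * ?W3" by linarith
      qed
    next
      have "200 * n \<le> 200 * ?W3" using W by (rule mult_le_mono2)
      then show "200 * n + 4000 * ?W3 \<le> 4400 * ?W3" by linarith
    qed
  next
    have "100 * n \<le> 100 * ?W3" using W by (rule mult_le_mono2)
    then show "100 * n + 4400 * ?W3 \<le> 4900 * ?W3" by linarith
  qed simp_all
  have "max_time (Set ''W'' (IAdd (Var ''B'') (Const 1))) \<le> 100 * 1" by simp
  also have "\<dots> \<le> 100 * ?W3" by (rule mult_le_mono2) (use n_pos in simp)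
  finally show "max_time (Set ''W'' (IAdd (Var ''B'') (Const 1))) + 4900 * ?W3 \<le> 5000 * ?W3" by linarith
qed simp

end

section \<open>The second program: an optimal line concept\<close>

definition Backtrack_load :: com where
  "Backtrack_load = Seq (Set ''k'' (ISub (ISub (Var ''m'') (Const 1)) (Var ''t''))) (Seq (Set ''x'' (IRead ''ch'' (Var ''k'')))
     (Seq (Set ''y'' (IRead ''pa'' (Var ''k''))) (Seq (Set ''rk'' (IRead ''row'' (Var ''k''))) (Set ''q'' (IRead ''sz'' (Var ''y''))))))"

definition Backtrack_read :: com where
  "Backtrack_read = Seq (Set ''F'' (IRead ''af'' (IAdd (Var ''rk'') (Var ''q'')))) (Set ''d'' (IRead ''am'' (IAdd (Var ''rk'') (Var ''q''))))"

definition Backtrack_write :: com where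
  "Backtrack_write = Seq (Seq (IWrite ''fs'' (Var ''k'') (Var ''F'')) (IWrite ''ms'' (Var ''k'') (Var ''d'')))
    (Seq (IWrite ''sz'' (Var ''y'') (ISub (IAdd (Var ''q'') (IAdd (Var ''d'') (Var ''d''))) (Var ''F'')))
      (IWrite ''sz'' (Var ''x'') (IRead ''da'' (IAdd (Var ''rk'') (Var ''F'')))))"

definition Backtrack_body :: com where
  "Backtrack_body = Seq Backtrack_load (Seq Backtrack_read Backtrack_write)"

definition Backtrack :: com where
  "Backtrack = Seq (IWrite ''sz'' (Var ''root'') (Var ''r0'')) (For ''t'' (Const 0) (Var ''m'') Backtrack_body)"

text \<open>A one-vertex open path at \<open>a\<close> is given by its lowest vertex
  \<open>a\<close>. Whole rows are filled, and \<open>sz\<close> alone decides how many entries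
  count.\<close>

definition Fill :: com where
  "Fill = For ''a'' (Const 0) (Var ''n'') (For ''r'' (Const 0) (Var ''W'')
     (IWrite ''stk'' (IAdd (IRead ''row'' (Var ''a'')) (Var ''r'')) (Var ''a'')))"

lemma Backtrack_wr [simp]:
  "iwr Backtrack_body = {''k'', ''x'', ''y'', ''rk'', ''q'', ''F'', ''d'', ''fs'', ''ms'', ''sz''}" "rwr Backtrack_body = {}"
  "iwr Backtrack = {''t'', ''k'', ''x'', ''y'', ''rk'', ''q'', ''F'', ''d'', ''fs'', ''ms'', ''sz''}" "rwr Backtrack = {}"
  "iwr Fill = {''a'', ''r'', ''stk''}" "rwr Fill = {}"
  by (auto simp: Backtrack_body_def Backtrack_load_def Backtrack_read_def Backtrack_write_def Backtrack_def Fill_def)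

context lp_run
begin

definition holds_trace :: "(nat \<Rightarrow> nat) \<Rightarrow> (nat \<Rightarrow> nat) \<Rightarrow> state \<Rightarrow> bool" where
  "holds_trace F i s \<longleftrightarrow> (\<forall>k<m. ints s ''fs'' (int k) = int (F k) \<and> ints s ''ms'' (int k) = int (i k))"

lemma tr_Backtrack:
  assumes sol: "solved r s" and zero: "ints s ''sz'' = (\<lambda>_. 0)"
  shows "tr Backtrack s (500 * n) (\<lambda>s'. \<exists>z F i. trace z F i \<and> z m root = r \<and> holds_trace F i s' \<and>
    (\<forall>v<n. ints s' ''sz'' (int v) = int (z 0 v)))"
  unfolding Backtrack_def
proof (rule tr_step)
  let ?s = "effect (IWrite ''sz'' (Var ''root'') (Var ''r0'')) s"
  \<comment> \<open>The abstract tables of minimisers are read off the initial memory, so that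
    \<open>trace_backtrack\<close> applies to what is stored.\<close>
  define g where "g k q = (nat (ints s ''af'' (idx k q)), nat (ints s ''am'' (idx k q)))" for k q
  define h where "h k F = nat (ints s ''da'' (idx k F))" for k F
  have R: "ready s" and T: "tables m s" and r: "r \<le> B" "ints s ''r0'' 0 = int r" using sol by (simp_all add: solved_def)
  have gx: "ints s ''af'' (idx k q) = int (fst (g k q)) \<and> ints s ''am'' (idx k q) = int (snd (g k q)) \<and>
      g k q \<in> choices k q \<and> A (Suc k) (pa k) q = join (A k) k q (g k q)" if kq: "k < m" "q \<le> B" for k q
  proof -
    obtain x where x: "x \<in> choices k q" "ints s ''af'' (idx k q) = int (fst x)" "ints s ''am'' (idx k q) = int (snd x)"
      "Min (join (A k) k q ` choices k q) = join (A k) k q x"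
    proof -
      have "join_table (A k) k q s" using T kq by (simp add: tables_def)
      then show thesis unfolding join_table_def by (elim bexE conjE) (rule that; assumption)
    qed
    then have "g k q = x" by (simp add: g_def)
    with x show ?thesis by simp
  qed
  have hx: "ints s ''da'' (idx k F) = int (h k F) \<and> h k F \<le> B \<and>
      up (A k) k F = A k (ch k) (h k F) + cfix I * real (F - h k F) + wt k * real F" if kF: "k < m" "F \<le> B" for k F
  proof -
    obtain y where y: "y \<le> B" "ints s ''da'' (idx k F) = int y"
      "up (A k) k F = A k (ch k) y + cfix I * real (F - y) + wt k * real F"
    proof -
      have "up_table (A k) k F s" using T kF by (simp add: tables_def)
      then show thesis unfolding up_table_def by (elim exE conjE) (rule that; assumption)
    qed
    then have "h k F = y" by (simp add: h_def)
    with y show ?thesis by simp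
  qed
  have opt: "optimal_tables g h" unfolding optimal_tables_def using gx hx by blast
  let ?b = "backtrack g h r"
  let ?z = "\<lambda>k. ?b (m - k)"
  let ?F = "\<lambda>k. fst (g k (?z (Suc k) (pa k)))"
  let ?i = "\<lambda>k. snd (g k (?z (Suc k) (pa k)))"
  have tr: "trace ?z ?F ?i" by (rule trace_backtrack[OF opt r(1)])
  have zB: "?z k v \<le> B" for k v using tr by (simp add: trace_def)
  have R0: "ready ?s" by (rule ready_frame[OF R, of "{''sz''}" "{}"]) (simp_all add: frame_def)
  have s0: "ints ?s ''sz'' (int v) = int (?b 0 v)" for v
    using zero r by (simp add: readyD[OF R])
  let ?J = "\<lambda>t s'. (\<forall>v<n. ints s' ''sz'' (int v) = int (?b t v)) \<and>
        (\<forall>k<m. m \<le> k + t \<longrightarrow> ints s' ''fs'' (int k) = int (?F k) \<and> ints s' ''ms'' (int k) = int (?i k))"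
  show "tr (For ''t'' (Const 0) (Var ''m'') Backtrack_body) ?s ((200 + 50) * (n * 1))
    (\<lambda>s'. \<exists>z F i. trace z F i \<and> z m root = r \<and> holds_trace F i s' \<and> (\<forall>v<n. ints s' ''sz'' (int v) = int (z 0 v)))"
  proof (rule tr_For[where l = 0 and h = m and K = 200 and X = 1 and Y = n
      and J = ?J])
    fix t s' assume fr: "framed_loop ''t'' Backtrack_body ?s s'"
    have R': "ready s'" by (rule ready_frame[OF R0 fr]) simp_all
    note D = readyD[OF R']
    show "ival (Var ''m'') s' = int m" by (simp add: D)
    assume t: "t < m" "ints s' ''t'' 0 = int t"
      and J: "?J t s'"
    define k where "k = m - Suc t"
    have k: "k < m" "int m - 1 - int t = int k" "m - Suc k = t" using t by (auto simp: k_def)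
    let ?q = "?b t (pa k)"
    have q: "?q \<le> B" using zB[of "Suc k" "pa k"] k(3) by simp
    have tb: "ints s' ''af'' = ints s ''af''" "ints s' ''am'' = ints s ''am''" "ints s' ''da'' = ints s ''da''"
      by (simp_all add: frame_ints[OF fr])
    have ch: "g k ?q \<in> choices k ?q" using gx k q by blast
    have FB: "fst (g k ?q) \<le> B" using ch hi_B[OF k(1)] by (auto simp: choices_def)
    have nn: "int ?q + (int (snd (g k ?q)) + int (snd (g k ?q))) - int (fst (g k ?q)) = int (?q + 2 * snd (g k ?q) - fst (g k ?q))"
      using ch by (auto simp: choices_def)
    define s1 where "s1 = effect Backtrack_load s'"
    have "k \<le> n" using k(1) m_le_n by simp
    then have s1: "ints s1 = (ints s')(''k'' := (ints s' ''k'')(0 := int k), ''x'' := (ints s' ''x'')(0 := int (ch k)),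
       ''y'' := (ints s' ''y'')(0 := int (pa k)), ''rk'' := (ints s' ''rk'')(0 := idx k 0), ''q'' := (ints s' ''q'')(0 := int ?q))"
      using J t(2) k pa_less[OF k(1)] by (simp add: s1_def Backtrack_load_def D)
    define s2 where "s2 = effect Backtrack_read s1"
    have s2: "ints s2 = (ints s1)(''F'' := (ints s' ''F'')(0 := int (fst (g k ?q))), ''d'' := (ints s' ''d'')(0 := int (snd (g k ?q))))"
      using gx[OF k(1) q] by (simp add: s2_def Backtrack_read_def s1 tb)
    have e: "ints (effect Backtrack_body s') = (ints s2)(''fs'' := (ints s' ''fs'')(int k := int (fst (g k ?q))),
      ''ms'' := (ints s' ''ms'')(int k := int (snd (g k ?q))),
      ''sz'' := (ints s' ''sz'')(int (pa k) := int (?q + 2 * snd (g k ?q) - fst (g k ?q)), int (ch k) := int (h k (fst (g k ?q)))))"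
      unfolding nn[symmetric] using hx[OF k(1) FB] ch_neq_pa[OF k(1)]
      by (simp add: Backtrack_body_def s1_def[symmetric] s2_def[symmetric] Backtrack_write_def s2 s1 tb)
    have b: "?b (Suc t) = (?b t)(pa k := ?q + 2 * snd (g k ?q) - fst (g k ?q), ch k := h k (fst (g k ?q)))"
      by (simp add: Let_def k_def)
    show "tr Backtrack_body s' (200 * 1) (\<lambda>s''. (\<forall>v<n. ints (iupdate s'' ''t'' 0 (int (Suc t))) ''sz'' (int v) = int (?b (Suc t) v)) \<and>
        (\<forall>k<m. m \<le> k + Suc t \<longrightarrow> ints (iupdate s'' ''t'' 0 (int (Suc t))) ''fs'' (int k) = int (?F k) \<and>
          ints (iupdate s'' ''t'' 0 (int (Suc t))) ''ms'' (int k) = int (?i k)))"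
    proof (rule tr_effect)
      have "j = k \<or> m \<le> j + t" if "m \<le> j + Suc t" "j < m" for j using that t(1) k(3) k(1) by linarith
      then show "(\<forall>v<n. ints (iupdate (effect Backtrack_body s') ''t'' 0 (int (Suc t))) ''sz'' (int v) = int (?b (Suc t) v)) \<and>
        (\<forall>k<m. m \<le> k + Suc t \<longrightarrow> ints (iupdate (effect Backtrack_body s') ''t'' 0 (int (Suc t))) ''fs'' (int k) = int (?F k) \<and>
          ints (iupdate (effect Backtrack_body s') ''t'' 0 (int (Suc t))) ''ms'' (int k) = int (?i k))"
        using J k(3) unfolding b by (auto simp: e s2 s1)
    qed (simp_all add: Backtrack_body_def Backtrack_load_def Backtrack_read_def Backtrack_write_def)
  next
    fix s' :: state assume J: "?J m s'"
    show "\<exists>z F i. trace z F i \<and> z m root = r \<and> holds_trace F i s' \<and> (\<forall>v<n. ints s' ''sz'' (int v) = int (z 0 v))"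
      using J by (intro exI[of _ ?z] exI[of _ ?F] exI[of _ ?i] conjI tr) (simp_all add: holds_trace_def)
  next
    show "?J 0 (iupdate ?s ''t'' 0 (int 0))"
      using s0 by (auto simp del: backtrack.simps effect.simps)
  qed (use m_le_n n_pos in simp_all)
qed (use n_pos in simp_all)

lemma tr_Fill:
  assumes "ready s"
  shows "tr Fill s (200 * (n * Suc B)) (\<lambda>s'. \<forall>v<n. \<forall>r\<le>B. ints s' ''stk'' (idx v r) = int v)"
  unfolding Fill_def
proof (rule tr_For[where l = 0 and h = n and K = 70 and X = "Suc B" and Y = n
      and J = "\<lambda>j s'. \<forall>v<j. \<forall>r\<le>B. ints s' ''stk'' (idx v r) = int v"])
  let ?J = "\<lambda>j s'. \<forall>v<j. \<forall>r\<le>B. ints s' ''stk'' (idx v r) = int v"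
  let ?b = "IWrite ''stk'' (IAdd (IRead ''row'' (Var ''a'')) (Var ''r'')) (Var ''a'')"
  let ?f = "For ''r'' (Const 0) (Var ''W'') ?b"
  fix j s'
  assume fr: "framed_loop ''a'' ?f s s'"
  have R: "ready s'" by (rule ready_frame[OF assms fr]) simp_all
  then show "ival (Var ''n'') s' = int n" by (simp add: readyD)
  assume j: "j < n" "?J j s'" "ints s' ''a'' 0 = int j"
  show "tr ?f s' (70 * Suc B) (\<lambda>s''. \<forall>v<Suc j. \<forall>r\<le>B. ints (iupdate s'' ''a'' 0 (int (Suc j))) ''stk'' (idx v r) = int v)"
  proof (rule tr_For[where l = 0 and h = "Suc B" and K = 20 and X = 1 and Y = "Suc B"
      and J = "\<lambda>i s''. (?J j s'') \<and> (\<forall>r<i. ints s'' ''stk'' (idx j r) = int j)"])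
    fix i s''
    assume i: "i < Suc B" "(?J j s'') \<and> (\<forall>r<i. ints s'' ''stk'' (idx j r) = int j)"
      "ints s'' ''r'' 0 = int i" and fr2: "framed_loop ''r'' ?b s' s''"
    have R2: "ready s''" by (rule ready_frame[OF R fr2]) simp_all
    have a: "ints s'' ''a'' 0 = int j" using j(3) by (simp add: frame_ints[OF fr2])
    show "tr ?b s'' (20 * 1) (\<lambda>s'''. (?J j (iupdate s''' ''r'' 0 (int (Suc i)))) \<and>
      (\<forall>r<Suc i. ints (iupdate s''' ''r'' 0 (int (Suc i))) ''stk'' (idx j r) = int j))"
    proof (rule tr_effect)
      have "i \<le> B" "j \<le> n" using i j(1) by simp_all
      then show "(?J j (iupdate (effect ?b s'') ''r'' 0 (int (Suc i)))) \<and>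
      (\<forall>r<Suc i. ints (iupdate (effect ?b s'') ''r'' 0 (int (Suc i))) ''stk'' (idx j r) = int j)"
        using i a by (auto simp: readyD[OF R2] less_Suc_eq)
    qed simp_all
  next
    fix s'' :: state assume "(?J j s'') \<and> (\<forall>r<Suc B. ints s'' ''stk'' (idx j r) = int j)"
    then show "\<forall>v<Suc j. \<forall>r\<le>B. ints (iupdate s'' ''a'' 0 (int (Suc j))) ''stk'' (idx v r) = int v"
      by (auto simp: less_Suc_eq[of _ j])
  qed (use R j in \<open>simp_all add: readyD ready_frame\<close>)
qed (use n_pos in simp_all)

end

lemma effect_frame: "loop_free P \<Longrightarrow> framed P s (effect P s)"
  using runs_effect runs_frame by blast

section \<open>Executing the trace on stacks of open paths\<close>

definition Finish :: com where
  "Finish = Seq (If (ILess (Var ''s2'') (Var ''s1'')) (Seq (Set ''t1'' (Var ''s1'')) (Seq (Set ''s1'' (Var ''s2'')) (Set ''s2'' (Var ''t1'')))) Skip)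
     (Seq (Set ''ix'' (IAdd (IRead ''rn'' (Var ''s1'')) (Var ''s2'')))
     (Seq (IWrite ''cnt'' (Var ''ix'') (IAdd (IRead ''cnt'' (Var ''ix'')) (Const 1))) (IWrite ''top'' (Var ''ix'') (Var ''tt''))))"

definition Close_pop :: com where
  "Close_pop = Seq (Set ''p'' (ISub (IRead ''sz'' (Var ''x'')) (Const 1))) (Seq (IWrite ''sz'' (Var ''x'') (Var ''p''))
     (Seq (Set ''s1'' (Var ''x'')) (Seq (Set ''s2'' (IRead ''stk'' (IAdd (Var ''rx'') (Var ''p'')))) (Set ''tt'' (Var ''x'')))))"

text \<open>Open paths beyond the capacity \<open>F\<close> of the upward edge end at
  \<open>x\<close>. With \<open>F = 0\<close> the same loop finishes everything at the root.\<close>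

definition Close :: com where
  "Close = While (ILess (Var ''F'') (IRead ''sz'' (Var ''x''))) (Seq Close_pop Finish)"

definition Start_body :: com where
  "Start_body = Seq (IWrite ''stk'' (IAdd (Var ''rx'') (IRead ''sz'' (Var ''x''))) (Var ''x''))
     (IWrite ''sz'' (Var ''x'') (IAdd (IRead ''sz'' (Var ''x'')) (Const 1)))"

definition Start :: com where
  "Start = While (ILess (IRead ''sz'' (Var ''x'')) (Var ''F'')) Start_body"

definition Pair_pop :: com where
  "Pair_pop = Seq (Seq (Set ''p'' (ISub (IRead ''sz'' (Var ''x'')) (Const 1))) (Seq (IWrite ''sz'' (Var ''x'') (Var ''p''))
       (Set ''s2'' (IRead ''stk'' (IAdd (Var ''rx'') (Var ''p''))))))
     (Seq (Set ''p'' (ISub (IRead ''sz'' (Var ''y'')) (Const 1))) (Seq (IWrite ''sz'' (Var ''y'') (Var ''p''))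
       (Seq (Set ''s1'' (IRead ''stk'' (IAdd (Var ''ry'') (Var ''p'')))) (Set ''tt'' (Var ''y'')))))"

definition Pairs :: com where
  "Pairs = For ''z'' (Const 0) (Var ''d'') (Seq Pair_pop Finish)"

definition Move_body :: com where
  "Move_body = Seq (Seq (Set ''p'' (ISub (IRead ''sz'' (Var ''x'')) (Const 1))) (Seq (IWrite ''sz'' (Var ''x'') (Var ''p''))
       (Set ''s2'' (IRead ''stk'' (IAdd (Var ''rx'') (Var ''p''))))))
     (Seq (IWrite ''stk'' (IAdd (Var ''ry'') (IRead ''sz'' (Var ''y''))) (Var ''s2''))
       (IWrite ''sz'' (Var ''y'') (IAdd (IRead ''sz'' (Var ''y'')) (Const 1))))"

definition Move :: com where
  "Move = While (ILess (Const 0) (IRead ''sz'' (Var ''x''))) Move_body"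

definition Load_trace :: com where
  "Load_trace = Seq (Set ''x'' (IRead ''ch'' (Var ''k''))) (Seq (Set ''y'' (IRead ''pa'' (Var ''k'')))
     (Seq (Set ''rx'' (IRead ''row'' (Var ''x''))) (Seq (Set ''ry'' (IRead ''row'' (Var ''y'')))
     (Seq (Set ''F'' (IRead ''fs'' (Var ''k''))) (Set ''d'' (IRead ''ms'' (Var ''k'')))))))"

text \<open>Closing and starting leave exactly \<open>F\<close> open paths at the child. They are
  joined before the others move up, so that both partners of a join come from different edges at the
  parent.\<close>

definition Forward :: com where
  "Forward = Seq (For ''k'' (Const 0) (Var ''m'') (Seq Load_trace (Seq Close (Seq Start (Seq Pairs Move)))))
     (Seq (Seq (Set ''x'' (Var ''root'')) (Seq (Set ''F'' (Const 0)) (Set ''rx'' (IRead ''row'' (Var ''x''))))) Close)"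

lemma Forward_wr [simp]:
  "iwr Finish = {''t1'', ''s1'', ''s2'', ''ix'', ''cnt'', ''top''}" "rwr Finish = {}"
  "iwr Close_pop = {''p'', ''sz'', ''s1'', ''s2'', ''tt''}" "rwr Close_pop = {}"
  "iwr Close = {''p'', ''sz'', ''s1'', ''s2'', ''tt'', ''t1'', ''ix'', ''cnt'', ''top''}" "rwr Close = {}"
  "iwr Start_body = {''stk'', ''sz''}" "rwr Start_body = {}"
  "iwr Start = {''stk'', ''sz''}" "rwr Start = {}"
  "iwr Pair_pop = {''p'', ''sz'', ''s1'', ''s2'', ''tt''}" "rwr Pair_pop = {}"
  "iwr Pairs = {''z'', ''p'', ''sz'', ''s1'', ''s2'', ''tt'', ''t1'', ''ix'', ''cnt'', ''top''}" "rwr Pairs = {}"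
  "iwr Move_body = {''p'', ''sz'', ''s2'', ''stk''}" "rwr Move_body = {}"
  "iwr Move = {''p'', ''sz'', ''s2'', ''stk''}" "rwr Move = {}"
  "iwr Load_trace = {''x'', ''y'', ''rx'', ''ry'', ''F'', ''d''}" "rwr Load_trace = {}"
  by (auto simp: Finish_def Close_pop_def Close_def Start_body_def Start_def Pair_pop_def Pairs_def Move_body_def Move_def Load_trace_def)

lemma Forward_lf [simp]:
  "loop_free Finish" "loop_free Close_pop" "loop_free Start_body" "loop_free Pair_pop" "loop_free Move_body" "loop_free Load_trace"
  "max_time Finish \<le> 60" "max_time Close_pop \<le> 60" "max_time Start_body \<le> 60" "max_time Pair_pop \<le> 60" "max_time Move_body \<le> 60"
  "max_time Load_trace \<le> 60"
  by (simp_all add: Finish_def Close_pop_def Start_body_def Pair_pop_def Move_body_def Load_trace_def)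

lemma Forward_wr2 [simp]:
  "iwr Forward = {''k'', ''x'', ''y'', ''rx'', ''ry'', ''F'', ''d'', ''z'', ''p'', ''sz'', ''s1'', ''s2'', ''tt'', ''t1'', ''ix'', ''cnt'', ''top'', ''stk''}"
  "rwr Forward = {}"
  by (auto simp: Forward_def)

locale lp_trace = lp_run +
  fixes z :: "nat \<Rightarrow> nat \<Rightarrow> nat" and F i :: "nat \<Rightarrow> nat"
  assumes trace: "trace z F i"
begin

definition jdx :: "nat \<Rightarrow> nat \<Rightarrow> int" where "jdx a b = int (a * n + b)"

lemma jdx_0 [simp]: "jdx a 0 + int b = jdx a b"
  by (simp add: jdx_def)

lemma jdx_eq [simp]: "b < n \<Longrightarrow> b' < n \<Longrightarrow> jdx a b = jdx a' b' \<longleftrightarrow> a = a' \<and> b = b'"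
proof -
  assume b: "b < n" "b' < n"
  have "a = a' \<and> b = b'" if "a * n + b = a' * n + b'"
  proof -
    have "(a * n + b) div n = (a' * n + b') div n" "(a * n + b) mod n = (a' * n + b') mod n" using that by simp_all
    then show ?thesis using b by simp
  qed
  then show ?thesis unfolding jdx_def of_nat_eq_iff by blast
qed

definition prepared :: "state \<Rightarrow> bool" where
  "prepared s \<longleftrightarrow> ready s \<and> (\<forall>a<n. ints s ''rn'' (int a) = jdx a 0) \<and> holds_trace F i s"

lemma prepared_frame:
  assumes "prepared s" "frame X Y s s'"
    "X \<inter> {''n'', ''m'', ''u'', ''v'', ''fmin'', ''fmax'', ''ch'', ''pa'', ''ed'', ''par'', ''root'', ''B'', ''W'', ''row'',
      ''rn'', ''fs'', ''ms''} = {}"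
    "Y \<inter> {''c'', ''cfix''} = {}"
  shows "prepared s'"
  using assms(1,3,4) ready_frame[OF _ assms(2)]
  by (simp add: prepared_def holds_trace_def frame_ints[OF assms(2)])

definition finished :: "(nat \<times> nat \<times> nat) list \<Rightarrow> state \<Rightarrow> bool" where
  "finished fin s \<longleftrightarrow> (\<forall>x\<in>set fin. fst x \<le> fst (snd x)) \<and> (\<forall>a<n. \<forall>b<n.
     ints s ''cnt'' (jdx a b) = int (length (filter (\<lambda>x. fst x = a \<and> fst (snd x) = b) fin)) \<and>
     (\<forall>t. (a, b, t) \<in> set fin \<longrightarrow> ints s ''top'' (jdx a b) = int t))"

text \<open>A repeated write to \<open>top\<close> is harmless: by \<open>valid_unique\<close>, a
  valid path with the same endpoints has the same top.\<close>

lemma finished_Finish: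
  assumes "finished fin s" "prepared s" "\<forall>x\<in>set (norm3 a b t # fin). valid x"
    and "ints s ''s1'' 0 = int a" "ints s ''s2'' 0 = int b" "ints s ''tt'' 0 = int t"
  shows "finished (norm3 a b t # fin) (effect Finish s)"
proof -
  obtain a' b' where ab: "norm3 a b t = (a', b', t)" "a' \<le> b'" "(a', b') = (if b < a then (b, a) else (a, b))"
    by (rule that[of "if b < a then b else a" "if b < a then a else b"]) (auto simp: norm3_def)
  have v: "valid (a', b', t)" using assms(3) ab by simp
  then have lt: "a' < n" "b' < n" by (auto simp: valid_def)
  have rn: "ints s ''rn'' (int a') = jdx a' 0" using assms(2) lt by (simp add: prepared_def)
  have e: "ints (effect Finish s) ''cnt'' = (ints s ''cnt'')(jdx a' b' := ints s ''cnt'' (jdx a' b') + 1)"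
    "ints (effect Finish s) ''top'' = (ints s ''top'')(jdx a' b' := int t)"
    using assms(4-6) ab(3) rn by (auto simp: Finish_def split: if_splits)
  show ?thesis unfolding ab(1) finished_def
  proof (intro conjI allI impI ballI)
    fix c d assume cd: "c < n" "d < n"
    show "ints (effect Finish s) ''cnt'' (jdx c d) = int (length (filter (\<lambda>x. fst x = c \<and> fst (snd x) = d) ((a', b', t) # fin)))"
      using assms(1) cd lt by (auto simp: e finished_def)
    fix u assume u: "(c, d, u) \<in> set ((a', b', t) # fin)"
    show "ints (effect Finish s) ''top'' (jdx c d) = int u"
    proof (cases "c = a' \<and> d = b'")
      case True
      then have "valid (a', b', u)" using u assms(3) v by auto
      then have "u = t" using v valid_unique by blast
      then show ?thesis using True by (simp add: e)
    next
      case False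
      then show ?thesis using u assms(1) cd lt by (auto simp: e finished_def)
    qed
  qed (use assms(1) ab(2) in \<open>auto simp: finished_def\<close>)
qed

lemma finished_cong: "finished fin s \<Longrightarrow> ints s' ''cnt'' = ints s ''cnt'' \<Longrightarrow> ints s' ''top'' = ints s ''top'' \<Longrightarrow> finished fin s'"
  by (simp add: finished_def)

definition stacks :: "(nat \<Rightarrow> nat list) \<Rightarrow> state \<Rightarrow> bool" where
  "stacks op s \<longleftrightarrow> (\<forall>v<n. ints s ''sz'' (int v) = int (length (op v)) \<and>
     (\<forall>r<length (op v). ints s ''stk'' (idx v r) = int (op v ! r)))"

lemma stacks_cong: "stacks op s \<Longrightarrow> ints s' ''sz'' = ints s ''sz'' \<Longrightarrow> ints s' ''stk'' = ints s ''stk'' \<Longrightarrow> stacks op s'"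
  by (simp add: stacks_def)

lemma stacks_pop:
  assumes "stacks op s" "op v = xs @ [x]" "ints s' ''sz'' = (ints s ''sz'')(int v := int (length xs))" "ints s' ''stk'' = ints s ''stk''"
  shows "stacks (op(v := xs)) s'"
  using assms by (auto simp: stacks_def nth_append)

text \<open>All stacks share one array with rows of width \<open>Suc B\<close>. The length bounds
  keep a push from spilling into the row of the next vertex.\<close>

lemma stacks_push:
  assumes "stacks op s" "v < n" "ints s' ''sz'' = (ints s ''sz'')(int v := int (Suc (length (op v))))"
    "ints s' ''stk'' = (ints s ''stk'')(idx v (length (op v)) := int x)" "\<forall>u. length (op u) \<le> B" "length (op v) < B"
  shows "stacks (op(v := op v @ [x])) s'"
  unfolding stacks_def
proof (intro allI impI conjI)
  fix u assume u: "u < n"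
  show "ints s' ''sz'' (int u) = int (length ((op(v := op v @ [x])) u))"
    using assms(1,3) u by (simp add: stacks_def)
  fix r assume r: "r < length ((op(v := op v @ [x])) u)"
  have "r \<le> B" using r assms(5)[rule_format, of u] assms(6) by (auto split: if_splits)
  then show "ints s' ''stk'' (idx u r) = int ((op(v := op v @ [x])) u ! r)"
    using assms(1,4,6) u r by (auto simp: stacks_def nth_append)
qed

text \<open>The lists themselves are hidden: which loops run and how often depends only on the stack
  lengths \<open>L\<close>, and any choice of concrete paths is as good as another.\<close>

definition st :: "nat \<Rightarrow> nat \<Rightarrow> nat \<Rightarrow> int \<Rightarrow> (nat \<Rightarrow> nat) \<Rightarrow> state \<Rightarrow> bool" where
  "st k k' q N L s \<longleftrightarrow> (\<exists>fin op. config F k k' q N fin op \<and> stacks op s \<and> finished fin s \<and> (\<forall>v. length (op v) = L v))"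

lemma stE:
  assumes "st k k' q N L s"
  obtains fin op where "config F k k' q N fin op" "stacks op s" "finished fin s" "\<And>v. length (op v) = L v"
  using assms unfolding st_def by (elim exE conjE) (rule that, assumption, assumption, assumption, erule spec)

lemma st_sz: "st k k' q N L s \<Longrightarrow> v < n \<Longrightarrow> ints s ''sz'' (int v) = int (L v)"
  by (erule stE) (simp add: stacks_def)

lemma st_cong:
  assumes "st k k' q N L s" "ints s' ''cnt'' = ints s ''cnt''" "ints s' ''top'' = ints s ''top''"
    "ints s' ''sz'' = ints s ''sz''" "ints s' ''stk'' = ints s ''stk''"
  shows "st k k' q N L s'"
  using assms(1)
proof (rule stE)
  fix fin op assume "config F k k' q N fin op" "stacks op s" "finished fin s" "\<And>v. length (op v) = L v"
  then show ?thesis unfolding st_def using stacks_cong finished_cong assms(2-5) by blast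
qed

lemma length_SucE:
  assumes "length xs = Suc l"
  obtains ys y where "xs = ys @ [y]" "length ys = l"
  using assms by (cases xs rule: rev_cases) auto

lemma st_close:
  assumes "prepared s" "st k k' q N L s" "L v = Suc l" "v < n" "ints s ''x'' 0 = int v" "ints s ''rx'' 0 = idx v 0"
  shows "st k k' q N (L(v := l)) (effect (Seq Close_pop Finish) s)"
  using assms(2)
proof (rule stE)
  fix fin op assume c: "config F k k' q N fin op" "stacks op s" "finished fin s" "\<And>v. length (op v) = L v"
  obtain xs x where x: "op v = xs @ [x]" "length xs = l" by (rule length_SucE[of "op v" l]) (use c(4) assms(3) in auto)
  define t where "t = effect Close_pop s"
  have sz: "ints s ''sz'' (int v) = int (Suc l)" "ints s ''stk'' (idx v l) = int x"
    using c(2) assms(4) x by (auto simp: stacks_def)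
  have t: "ints t = (ints s)(''p'' := (ints s ''p'')(0 := int l), ''sz'' := (ints s ''sz'')(int v := int l),
      ''s1'' := (ints s ''s1'')(0 := int v), ''s2'' := (ints s ''s2'')(0 := int x), ''tt'' := (ints s ''tt'')(0 := int v))"
    using assms(5,6) sz by (simp add: t_def Close_pop_def)
  have Pt: "prepared t" unfolding t_def by (rule prepared_frame[OF assms(1) effect_frame]) simp_all
  note c' = config_close[OF c(1) x(1)]
  have "finished (norm3 v x v # fin) (effect Finish t)"
    by (rule finished_Finish[OF finished_cong[OF c(3)] Pt]) (use c' in \<open>simp_all add: t config_def\<close>)
  moreover have fr: "framed Finish t (effect Finish t)" by (rule effect_frame) simp
  have "stacks (op(v := xs)) (effect Finish t)"
    by (rule stacks_pop[OF c(2) x(1)]) (simp_all add: frame_ints[OF fr] t x(2))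
  moreover have "length ((op(v := xs)) u) = (L(v := l)) u" for u using c(4) x(2) by simp
  moreover have "effect Finish t = effect (Seq Close_pop Finish) s" by (simp add: t_def)
  ultimately show ?thesis unfolding st_def using c' by metis
qed

lemma tr_Close:
  assumes P: "prepared s" and S: "st k k' q N L s" "L v \<le> B" "v < n" "ints s ''x'' 0 = int v" "ints s ''rx'' 0 = idx v 0" "ints s ''F'' 0 = int f"
  shows "tr Close s (200 * Suc B) (st k k' q N (L(v := min (L v) f)))"
  unfolding Close_def
proof (rule tr_While'[where J = "\<lambda>s'. \<exists>l. st k k' q N (L(v := l)) s' \<and> min (L v) f \<le> l \<and> l \<le> L v"
      and \<mu> = "\<lambda>s'. nat (ints s' ''sz'' (int v))" and K = 120 and Y = "Suc B"])
  let ?J = "\<lambda>s'. \<exists>l. st k k' q N (L(v := l)) s' \<and> min (L v) f \<le> l \<and> l \<le> L v"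
  let ?b = "Seq Close_pop Finish"
  show "?J s" using S(1) by (intro exI[of _ "L v"]) simp
  show "nat (ints s ''sz'' (int v)) \<le> Suc B" using st_sz[OF S(1,3)] S(2) by simp
  fix s' assume fr: "framed ?b s s'" and J: "?J s'"
  have P': "prepared s'" by (rule prepared_frame[OF P fr]) simp_all
  have v: "ints s' ''x'' 0 = int v" "ints s' ''rx'' 0 = idx v 0" "ints s' ''F'' 0 = int f"
    using S(4-6) by (simp_all add: frame_ints[OF fr])
  from J obtain l where l: "st k k' q N (L(v := l)) s'" "min (L v) f \<le> l" "l \<le> L v" by blast
  have szl: "ints s' ''sz'' (int v) = int l" using st_sz[OF l(1) S(3)] by simp
  {
    assume "bval (ILess (Var ''F'') (IRead ''sz'' (Var ''x''))) s'"
    then have "f < l" using v szl by simp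
    then obtain l' where l': "l = Suc l'" "f \<le> l'" by (cases l) auto
    have st': "st k k' q N (L(v := l')) (effect ?b s')"
      using st_close[OF P' l(1) _ S(3) v(1,2), of l'] l'(1) by simp
    show "tr ?b s' 120 (\<lambda>s''. (?J s'') \<and>
      nat (ints s'' ''sz'' (int v)) < nat (ints s' ''sz'' (int v)))"
    proof (rule tr_effect)
      show "max_time ?b \<le> 120" unfolding max_time.simps using Forward_lf(7,8) by linarith
      show "(?J (effect ?b s')) \<and>
        nat (ints (effect ?b s') ''sz'' (int v)) < nat (ints s' ''sz'' (int v))"
        using st' l' l(3) st_sz[OF st' S(3)] szl by (auto simp del: effect.simps)
    qed simp
  next
    assume "\<not> bval (ILess (Var ''F'') (IRead ''sz'' (Var ''x''))) s'"
    then have "l \<le> f" using v szl by simp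
    then have "l = min (L v) f" using l by simp
    then show "st k k' q N (L(v := min (L v) f)) s'" using l(1) by simp
  }
qed simp_all

lemma tr_Start:
  assumes P: "prepared s" and S: "st k k' q N L s" "\<forall>u. L u \<le> B" "v < n" "ints s ''x'' 0 = int v" "ints s ''rx'' 0 = idx v 0" "ints s ''F'' 0 = int f"
    and f: "L v \<le> f" "f \<le> B"
  shows "tr Start s (200 * Suc B) (st k k' q (N + int (f - L v)) (L(v := f)))"
  unfolding Start_def
proof (rule tr_While'[where J = "\<lambda>s'. \<exists>l. st k k' q (N + int (l - L v)) (L(v := l)) s' \<and> L v \<le> l \<and> l \<le> f"
      and \<mu> = "\<lambda>s'. f - nat (ints s' ''sz'' (int v))" and K = 60 and Y = "Suc B"])
  let ?J = "\<lambda>s'. \<exists>l. st k k' q (N + int (l - L v)) (L(v := l)) s' \<and> L v \<le> l \<and> l \<le> f"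
  show "?J s" using S(1) f by (intro exI[of _ "L v"]) simp
  fix s' assume fr: "framed Start_body s s'" and J: "?J s'"
  have v: "ints s' ''x'' 0 = int v" "ints s' ''rx'' 0 = idx v 0" "ints s' ''F'' 0 = int f"
    using S(4-6) by (simp_all add: frame_ints[OF fr])
  from J obtain l where l: "st k k' q (N + int (l - L v)) (L(v := l)) s'" "L v \<le> l" "l \<le> f" by blast
  have szl: "ints s' ''sz'' (int v) = int l" using st_sz[OF l(1) S(3)] by simp
  {
    assume "bval (ILess (IRead ''sz'' (Var ''x'')) (Var ''F'')) s'"
    then have lf: "l < f" using v szl by simp
    have st': "st k k' q (N + int (Suc l - L v)) (L(v := Suc l)) (effect Start_body s')"
      using l(1)
    proof (rule stE)
      fix fin op assume c: "config F k k' q (N + int (l - L v)) fin op" "stacks op s'" "finished fin s'" "\<And>u. length (op u) = (L(v := l)) u"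
      have "config F k k' q (N + int (l - L v) + 1) fin (op(v := op v @ [v]))" by (rule config_start[OF c(1) S(3)])
      moreover have "N + int (l - L v) + 1 = N + int (Suc l - L v)" using l(2) by simp
      moreover have "stacks (op(v := op v @ [v])) (effect Start_body s')"
        by (rule stacks_push[OF c(2) S(3)]) (use v szl c(4) S(2) lf f in \<open>auto simp: Start_body_def\<close>)
      moreover have "finished fin (effect Start_body s')" by (rule finished_cong[OF c(3)]) (simp_all add: Start_body_def)
      moreover have "length ((op(v := op v @ [v])) u) = (L(v := Suc l)) u" for u using c(4) by simp
      ultimately show ?thesis unfolding st_def by (metis (no_types))
    qed
    show "tr Start_body s' 60 (\<lambda>s''. (?J s'') \<and>
      f - nat (ints s'' ''sz'' (int v)) < f - nat (ints s' ''sz'' (int v)))"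
    proof (rule tr_effect)
      have "f - nat (ints (effect Start_body s') ''sz'' (int v)) < f - nat (ints s' ''sz'' (int v))"
        using st_sz[OF st' S(3)] szl lf by simp
      then show "(?J (effect Start_body s')) \<and>
        f - nat (ints (effect Start_body s') ''sz'' (int v)) < f - nat (ints s' ''sz'' (int v))"
        using st' l(2) lf by (intro conjI exI[of _ "Suc l"]) auto
    qed simp_all
  next
    assume "\<not> bval (ILess (IRead ''sz'' (Var ''x'')) (Var ''F'')) s'"
    then have "l = f" using v szl l(3) by simp
    then show "st k k' q (N + int (f - L v)) (L(v := f)) s'" using l(1) by simp
  }
qed (use f in simp_all)

lemma tr_Pairs:
  assumes P: "prepared s" and S: "st k k 0 N L s" and k: "k < m"
    and v: "ints s ''x'' 0 = int (ch k)" "ints s ''y'' 0 = int (pa k)" "ints s ''rx'' 0 = idx (ch k) 0" "ints s ''ry'' 0 = idx (pa k) 0" "ints s ''d'' 0 = int e"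
    and e: "e \<le> L (ch k)" "e \<le> L (pa k)" "e \<le> B"
  shows "tr Pairs s (200 * Suc B) (st k k e (N - int e) (L(ch k := L (ch k) - e, pa k := L (pa k) - e)))"
  unfolding Pairs_def
proof (rule tr_For[where l = 0 and h = e and K = 120 and X = 1 and Y = "Suc B"
      and J = "\<lambda>j. st k k j (N - int j) (L(ch k := L (ch k) - j, pa k := L (pa k) - j))"])
  let ?b = "Seq Pair_pop Finish"
  show "st k k 0 (N - int 0) (L(ch k := L (ch k) - 0, pa k := L (pa k) - 0)) (iupdate s ''z'' 0 (int 0))"
    using st_cong[OF S, of "iupdate s ''z'' 0 (int 0)"] by simp
  fix j s' assume fr: "framed_loop ''z'' ?b s s'"
  show "ival (Var ''d'') s' = int e" using v(5) by (simp add: frame_ints[OF fr])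
  assume j: "j < e" "st k k j (N - int j) (L(ch k := L (ch k) - j, pa k := L (pa k) - j)) s'"
  have P': "prepared s'" by (rule prepared_frame[OF P fr]) simp_all
  have v': "ints s' ''x'' 0 = int (ch k)" "ints s' ''y'' 0 = int (pa k)" "ints s' ''rx'' 0 = idx (ch k) 0" "ints s' ''ry'' 0 = idx (pa k) 0"
    using v by (simp_all add: frame_ints[OF fr])
  note cn = ch_less[OF k] and pn = pa_less[OF k] and cp = ch_neq_pa[OF k]
  have st': "st k k (Suc j) (N - int (Suc j)) (L(ch k := L (ch k) - Suc j, pa k := L (pa k) - Suc j)) (effect ?b s')"
    using j(2)
  proof (rule stE)
    fix fin op assume c: "config F k k j (N - int j) fin op" "stacks op s'" "finished fin s'"
      "\<And>u. length (op u) = (L(ch k := L (ch k) - j, pa k := L (pa k) - j)) u"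
    have "length (op (ch k)) = Suc (L (ch k) - Suc j)" "length (op (pa k)) = Suc (L (pa k) - Suc j)"
      using c(4) cp j(1) e by simp_all
    then obtain xs x ys y where x: "op (ch k) = xs @ [x]" "length xs = L (ch k) - Suc j"
      and y: "op (pa k) = ys @ [y]" "length ys = L (pa k) - Suc j" by (metis length_SucE)
    define t where "t = effect Pair_pop s'"
    have sz: "ints s' ''sz'' (int (ch k)) = int (Suc (length xs))" "ints s' ''stk'' (idx (ch k) (length xs)) = int x"
      "ints s' ''sz'' (int (pa k)) = int (Suc (length ys))" "ints s' ''stk'' (idx (pa k) (length ys)) = int y"
      using c(2) cn pn x(1) y(1) by (auto simp: stacks_def)
    have t: "ints t = (ints s')(''p'' := (ints s' ''p'')(0 := int (length ys)), ''s2'' := (ints s' ''s2'')(0 := int x),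
        ''sz'' := (ints s' ''sz'')(int (ch k) := int (length xs), int (pa k) := int (length ys)),
        ''s1'' := (ints s' ''s1'')(0 := int y), ''tt'' := (ints s' ''tt'')(0 := int (pa k)))"
      using v' sz cp by (simp add: t_def Pair_pop_def fun_eq_iff)
    have Pt: "prepared t" unfolding t_def by (rule prepared_frame[OF P' effect_frame]) simp_all
    note c' = config_join[OF c(1) k y(1) x(1)]
    have "finished (norm3 y x (pa k) # fin) (effect Finish t)"
      by (rule finished_Finish[OF finished_cong[OF c(3)] Pt]) (use c' in \<open>simp_all add: t config_def\<close>)
    moreover have fr: "framed Finish t (effect Finish t)" by (rule effect_frame) simp
    \<comment> \<open>This auxiliary state splits the two pops, so that \<open>stacks_pop\<close>
      applies twice. It pops the parent first, as in \<open>config_join\<close>, whereas the program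
      pops the child first; the resulting stacks agree.\<close>
    define u where "u = iupdate s' ''sz'' (int (pa k)) (int (length ys))"
    have "stacks (op(pa k := ys)) u" by (rule stacks_pop[OF c(2) y(1)]) (simp_all add: u_def)
    then have "stacks (op(pa k := ys, ch k := xs)) (effect Finish t)"
      by (rule stacks_pop[where x = x]) (use x(1) cp in \<open>auto simp: frame_ints[OF fr] t u_def fun_eq_iff\<close>)
    moreover have "length ((op(pa k := ys, ch k := xs)) u) = (L(ch k := L (ch k) - Suc j, pa k := L (pa k) - Suc j)) u" for u
      using c(4) x(2) y(2) cp by simp
    moreover have "N - int j - 1 = N - int (Suc j)" by simp
    moreover have "effect Finish t = effect ?b s'" by (simp add: t_def)
    ultimately show ?thesis unfolding st_def using c' by metis
  qed
  show "tr ?b s' (120 * 1) (\<lambda>s''. st k k (Suc j) (N - int (Suc j)) (L(ch k := L (ch k) - Suc j, pa k := L (pa k) - Suc j)) (iupdate s'' ''z'' 0 (int (Suc j))))"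
  proof (rule tr_effect)
    show "max_time ?b \<le> 120 * 1" unfolding max_time.simps using Forward_lf(7,10) by linarith
    show "st k k (Suc j) (N - int (Suc j)) (L(ch k := L (ch k) - Suc j, pa k := L (pa k) - Suc j)) (iupdate (effect ?b s') ''z'' 0 (int (Suc j)))"
      by (rule st_cong[OF st']) simp_all
  qed simp
qed (use e in simp_all)

lemma tr_Move:
  assumes P: "prepared s" and S: "st k (Suc k) q N L s" and k: "k < m"
    and v: "ints s ''x'' 0 = int (ch k)" "ints s ''y'' 0 = int (pa k)" "ints s ''rx'' 0 = idx (ch k) 0" "ints s ''ry'' 0 = idx (pa k) 0"
    and L: "\<forall>u. L u \<le> B" "L (pa k) + L (ch k) \<le> B"
  shows "tr Move s (200 * Suc B) (st k (Suc k) (q + L (ch k)) N (L(ch k := 0, pa k := L (pa k) + L (ch k))))"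
  unfolding Move_def
proof (rule tr_While'[where J = "\<lambda>s'. \<exists>l\<le>L (ch k). st k (Suc k) (q + (L (ch k) - l)) N (L(ch k := l, pa k := L (pa k) + (L (ch k) - l))) s'"
      and \<mu> = "\<lambda>s'. nat (ints s' ''sz'' (int (ch k)))" and K = 60 and Y = "Suc B"])
  let ?J = "\<lambda>s'. \<exists>l\<le>L (ch k). st k (Suc k) (q + (L (ch k) - l)) N (L(ch k := l, pa k := L (pa k) + (L (ch k) - l))) s'"
  note cn = ch_less[OF k] and pn = pa_less[OF k] and cp = ch_neq_pa[OF k]
  show "?J s"
    using S by (intro exI[of _ "L (ch k)"]) simp
  show "nat (ints s ''sz'' (int (ch k))) \<le> Suc B" using st_sz[OF S cn] L(1)[rule_format, of "ch k"] by simp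
  fix s' assume fr: "framed Move_body s s'"
    and J: "?J s'"
  have v': "ints s' ''x'' 0 = int (ch k)" "ints s' ''y'' 0 = int (pa k)" "ints s' ''rx'' 0 = idx (ch k) 0" "ints s' ''ry'' 0 = idx (pa k) 0"
    using v by (simp_all add: frame_ints[OF fr])
  from J obtain l where l: "l \<le> L (ch k)" "st k (Suc k) (q + (L (ch k) - l)) N (L(ch k := l, pa k := L (pa k) + (L (ch k) - l))) s'" by blast
  have szl: "ints s' ''sz'' (int (ch k)) = int l" using st_sz[OF l(2) cn] cp by simp
  {
    assume "bval (ILess (Const 0) (IRead ''sz'' (Var ''x''))) s'"
    then obtain l' where l': "l = Suc l'" using v' szl by (cases l) auto
    have st': "st k (Suc k) (q + (L (ch k) - l')) N (L(ch k := l', pa k := L (pa k) + (L (ch k) - l'))) (effect Move_body s')"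
      using l(2)
    proof (rule stE)
      fix fin op assume c: "config F k (Suc k) (q + (L (ch k) - l)) N fin op" "stacks op s'" "finished fin s'"
        "\<And>u. length (op u) = (L(ch k := l, pa k := L (pa k) + (L (ch k) - l))) u"
      have "length (op (ch k)) = Suc l'" using c(4) cp l' by simp
      then obtain xs x where x: "op (ch k) = xs @ [x]" "length xs = l'" by (rule length_SucE)
      have lp: "length (op (pa k)) = L (pa k) + (L (ch k) - l)" using c(4) by simp
      have sz: "ints s' ''sz'' (int (ch k)) = int (Suc l')" "ints s' ''stk'' (idx (ch k) l') = int x"
        "ints s' ''sz'' (int (pa k)) = int (length (op (pa k)))"
        using c(2) cn pn x by (auto simp: stacks_def)
      have t: "ints (effect Move_body s') = (ints s')(''p'' := (ints s' ''p'')(0 := int l'), ''s2'' := (ints s' ''s2'')(0 := int x),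
          ''sz'' := (ints s' ''sz'')(int (ch k) := int l', int (pa k) := int (Suc (length (op (pa k))))),
          ''stk'' := (ints s' ''stk'')(idx (pa k) (length (op (pa k))) := int x))"
        using v' sz cp by (simp add: Move_body_def fun_eq_iff)
      note c' = config_move[OF c(1) k x(1)]
      define u where "u = iupdate s' ''sz'' (int (ch k)) (int l')"
      have "stacks (op(ch k := xs)) u" by (rule stacks_pop[OF c(2) x(1)]) (simp_all add: u_def x(2))
      then have "stacks ((op(ch k := xs))(pa k := (op(ch k := xs)) (pa k) @ [x])) (effect Move_body s')"
        by (rule stacks_push[OF _ pn]) (use cp l l' lp c(4) L x(2) in \<open>auto simp: t u_def\<close>)
      moreover have "(op(ch k := xs))(pa k := (op(ch k := xs)) (pa k) @ [x]) = op(pa k := op (pa k) @ [x], ch k := xs)"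
        using cp by (auto simp: fun_eq_iff)
      moreover have "finished fin (effect Move_body s')" by (rule finished_cong[OF c(3)]) (simp_all add: t)
      moreover have "length ((op(pa k := op (pa k) @ [x], ch k := xs)) u) = (L(ch k := l', pa k := L (pa k) + (L (ch k) - l'))) u" for u
        using c(4) x(2) cp l l' by auto
      moreover have "Suc (q + (L (ch k) - l)) = q + (L (ch k) - l')" using l(1) l' by simp
      ultimately show ?thesis unfolding st_def using c' by metis
    qed
    show "tr Move_body s' 60 (\<lambda>s''. (?J s'') \<and>
      nat (ints s'' ''sz'' (int (ch k))) < nat (ints s' ''sz'' (int (ch k))))"
    proof (rule tr_effect)
      have "nat (ints (effect Move_body s') ''sz'' (int (ch k))) < nat (ints s' ''sz'' (int (ch k)))"
        using st_sz[OF st' cn] szl cp l' by simp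
      then show "(?J (effect Move_body s')) \<and>
        nat (ints (effect Move_body s') ''sz'' (int (ch k))) < nat (ints s' ''sz'' (int (ch k)))"
        using st' l(1) l' by (intro conjI exI[of _ l']) auto
    qed simp_all
  next
    assume "\<not> bval (ILess (Const 0) (IRead ''sz'' (Var ''x''))) s'"
    then have "l = 0" using v' szl by simp
    then show "st k (Suc k) (q + L (ch k)) N (L(ch k := 0, pa k := L (pa k) + L (ch k))) s'" using l(2) by simp
  }
qed simp_all

text \<open>The stack of a removed vertex is empty, whereas \<open>trace\<close> does not set the
  count there to 0.\<close>

definition lengths :: "nat \<Rightarrow> nat \<Rightarrow> nat" where
  "lengths k v = (if v \<in> rest k then z k v else 0)"

definition paths :: "nat \<Rightarrow> int" where
  "paths k = int (\<Sum>v<n. z 0 v) + (\<Sum>j<k. int (F j - z j (ch j)) - int (i j))"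

lemma tr_Forward:
  assumes P: "prepared s" and S: "st 0 0 0 (paths 0) (lengths 0) s"
  shows "tr Forward s (3000 * (n * Suc B)) (st m m 0 (paths m) (\<lambda>_. 0))"
  unfolding Forward_def
proof (rule tr_SeqI[where R = "st m m 0 (paths m) (lengths m)" and T' = "300 * (n * Suc B)"])
  have zB: "z k v \<le> B" for k v using trace by (simp add: trace_def)
  let ?b = "Seq Load_trace (Seq Close (Seq Start (Seq Pairs Move)))"
  show "tr (For ''k'' (Const 0) (Var ''m'') ?b) s (2000 * (n * Suc B)) (st m m 0 (paths m) (lengths m))"
  proof (rule tr_For[where l = 0 and h = m and K = 1900 and X = "Suc B" and Y = n
      and J = "\<lambda>k. st k k 0 (paths k) (lengths k)"])
    show "st 0 0 0 (paths 0) (lengths 0) (iupdate s ''k'' 0 (int 0))" by (rule st_cong[OF S]) simp_all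
    fix k s' assume fr: "framed_loop ''k'' ?b s s'"
    have P': "prepared s'" by (rule prepared_frame[OF P fr]) simp_all
    then have R': "ready s'" "holds_trace F i s'" by (simp_all add: prepared_def)
    show "ival (Var ''m'') s' = int m" by (simp add: readyD[OF R'(1)])
    assume k: "k < m" "ints s' ''k'' 0 = int k" and S': "st k k 0 (paths k) (lengths k) s'"
    note cn = ch_less[OF k(1)] and pn = pa_less[OF k(1)] and cp = ch_neq_pa[OF k(1)]
    have tk: "F k \<le> hi k" "i k \<le> F k" "i k \<le> z k (pa k)" "z (Suc k) (pa k) + 2 * i k = z k (pa k) + F k"
      "\<And>v. v \<noteq> ch k \<Longrightarrow> v \<noteq> pa k \<Longrightarrow> z (Suc k) v = z k v" using trace k(1) by (auto simp: trace_def)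
    have FB: "F k \<le> B" using tk(1) hi_B[OF k(1)] by simp
    have Lc: "lengths k (ch k) = z k (ch k)" "lengths k (pa k) = z k (pa k)"
      using ch_in_rest[OF k(1)] pa_in_rest[OF k(1)] by (simp_all add: lengths_def)
    have LB: "lengths k u \<le> B" for u using zB by (simp add: lengths_def)
    let ?Q = "st (Suc k) (Suc k) 0 (paths (Suc k)) (lengths (Suc k))"
    show "tr ?b s' (1900 * Suc B) (\<lambda>s''. ?Q (iupdate s'' ''k'' 0 (int (Suc k))))"
    proof (rule tr_SeqI[where R = "(=) (effect Load_trace s')" and T = 60 and T' = "1000 * Suc B"])
      show "tr Load_trace s' 60 ((=) (effect Load_trace s'))" by (rule tr_effect) simp_all
      fix s1 assume s1: "effect Load_trace s' = s1" and f1: "framed Load_trace s' s1"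
      have P1: "prepared s1" by (rule prepared_frame[OF P' f1]) simp_all
      have v1: "ints s1 ''x'' 0 = int (ch k)" "ints s1 ''y'' 0 = int (pa k)" "ints s1 ''rx'' 0 = idx (ch k) 0" "ints s1 ''ry'' 0 = idx (pa k) 0"
        "ints s1 ''F'' 0 = int (F k)" "ints s1 ''d'' 0 = int (i k)"
        using k(2) R'(2) cn pn unfolding s1[symmetric]
        by (simp_all add: Load_trace_def readyD[OF R'(1)] k(1) holds_trace_def)
      have S1: "st k k 0 (paths k) (lengths k) s1" by (rule st_cong[OF S']) (simp_all add: frame_ints[OF f1])
      have L1: "lengths k (ch k) \<le> B" using LB .
      show "tr (Seq Close (Seq Start (Seq Pairs Move))) s1 (1000 * Suc B) (\<lambda>s''. ?Q (iupdate s'' ''k'' 0 (int (Suc k))))"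
      proof (rule tr_SeqI[OF tr_Close[OF P1 S1 L1 cn v1(1,3,5)], where T' = "800 * Suc B"])
        let ?L2 = "(lengths k)(ch k := min (lengths k (ch k)) (F k))"
        fix s2 assume S2: "st k k 0 (paths k) ?L2 s2" and f2: "framed Close s1 s2"
        have P2: "prepared s2" by (rule prepared_frame[OF P1 f2]) simp_all
        have v2: "ints s2 ''x'' 0 = int (ch k)" "ints s2 ''y'' 0 = int (pa k)" "ints s2 ''rx'' 0 = idx (ch k) 0" "ints s2 ''ry'' 0 = idx (pa k) 0"
          "ints s2 ''F'' 0 = int (F k)" "ints s2 ''d'' 0 = int (i k)" using v1 by (simp_all add: frame_ints[OF f2])
        have L2: "\<forall>u. ?L2 u \<le> B" "?L2 (ch k) \<le> F k" using LB FB by auto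
        show "tr (Seq Start (Seq Pairs Move)) s2 (800 * Suc B) (\<lambda>s''. ?Q (iupdate s'' ''k'' 0 (int (Suc k))))"
        proof (rule tr_SeqI[OF tr_Start[OF P2 S2 L2(1) cn v2(1,3,5) L2(2) FB], where T' = "600 * Suc B"])
          let ?N = "paths k + int (F k - ?L2 (ch k))" and ?L3 = "?L2(ch k := F k)"
          fix s3 assume S3: "st k k 0 ?N ?L3 s3" and f3: "framed Start s2 s3"
          have P3: "prepared s3" by (rule prepared_frame[OF P2 f3]) simp_all
          have v3: "ints s3 ''x'' 0 = int (ch k)" "ints s3 ''y'' 0 = int (pa k)" "ints s3 ''rx'' 0 = idx (ch k) 0" "ints s3 ''ry'' 0 = idx (pa k) 0"
            "ints s3 ''d'' 0 = int (i k)" using v2 by (simp_all add: frame_ints[OF f3])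
          have L3: "i k \<le> ?L3 (ch k)" "i k \<le> ?L3 (pa k)" "i k \<le> B" using tk Lc cp FB by auto
          show "tr (Seq Pairs Move) s3 (600 * Suc B) (\<lambda>s''. ?Q (iupdate s'' ''k'' 0 (int (Suc k))))"
          proof (rule tr_SeqI[OF tr_Pairs[OF P3 S3 k(1) v3 L3], where T' = "200 * Suc B"])
            let ?L4 = "?L3(ch k := ?L3 (ch k) - i k, pa k := ?L3 (pa k) - i k)"
            fix s4 assume S4: "st k k (i k) (?N - int (i k)) ?L4 s4" and f4: "framed Pairs s3 s4"
            have P4: "prepared s4" by (rule prepared_frame[OF P3 f4]) simp_all
            have v4: "ints s4 ''x'' 0 = int (ch k)" "ints s4 ''y'' 0 = int (pa k)" "ints s4 ''rx'' 0 = idx (ch k) 0" "ints s4 ''ry'' 0 = idx (pa k) 0"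
              using v3 by (simp_all add: frame_ints[OF f4])
            \<comment> \<open>From here on the open paths at \<open>pa k\<close> may contain edge
              \<open>k\<close>, which the weaker bound \<open>Suc k\<close> permits.\<close>
            have S4': "st k (Suc k) (i k) (?N - int (i k)) ?L4 s4"
              using S4 config_mono[of F k k _ _ _ _ "Suc k"] unfolding st_def by (meson le_SucI order_refl)
            \<comment> \<open>What both stacks hold after the joins is exactly the next count at the
              parent. As a value of the trace it is at most \<open>B\<close>, so no move overflows a
              row.\<close>
            have zs: "z k (pa k) - i k + (F k - i k) = z (Suc k) (pa k)" using tk by linarith
            have L4: "\<forall>u. ?L4 u \<le> B" "?L4 (pa k) + ?L4 (ch k) \<le> B"
              using LB FB Lc cp zs zB[of "Suc k" "pa k"] by (auto intro: le_trans[OF diff_le_self])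
            show "tr Move s4 (200 * Suc B) (\<lambda>s''. ?Q (iupdate s'' ''k'' 0 (int (Suc k))))"
            proof (rule tr_mono[OF tr_Move[OF P4 S4' k(1) v4 L4] order_refl])
              fix s5 assume S5: "st k (Suc k) (i k + ?L4 (ch k)) (?N - int (i k)) (?L4(ch k := 0, pa k := ?L4 (pa k) + ?L4 (ch k))) s5"
              have "i k + ?L4 (ch k) = F k" using tk cp by simp
              moreover have "?L4(ch k := 0, pa k := ?L4 (pa k) + ?L4 (ch k)) = lengths (Suc k)"
              proof
                fix v
                show "(?L4(ch k := 0, pa k := ?L4 (pa k) + ?L4 (ch k))) v = lengths (Suc k) v"
                proof (cases "v = pa k")
                  case True
                  then show ?thesis using zs cp Lc pa_in_rest_Suc[OF k(1)] by (simp add: lengths_def)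
                next
                  case False
                  then show ?thesis using tk(5) rest_Suc[OF k(1)] by (simp add: lengths_def)
                qed
              qed
              moreover have "?N - int (i k) = paths (Suc k)" using Lc by (simp add: paths_def min_def)
              ultimately have "st k (Suc k) (F k) (paths (Suc k)) (lengths (Suc k)) s5" using S5 by simp
              then have "?Q s5" unfolding st_def using config_next by blast
              then show "?Q (iupdate s5 ''k'' 0 (int (Suc k)))" by (rule st_cong) simp_all
            qed
          qed simp
        qed simp
      qed simp
    qed simp
  qed (use m_le_n n_pos in simp_all)
  fix s' assume S': "st m m 0 (paths m) (lengths m) s'" and fr: "framed (For ''k'' (Const 0) (Var ''m'') ?b) s s'"
  have P': "prepared s'" by (rule prepared_frame[OF P fr]) simp_all
  then have R': "ready s'" by (simp add: prepared_def)
  let ?l = "Seq (Set ''x'' (Var ''root'')) (Seq (Set ''F'' (Const 0)) (Set ''rx'' (IRead ''row'' (Var ''x''))))"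
  have fr2: "frame {''x'', ''F'', ''rx''} {} s' (effect ?l s')" by (simp add: frame_def)
  show "tr (Seq ?l Close) s' (300 * (n * Suc B)) (st m m 0 (paths m) (\<lambda>_. 0))"
  proof (rule tr_step)
    have P2: "prepared (effect ?l s')" by (rule prepared_frame[OF P' fr2]) simp_all
    have S2: "st m m 0 (paths m) (lengths m) (effect ?l s')" by (rule st_cong[OF S']) simp_all
    have "(lengths m)(root := min (lengths m root) 0) = (\<lambda>_. 0)" by (auto simp: lengths_def rest_m fun_eq_iff)
    with tr_Close[OF P2 S2, of root 0] show "tr Close (effect ?l s') (200 * Suc B) (st m m 0 (paths m) (\<lambda>_. 0))"
      using zB root_less by (simp add: lengths_def readyD[OF R'])
    have "1 * Suc B \<le> n * Suc B" using n_pos by (intro mult_le_mono) simp_all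
    then have "200 * Suc B \<le> 200 * (n * Suc B)" "100 * 1 \<le> 100 * (n * Suc B)" using n_pos by (intro mult_le_mono2; simp)+
    moreover have "max_time ?l \<le> 100 * 1" by simp
    ultimately show "max_time ?l + 200 * Suc B \<le> 300 * (n * Suc B)" by linarith
  qed simp
qed simp

end

section \<open>Writing out the merged lines\<close>

definition Walk_body :: "string \<Rightarrow> string \<Rightarrow> com" where
  "Walk_body arr c = Seq (IWrite arr (Var c) (Var ''x'')) (Seq (Inc c) (Set ''x'' (IRead ''par'' (Var ''x''))))"

definition Walk :: "string \<Rightarrow> string \<Rightarrow> com" where
  "Walk arr c = While (Not (And (Not (ILess (Var ''x'') (Var ''tt''))) (Not (ILess (Var ''tt'') (Var ''x''))))) (Walk_body arr c)"

text \<open>Parent pointers lead only upwards, so the second arm is found from its endpoint to the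
  top, opposite to the order in which the path continues. It is buffered in \<open>tmp\<close> and
  emptied from the back.\<close>

definition Unstack_body :: com where
  "Unstack_body = Seq (Set ''L'' (ISub (Var ''L'') (Const 1))) (Seq (IWrite ''path'' (Var ''pl'') (IRead ''tmp'' (Var ''L''))) (Inc ''pl''))"

definition Unstack :: com where
  "Unstack = While (ILess (Const 0) (Var ''L'')) Unstack_body"

definition Emit_begin :: com where
  "Emit_begin = Seq (IWrite ''freq'' (Var ''nl'') (IRead ''cnt'' (Var ''ix''))) (Seq (Set ''tt'' (IRead ''top'' (Var ''ix'')))
     (Seq (Set ''x'' (Var ''a'')) (Set ''l0'' (Var ''pl''))))"

definition Emit_mid :: com where
  "Emit_mid = Seq (IWrite ''path'' (Var ''pl'') (Var ''tt'')) (Seq (Inc ''pl'') (Seq (Set ''x'' (Var ''b'')) (Set ''L'' (Const 0))))"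

definition Emit_end :: com where
  "Emit_end = Seq (IWrite ''len'' (Var ''nl'') (ISub (Var ''pl'') (Var ''l0''))) (Inc ''nl'')"

definition Emit_path :: com where
  "Emit_path = Seq Emit_begin (Seq (Walk ''path'' ''pl'') (Seq Emit_mid (Seq (Walk ''tmp'' ''L'') (Seq Unstack Emit_end))))"

definition Emit_cell :: com where
  "Emit_cell = Seq (Set ''ix'' (IAdd (IRead ''rn'' (Var ''a'')) (Var ''b''))) (If (ILess (Const 0) (IRead ''cnt'' (Var ''ix''))) Emit_path Skip)"

definition Emit :: com where
  "Emit = Seq (Seq (Set ''nl'' (Const 0)) (Set ''pl'' (Const 0)))
     (Seq (For ''a'' (Const 0) (Var ''n'') (For ''b'' (Const 0) (Var ''n'') Emit_cell)) (Set ''lines'' (Var ''nl'')))"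

lemma Emit_wr [simp]:
  "iwr (Walk_body arr c) = {arr, c, ''x''}" "rwr (Walk_body arr c) = {}"
  "iwr (Walk arr c) = {arr, c, ''x''}" "rwr (Walk arr c) = {}"
  "iwr Unstack_body = {''L'', ''path'', ''pl''}" "rwr Unstack_body = {}"
  "iwr Unstack = {''L'', ''path'', ''pl''}" "rwr Unstack = {}"
  "iwr Emit_begin = {''freq'', ''tt'', ''x'', ''l0''}" "rwr Emit_begin = {}"
  "iwr Emit_mid = {''path'', ''pl'', ''x'', ''L''}" "rwr Emit_mid = {}"
  "iwr Emit_end = {''len'', ''nl''}" "rwr Emit_end = {}"
  by (auto simp: Walk_def Walk_body_def Unstack_body_def Unstack_def Emit_begin_def Emit_mid_def Emit_end_def)

lemma Emit_wr2 [simp]: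
  "iwr Emit_path = {''freq'', ''tt'', ''x'', ''l0'', ''path'', ''pl'', ''L'', ''tmp'', ''len'', ''nl''}" "rwr Emit_path = {}"
  "iwr Emit_cell = {''ix'', ''freq'', ''tt'', ''x'', ''l0'', ''path'', ''pl'', ''L'', ''tmp'', ''len'', ''nl''}" "rwr Emit_cell = {}"
  "iwr Emit = {''a'', ''b'', ''lines'', ''ix'', ''freq'', ''tt'', ''x'', ''l0'', ''path'', ''pl'', ''L'', ''tmp'', ''len'', ''nl''}" "rwr Emit = {}"
  by (auto simp: Emit_path_def Emit_cell_def Emit_def)

lemma stores_cong: "stores s a xs \<Longrightarrow> ints s' a = ints s a \<Longrightarrow> stores s' a xs"
  by (simp add: stores_def)

lemma stores_snoc: "stores s a xs \<Longrightarrow> ints s' a = (ints s a)(int (length xs) := int x) \<Longrightarrow> stores s' a (xs @ [x])"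
  by (auto simp: stores_def nth_append less_Suc_eq)

context lp_trace
begin

lemma length_arm_list: "(a, t) \<in> R\<^sup>* \<Longrightarrow> a < n \<Longrightarrow> length (arm_list a t) \<le> n"
proof -
  assume a: "(a, t) \<in> R\<^sup>*" "a < n"
  note am = is_arm_arm_list[OF a(1)]
  have "set (arm_list a t) \<subseteq> {..<n}" using is_arm_set[OF am] arm_less[OF a(2)] by auto
  then show ?thesis using distinct_card[OF is_arm_distinct[OF am]] card_mono[of "{..<n}" "set (arm_list a t)"] by simp
qed

lemma tr_Walk:
  assumes P: "prepared s" and a: "(a, t) \<in> R\<^sup>*" "a < n" "ints s ''x'' 0 = int a" "ints s ''tt'' 0 = int t"
    and xs: "stores s arr xs" "ints s c 0 = int (length xs)"
    and names: "arr \<noteq> c" "{arr, c} \<inter> {''x'', ''tt'', ''n'', ''m'', ''u'', ''v'', ''fmin'', ''fmax'', ''ch'', ''pa'', ''ed'', ''par'',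
      ''root'', ''B'', ''W'', ''row'', ''rn'', ''fs'', ''ms''} = {}"
  shows "tr (Walk arr c) s (100 * n) (\<lambda>s'. stores s' arr (xs @ arm_list a t) \<and> ints s' c 0 = int (length (xs @ arm_list a t)))"
  unfolding Walk_def
\<comment> \<open>The arm is split into the part \<open>ys\<close> already written and the part
  \<open>zs\<close> still to be climbed from the current vertex \<open>y\<close>.\<close>
proof (rule tr_While'[where J = "\<lambda>s'. \<exists>ys zs y. arm_list a t = ys @ zs \<and> is_arm zs y t \<and> ints s' ''x'' 0 = int y \<and>
      stores s' arr (xs @ ys) \<and> ints s' c 0 = int (length (xs @ ys))"
      and \<mu> = "\<lambda>s'. length xs + length (arm_list a t) - nat (ints s' c 0)" and K = 50 and Y = n])
  let ?J = "\<lambda>s'. \<exists>ys zs y. arm_list a t = ys @ zs \<and> is_arm zs y t \<and> ints s' ''x'' 0 = int y \<and>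
      stores s' arr (xs @ ys) \<and> ints s' c 0 = int (length (xs @ ys))"
  have nm: "arr \<noteq> ''x''" "c \<noteq> ''x''" "arr \<noteq> ''par''" "c \<noteq> ''par''" "c \<noteq> arr" using names by auto
  let ?b = "Walk_body arr c"
  let ?g = "Not (And (Not (ILess (Var ''x'') (Var ''tt''))) (Not (ILess (Var ''tt'') (Var ''x''))))"
  show "?J s"
    using is_arm_arm_list[OF a(1)] a(3) xs by (intro exI[of _ "[]"] exI[of _ "arm_list a t"] exI[of _ a]) simp
  show "length xs + length (arm_list a t) - nat (ints s c 0) \<le> n" using length_arm_list[OF a(1,2)] xs(2) by simp
  fix s' assume fr: "framed ?b s s'"
    and J: "?J s'"
  have tt: "ints s' ''tt'' 0 = int t" using a(4) names by (simp add: frame_ints[OF fr])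
  have "prepared s'" by (rule prepared_frame[OF P fr]) (use names in simp_all)
  then have R': "ready s'" by (simp add: prepared_def)
  from J obtain ys zs y where y: "arm_list a t = ys @ zs" "is_arm zs y t" "ints s' ''x'' 0 = int y"
    "stores s' arr (xs @ ys)" "ints s' c 0 = int (length (xs @ ys))" by (elim exE conjE) (rule that; assumption)
  {
    assume "bval ?g s'"
    then have "y \<noteq> t" using y(3) tt by auto
    then obtain zs' k where k: "zs = y # zs'" "k < m" "y = ch k" "is_arm zs' (pa k) t" using y(2) by (cases zs) auto
    have par: "ints s' ''par'' (int y) = int (pa k)" using readyD(11)[OF R' k(2)] k(3) by simp
    have e: "ints (effect ?b s') = (ints s')(arr := (ints s' arr)(int (length (xs @ ys)) := int y),
      c := (ints s' c)(0 := int (length (xs @ ys @ [y]))), ''x'' := (ints s' ''x'')(0 := int (pa k)))"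
      using y(3,5) par names nm by (simp add: Walk_body_def fun_eq_iff add.commute)
    have "stores (effect ?b s') arr ((xs @ ys) @ [y])"
      by (rule stores_snoc[OF y(4)]) (use names nm in \<open>simp add: e\<close>)
    then have st: "stores (effect ?b s') arr (xs @ (ys @ [y]))" by simp
    have x: "ints (effect ?b s') ''x'' 0 = int (pa k)" "ints (effect ?b s') c 0 = int (length (xs @ (ys @ [y])))"
      using names nm by (simp_all add: e)
    have arm: "arm_list a t = (ys @ [y]) @ zs'" using y(1) k(1) by simp
    show "tr ?b s' 50 (\<lambda>s''. (?J s'') \<and>
      length xs + length (arm_list a t) - nat (ints s'' c 0) < length xs + length (arm_list a t) - nat (ints s' c 0))"
    proof (rule tr_effect)
      show "(?J (effect ?b s')) \<and>
        length xs + length (arm_list a t) - nat (ints (effect ?b s') c 0) < length xs + length (arm_list a t) - nat (ints s' c 0)"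
      proof
        show "?J (effect ?b s')"
          by (intro exI conjI) (rule arm k(4) x st)+
        show "length xs + length (arm_list a t) - nat (ints (effect ?b s') c 0) < length xs + length (arm_list a t) - nat (ints s' c 0)"
          unfolding x(2) y(5) arm by simp
      qed
    qed (simp_all add: Walk_body_def)
  next
    assume "\<not> bval ?g s'"
    then have "y = t" using y(3) tt by auto
    then have "zs = []" using is_arm_unique[of zs t t "[]"] y(2) by simp
    then show "stores s' arr (xs @ arm_list a t) \<and> ints s' c 0 = int (length (xs @ arm_list a t))" using y by simp
  }
qed (use n_pos in simp_all)

lemma tr_Unstack:
  assumes "stores s ''tmp'' ys" "ints s ''L'' 0 = int (length ys)" "stores s ''path'' xs" "ints s ''pl'' 0 = int (length xs)" "length ys \<le> n"
  shows "tr Unstack s (100 * n) (\<lambda>s'. stores s' ''path'' (xs @ rev ys) \<and> ints s' ''pl'' 0 = int (length (xs @ rev ys)))"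
  unfolding Unstack_def
proof (rule tr_While'[where J = "\<lambda>s'. \<exists>l\<le>length ys. ints s' ''L'' 0 = int l \<and> stores s' ''path'' (xs @ rev (drop l ys)) \<and>
      ints s' ''pl'' 0 = int (length (xs @ rev (drop l ys)))"
      and \<mu> = "\<lambda>s'. nat (ints s' ''L'' 0)" and K = 50 and Y = n])
  let ?J = "\<lambda>s'. \<exists>l\<le>length ys. ints s' ''L'' 0 = int l \<and> stores s' ''path'' (xs @ rev (drop l ys)) \<and>
      ints s' ''pl'' 0 = int (length (xs @ rev (drop l ys)))"
  show "?J s"
    using assms by (intro exI[of _ "length ys"]) simp
  fix s' assume fr: "framed Unstack_body s s'" and J: "?J s'"
  from J obtain l where l: "l \<le> length ys" "ints s' ''L'' 0 = int l" "stores s' ''path'' (xs @ rev (drop l ys))"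
    "ints s' ''pl'' 0 = int (length (xs @ rev (drop l ys)))" by (elim exE conjE) (rule that; assumption)
  {
    assume "bval (ILess (Const 0) (Var ''L'')) s'"
    then obtain l' where l': "l = Suc l'" using l(2) by (cases l) auto
    have tmp: "ints s' ''tmp'' (int l') = int (ys ! l')"
      using assms(1) l(1) l' by (simp add: frame_ints[OF fr] stores_def)
    have d: "xs @ rev (drop l' ys) = (xs @ rev (drop l ys)) @ [ys ! l']"
      using l(1) l' by (simp add: Cons_nth_drop_Suc[symmetric])
    have e: "ints (effect Unstack_body s') = (ints s')(''L'' := (ints s' ''L'')(0 := int l'),
      ''path'' := (ints s' ''path'')(int (length (xs @ rev (drop l ys))) := int (ys ! l')),
      ''pl'' := (ints s' ''pl'')(0 := int (length (xs @ rev (drop l' ys)))))"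
      unfolding d using l(2,4) l' tmp by (simp add: Unstack_body_def add.commute)
    have st: "stores (effect Unstack_body s') ''path'' (xs @ rev (drop l' ys))"
      unfolding d by (rule stores_snoc[OF l(3)]) (simp add: e)
    show "tr Unstack_body s' 50 (\<lambda>s''. (?J s'') \<and> nat (ints s'' ''L'' 0) < nat (ints s' ''L'' 0))"
    proof (rule tr_effect)
      show "(?J (effect Unstack_body s')) \<and> nat (ints (effect Unstack_body s') ''L'' 0) < nat (ints s' ''L'' 0)"
        using st l(1,2) l' by (intro conjI exI[of _ l']) (simp_all add: e)
    qed (simp_all add: Unstack_body_def)
  next
    assume "\<not> bval (ILess (Const 0) (Var ''L'')) s'"
    then have "l = 0" using l(2) by simp
    then show "stores s' ''path'' (xs @ rev ys) \<and> ints s' ''pl'' 0 = int (length (xs @ rev ys))" using l by simp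
  }
qed (use assms n_pos in simp_all)

definition emitted :: "(nat \<times> nat \<times> nat \<Rightarrow> nat) \<Rightarrow> (nat \<times> nat \<times> nat) list \<Rightarrow> state \<Rightarrow> bool" where
  "emitted f ks s \<longleftrightarrow> stores s ''path'' (concat (map path_of ks)) \<and> ints s ''pl'' 0 = int (length (concat (map path_of ks))) \<and>
     stores s ''len'' (map (\<lambda>x. length (path_of x)) ks) \<and> stores s ''freq'' (map f ks) \<and> ints s ''nl'' 0 = int (length ks)"

lemma tr_Emit_path:
  assumes P: "prepared s" and E: "emitted f ks s" and v: "valid (a, b, t)"
    and ab: "ints s ''a'' 0 = int a" "ints s ''b'' 0 = int b" "ints s ''cnt'' (ints s ''ix'' 0) = int (f (a, b, t))" "ints s ''top'' (ints s ''ix'' 0) = int t"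
  shows "tr Emit_path s (500 * n) (emitted f (ks @ [(a, b, t)]))"
  unfolding Emit_path_def
proof (rule tr_step)
  let ?p = "concat (map path_of ks)"
  have at: "a < n" "b < n" "(a, t) \<in> R\<^sup>*" "(b, t) \<in> R\<^sup>*" using v by (simp_all add: valid_def)
  let ?s = "effect Emit_begin s"
  have f0: "framed Emit_begin s ?s" by (rule effect_frame) (simp add: Emit_begin_def)
  have P0: "prepared ?s" by (rule prepared_frame[OF P f0]) simp_all
  have e0: "stores s ''path'' ?p" "ints s ''pl'' 0 = int (length ?p)" "stores s ''len'' (map (\<lambda>x. length (path_of x)) ks)"
    "stores s ''freq'' (map f ks)" "ints s ''nl'' 0 = int (length ks)" using E by (simp_all add: emitted_def)
  have i0: "ints ?s = (ints s)(''freq'' := (ints s ''freq'')(int (length ks) := int (f (a, b, t))), ''tt'' := (ints s ''tt'')(0 := int t),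
    ''x'' := (ints s ''x'')(0 := int a), ''l0'' := (ints s ''l0'')(0 := int (length ?p)))"
    using ab e0 by (simp add: Emit_begin_def)
  have fq: "stores ?s ''freq'' (map f (ks @ [(a, b, t)]))" using stores_snoc[OF e0(4), of ?s "f (a, b, t)"] by (simp add: i0)
  have x0: "ints ?s ''x'' 0 = int a" "ints ?s ''tt'' 0 = int t" "stores ?s ''path'' ?p" "ints ?s ''pl'' 0 = int (length ?p)"
    using stores_cong[OF e0(1), of ?s] e0(2) by (simp_all add: i0)
  show "tr (Seq (Walk ''path'' ''pl'') (Seq Emit_mid (Seq (Walk ''tmp'' ''L'') (Seq Unstack Emit_end)))) ?s (450 * n) (emitted f (ks @ [(a, b, t)]))"
  proof (rule tr_SeqI[OF tr_Walk[OF P0 at(3,1) x0], where T' = "350 * n"])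
    let ?p1 = "?p @ arm_list a t"
    fix s1 assume s1: "stores s1 ''path'' ?p1 \<and> ints s1 ''pl'' 0 = int (length ?p1)" and f1: "framed (Walk ''path'' ''pl'') ?s s1"
    have P1: "prepared s1" by (rule prepared_frame[OF P0 f1]) simp_all
    have i1: "ints s1 ''tt'' 0 = int t" "ints s1 ''b'' 0 = int b" using ab by (simp_all add: frame_ints[OF f1] i0)
    show "tr (Seq Emit_mid (Seq (Walk ''tmp'' ''L'') (Seq Unstack Emit_end))) s1 (350 * n) (emitted f (ks @ [(a, b, t)]))"
    proof (rule tr_step)
      let ?s2 = "effect Emit_mid s1" and ?p2 = "?p1 @ [t]"
      have f2: "framed Emit_mid s1 ?s2" by (rule effect_frame) (simp add: Emit_mid_def)
      have P2: "prepared ?s2" by (rule prepared_frame[OF P1 f2]) simp_all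
      have e2: "ints ?s2 = (ints s1)(''path'' := (ints s1 ''path'')(int (length ?p1) := int t), ''pl'' := (ints s1 ''pl'')(0 := int (length ?p2)),
        ''x'' := (ints s1 ''x'')(0 := int b), ''L'' := (ints s1 ''L'')(0 := 0))"
        using s1 i1 by (simp add: Emit_mid_def add.commute)
      have pt2: "stores ?s2 ''path'' ?p2" by (rule stores_snoc[OF conjunct1[OF s1]]) (simp add: e2)
      have x2: "ints ?s2 ''x'' 0 = int b" "ints ?s2 ''tt'' 0 = int t" "stores ?s2 ''tmp'' []" "ints ?s2 ''L'' 0 = int (length ([] :: nat list))"
        using i1 by (simp_all add: e2 stores_def)
      show "tr (Seq (Walk ''tmp'' ''L'') (Seq Unstack Emit_end)) ?s2 (300 * n) (emitted f (ks @ [(a, b, t)]))"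
      proof (rule tr_SeqI[OF tr_Walk[OF P2 at(4,2) x2], where T' = "200 * n"])
        fix s3 assume s3: "stores s3 ''tmp'' ([] @ arm_list b t) \<and> ints s3 ''L'' 0 = int (length ([] @ arm_list b t))"
          and f3: "framed (Walk ''tmp'' ''L'') ?s2 s3"
        have pt3: "stores s3 ''path'' ?p2" "ints s3 ''pl'' 0 = int (length ?p2)"
          using stores_cong[OF pt2, of s3] by (simp_all add: frame_ints[OF f3] e2)
        have t3: "stores s3 ''tmp'' (arm_list b t)" "ints s3 ''L'' 0 = int (length (arm_list b t))" using s3 by simp_all
        show "tr (Seq Unstack Emit_end) s3 (200 * n) (emitted f (ks @ [(a, b, t)]))"
        proof (rule tr_SeqI[OF tr_Unstack[OF t3 pt3 length_arm_list[OF at(4,2)]], where T' = "50"])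
          let ?p3 = "?p2 @ rev (arm_list b t)"
          fix s4 assume s4: "stores s4 ''path'' ?p3 \<and> ints s4 ''pl'' 0 = int (length ?p3)" and f4: "framed Unstack s3 s4"
          have p3: "?p3 = concat (map path_of (ks @ [(a, b, t)]))" by (simp add: path_of_def)
          have i4: "ints s4 ''nl'' 0 = int (length ks)" "ints s4 ''l0'' 0 = int (length ?p)" "ints s4 ''len'' = ints s ''len''" "ints s4 ''freq'' = ints ?s ''freq''"
            using e0(5) by (simp_all add: frame_ints[OF f4] frame_ints[OF f3] e2 frame_ints[OF f1] i0)
          have pl: "int (length ?p3) - int (length ?p) = int (length (path_of (a, b, t)))" unfolding p3 by simp
          have e5: "ints (effect Emit_end s4) = (ints s4)(''len'' := (ints s ''len'')(int (length ks) := int (length (path_of (a, b, t)))),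
            ''nl'' := (ints s4 ''nl'')(0 := int (length (ks @ [(a, b, t)]))))"
            using i4 s4 unfolding pl[symmetric] by (simp add: Emit_end_def add.commute)
          have "stores (effect Emit_end s4) ''len'' (map (\<lambda>x. length (path_of x)) ks @ [length (path_of (a, b, t))])"
            by (rule stores_snoc[OF e0(3)]) (simp add: e5)
          moreover have "stores (effect Emit_end s4) ''freq'' (map f (ks @ [(a, b, t)]))"
            by (rule stores_cong[OF fq]) (simp add: e5 i4(4))
          moreover have "stores (effect Emit_end s4) ''path'' ?p3"
            by (rule stores_cong[OF conjunct1[OF s4]]) (simp add: e5)
          ultimately have "emitted f (ks @ [(a, b, t)]) (effect Emit_end s4)"
            unfolding emitted_def p3 using s4 unfolding p3 by (simp add: e5)
          then show "tr Emit_end s4 50 (emitted f (ks @ [(a, b, t)]))"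
            by (intro tr_effect) (simp_all add: Emit_end_def)
        qed (use n_pos in simp)
      qed simp_all
    qed (use n_pos in \<open>simp_all add: Emit_mid_def\<close>)
  qed simp_all
qed (use n_pos in \<open>simp_all add: Emit_begin_def\<close>)

lemma emitted_cong:
  assumes "emitted f ks s" "ints s' ''path'' = ints s ''path''" "ints s' ''pl'' = ints s ''pl''" "ints s' ''len'' = ints s ''len''"
    "ints s' ''freq'' = ints s ''freq''" "ints s' ''nl'' = ints s ''nl''"
  shows "emitted f ks s'"
  using assms by (simp add: emitted_def stores_def)

text \<open>The pairs of endpoints are scanned lexicographically, and each distinct triple is
  written once with its multiplicity as frequency.\<close>

definition emitted_upto :: "(nat \<times> nat \<times> nat) list \<Rightarrow> nat \<Rightarrow> nat \<Rightarrow> state \<Rightarrow> bool" where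
  "emitted_upto fin a b s \<longleftrightarrow> (\<exists>ks. emitted (count_list fin) ks s \<and> distinct ks \<and>
     set ks = {x \<in> set fin. fst x < a \<or> fst x = a \<and> fst (snd x) < b})"

lemma emitted_upto_cong:
  assumes "emitted_upto fin a b s" "ints s' ''path'' = ints s ''path''" "ints s' ''pl'' = ints s ''pl''" "ints s' ''len'' = ints s ''len''"
    "ints s' ''freq'' = ints s ''freq''" "ints s' ''nl'' = ints s ''nl''"
  shows "emitted_upto fin a b s'"
  using assms emitted_cong unfolding emitted_upto_def by blast

lemma tr_Emit_cell:
  assumes P: "prepared s" and fin: "finished fin s" and val: "\<forall>x\<in>set fin. valid x" and E: "emitted_upto fin a b s"
    and ab: "a < n" "b < n" "ints s ''a'' 0 = int a" "ints s ''b'' 0 = int b"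
  shows "tr Emit_cell s (600 * n) (emitted_upto fin a (Suc b))"
  unfolding Emit_cell_def
proof (rule tr_step)
  let ?w = "Set ''ix'' (IAdd (IRead ''rn'' (Var ''a'')) (Var ''b''))"
  let ?s = "effect ?w s"
  have f0: "frame {''ix''} {} s ?s" by (simp add: frame_def)
  have P0: "prepared ?s" by (rule prepared_frame[OF P f0]) simp_all
  have "ints s ''rn'' (int a) = jdx a 0" using P ab(1) by (simp add: prepared_def)
  then have ix: "ints s ''rn'' (ints s ''a'' 0) + ints s ''b'' 0 = jdx a b" "ints s ''rn'' (int a) + int b = jdx a b" using ab by simp_all
  then have i0: "ints ?s = (ints s)(''ix'' := (ints s ''ix'')(0 := jdx a b))" by simp
  obtain ks where ks: "emitted (count_list fin) ks s" "distinct ks" "set ks = {x \<in> set fin. fst x < a \<or> fst x = a \<and> fst (snd x) < b}"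
    using E unfolding emitted_upto_def by (elim exE conjE) (rule that; assumption)
  have E0: "emitted (count_list fin) ks ?s" by (rule emitted_cong[OF ks(1)]) (simp_all add: i0)
  have cnt: "ints s ''cnt'' (jdx a b) = int (length (filter (\<lambda>x. fst x = a \<and> fst (snd x) = b) fin))"
    and top: "\<And>t. (a, b, t) \<in> set fin \<Longrightarrow> ints s ''top'' (jdx a b) = int t"
    using fin ab(1,2) by (simp_all add: finished_def)
  show "tr (If (ILess (Const 0) (IRead ''cnt'' (Var ''ix''))) Emit_path Skip) ?s (550 * n) (emitted_upto fin a (Suc b))"
  proof (rule tr_If[where T = "500 * n"])
    assume "bval (ILess (Const 0) (IRead ''cnt'' (Var ''ix''))) ?s"
    then have "filter (\<lambda>x. fst x = a \<and> fst (snd x) = b) fin \<noteq> []" using cnt by (auto simp: ix)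
    then obtain x where "x \<in> set fin" "fst x = a" "fst (snd x) = b" by (auto simp: filter_empty_conv)
    then have t: "(a, b, snd (snd x)) \<in> set fin" (is "(a, b, ?t) \<in> _") by (metis prod.collapse)
    define t where "t = ?t"
    note t = t[folded t_def]
    then have v: "valid (a, b, t)" using val by simp
    \<comment> \<open>All finished paths with these endpoints are the same triple, so the cell count
      is the multiplicity of a single line.\<close>
    have uniq: "x = (a, b, t)" if "x \<in> set fin" "fst x = a" "fst (snd x) = b" for x
    proof -
      have "x = (a, b, snd (snd x))" using that(2,3) by (metis prod.collapse)
      moreover from this have "valid (a, b, snd (snd x))" using that(1) val by metis
      ultimately show ?thesis using valid_unique[OF v] by metis
    qed
    have "filter (\<lambda>x. fst x = a \<and> fst (snd x) = b) fin = filter ((=) (a, b, t)) fin"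
    proof (rule filter_cong[OF refl])
      fix x assume "x \<in> set fin"
      then show "(fst x = a \<and> fst (snd x) = b) = ((a, b, t) = x)" using uniq[of x] by (metis fst_conv snd_conv)
    qed
    then have "ints ?s ''cnt'' (ints ?s ''ix'' 0) = int (count_list fin (a, b, t))"
      using cnt by (simp add: ix count_list_eq_length_filter)
    then have "tr Emit_path ?s (500 * n) (emitted (count_list fin) (ks @ [(a, b, t)]))"
      using ab top[OF t] by (intro tr_Emit_path[OF P0 E0 v]) (simp_all add: ix)
    moreover have "distinct (ks @ [(a, b, t)])" using ks(2,3) by auto
    moreover have "set (ks @ [(a, b, t)]) = {x \<in> set fin. fst x < a \<or> fst x = a \<and> fst (snd x) < Suc b}"
    proof (rule set_eqI)
      fix x
      show "x \<in> set (ks @ [(a, b, t)]) \<longleftrightarrow> x \<in> {x \<in> set fin. fst x < a \<or> fst x = a \<and> fst (snd x) < Suc b}"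
      proof (cases "x = (a, b, t)")
        case True
        then show ?thesis using t by simp
      next
        case False
        then have "\<not> (x \<in> set fin \<and> fst x = a \<and> fst (snd x) = b)" using uniq by blast
        then show ?thesis using False ks(3) less_Suc_eq[of "fst (snd x)" b] by auto
      qed
    qed
    ultimately show "tr Emit_path ?s (500 * n) (emitted_upto fin a (Suc b))"
      unfolding emitted_upto_def by (elim tr_mono) blast+
  next
    assume "\<not> bval (ILess (Const 0) (IRead ''cnt'' (Var ''ix''))) ?s"
    then have "filter (\<lambda>x. fst x = a \<and> fst (snd x) = b) fin = []" using cnt by (simp add: ix)
    then have "\<not> (fst x = a \<and> fst (snd x) = b)" if "x \<in> set fin" for x
      using that by (simp add: filter_empty_conv)
    then have "set ks = {x \<in> set fin. fst x < a \<or> fst x = a \<and> fst (snd x) < Suc b}"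
      unfolding ks(3) by (auto simp: less_Suc_eq)
    then have "emitted_upto fin a (Suc b) ?s" unfolding emitted_upto_def using E0 ks(2) by blast
    then show "tr Skip ?s (500 * n) (emitted_upto fin a (Suc b))" using n_pos by (intro tr_effect) simp_all
  qed (use n_pos in simp)
qed (use n_pos in simp_all)

text \<open>There are \<open>n * n\<close> cells, and a line has up to \<open>n\<close> vertices to
  be written out: this is where the factor \<open>n ^ 3\<close> comes from.\<close>

lemma tr_Emit:
  assumes P: "prepared s" and fin: "finished fin s" and val: "\<forall>x\<in>set fin. valid x"
  shows "tr Emit s (1000 * (n * (n * n))) (\<lambda>s'. \<exists>ks. emitted (count_list fin) ks s' \<and> distinct ks \<and> set ks = set fin \<and>
    ints s' ''lines'' 0 = int (length ks))"
  unfolding Emit_def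
proof (rule tr_step)
  let ?in = "For ''b'' (Const 0) (Var ''n'') Emit_cell"
  let ?s = "effect (Seq (Set ''nl'' (Const 0)) (Set ''pl'' (Const 0))) s"
  have f0: "frame {''nl'', ''pl''} {} s ?s" by (simp add: frame_def)
  have P0: "prepared ?s" by (rule prepared_frame[OF P f0]) simp_all
  have F0: "finished fin ?s" by (rule finished_cong[OF fin]) simp_all
  have "1 * 1 \<le> n * (n * n)" by (intro mult_le_mono) (use n_pos in simp_all)
  then have n3: "1 \<le> n * (n * n)" by simp
  show "tr (Seq (For ''a'' (Const 0) (Var ''n'') ?in) (Set ''lines'' (Var ''nl''))) ?s (900 * (n * (n * n)))
    (\<lambda>s'. \<exists>ks. emitted (count_list fin) ks s' \<and> distinct ks \<and> set ks = set fin \<and> ints s' ''lines'' 0 = int (length ks))"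
  proof (rule tr_SeqI[where R = "emitted_upto fin n 0" and T = "800 * (n * (n * n))" and T' = 10])
    show "tr (For ''a'' (Const 0) (Var ''n'') ?in) ?s (800 * (n * (n * n))) (emitted_upto fin n 0)"
    proof (rule tr_For[where l = 0 and h = n and K = 700 and X = "n * n" and Y = n and J = "\<lambda>i. emitted_upto fin i 0"])
      have "emitted (count_list fin) [] (iupdate ?s ''a'' 0 (int 0))" by (simp add: emitted_def stores_def)
      then show "emitted_upto fin 0 0 (iupdate ?s ''a'' 0 (int 0))" unfolding emitted_upto_def by (intro exI[of _ "[]"]) auto
      fix i s' assume fr: "framed_loop ''a'' ?in ?s s'"
      have P': "prepared s'" by (rule prepared_frame[OF P0 fr]) simp_all
      then show "ival (Var ''n'') s' = int n" using readyD by (simp add: prepared_def)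
      have F': "finished fin s'" by (rule finished_cong[OF F0]) (simp_all add: frame_ints[OF fr])
      assume i: "i < n" "emitted_upto fin i 0 s'" "ints s' ''a'' 0 = int i"
      show "tr ?in s' (700 * (n * n)) (\<lambda>s''. emitted_upto fin (Suc i) 0 (iupdate s'' ''a'' 0 (int (Suc i))))"
      proof (rule tr_For[where l = 0 and h = n and K = 600 and X = n and Y = n and J = "\<lambda>j. emitted_upto fin i j"])
        show "emitted_upto fin i 0 (iupdate s' ''b'' 0 (int 0))" by (rule emitted_upto_cong[OF i(2)]) simp_all
        fix j s'' assume fr2: "framed_loop ''b'' Emit_cell s' s''"
        have P2: "prepared s''" by (rule prepared_frame[OF P' fr2]) simp_all
        then show "ival (Var ''n'') s'' = int n" using readyD by (simp add: prepared_def)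
        have F2: "finished fin s''" by (rule finished_cong[OF F']) (simp_all add: frame_ints[OF fr2])
        assume j: "j < n" "emitted_upto fin i j s''" "ints s'' ''b'' 0 = int j"
        have a: "ints s'' ''a'' 0 = int i" using i(3) by (simp add: frame_ints[OF fr2])
        show "tr Emit_cell s'' (600 * n) (\<lambda>s'''. emitted_upto fin i (Suc j) (iupdate s''' ''b'' 0 (int (Suc j))))"
          by (rule tr_mono[OF tr_Emit_cell[OF P2 F2 val j(2) i(1) j(1) a j(3)] order_refl]) (erule emitted_upto_cong; simp)
      next
        fix s'' assume E2: "emitted_upto fin i n s''"
        have "{x \<in> set fin. fst x < i \<or> fst x = i \<and> fst (snd x) < n} = {x \<in> set fin. fst x < Suc i \<or> fst x = Suc i \<and> fst (snd x) < 0}"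
          using val by (auto simp: valid_def)
        then have "emitted_upto fin (Suc i) 0 s''" using E2 unfolding emitted_upto_def by simp
        then show "emitted_upto fin (Suc i) 0 (iupdate s'' ''a'' 0 (int (Suc i)))" by (rule emitted_upto_cong) simp_all
      qed (use n_pos in simp_all)
    qed (use n_pos in simp_all)
  next
    fix s' assume "emitted_upto fin n 0 s'"
    moreover have "{x \<in> set fin. fst x < n \<or> fst x = n \<and> fst (snd x) < 0} = set fin" using val by (auto simp: valid_def)
    ultimately obtain ks where ks: "emitted (count_list fin) ks s'" "distinct ks" "set ks = set fin"
      unfolding emitted_upto_def by auto
    let ?t = "effect (Set ''lines'' (Var ''nl'')) s'"
    have "emitted (count_list fin) ks ?t" by (rule emitted_cong[OF ks(1)]) simp_all
    moreover have "ints ?t ''lines'' 0 = int (length ks)" using ks(1) by (simp add: emitted_def)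
    ultimately show "tr (Set ''lines'' (Var ''nl'')) s' 10 (\<lambda>s'. \<exists>ks. emitted (count_list fin) ks s' \<and> distinct ks \<and> set ks = set fin \<and>
      ints s' ''lines'' 0 = int (length ks))"
      using ks(2,3) by (intro tr_effect exI[of _ ks]) simp_all
  qed (use n3 in linarith)
  show "max_time (Seq (Set ''nl'' (Const 0)) (Set ''pl'' (Const 0))) + 900 * (n * (n * n)) \<le> 1000 * (n * (n * n))"
  proof -
    have "max_time (Seq (Set ''nl'' (Const 0)) (Set ''pl'' (Const 0))) \<le> 10" by simp
    with n3 show ?thesis by linarith
  qed
qed simp

end

section \<open>Assembling both programs and their time bounds\<close>

definition Concept :: com where
  "Concept = Seq Backtrack (Seq Fill (Seq (Rows ''rn'' ''n'') (Seq Forward Emit)))"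

definition Opt_concept :: com where
  "Opt_concept = Seq Min_cost (If (ILess (Const 0) (Var ''feasible'')) Concept Skip)"

lemma count_list_map_inj_on:
  "inj_on g (set xs) \<Longrightarrow> x \<in> set xs \<Longrightarrow> count_list (map g xs) (g x) = count_list xs x"
proof -
  assume g: "inj_on g (set xs)" "x \<in> set xs"
  have "count_list (map g ys) (g x) = count_list ys x" if "set ys \<subseteq> set xs" for ys
    using that by (induction ys) (use g in \<open>auto dest: inj_onD\<close>)
  then show ?thesis by blast
qed

text \<open>The cost \<open>c\<close> is recorded as well, because the value left by the first
  program is later certified through a concept of exactly this cost.\<close>

definition outputs_concept :: "nat lp_instance \<Rightarrow> real \<Rightarrow> state \<Rightarrow> bool" where
  "outputs_concept I c s \<longleftrightarrow> (\<exists>ps f. (\<forall>p\<in>set ps. simple_path I p) \<and> distinct (map path_line ps) \<and>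
     optimal I (set (map path_line ps)) f \<and> concept_cost I (set (map path_line ps)) f = c \<and>
     stores s ''lines'' [length ps] \<and> stores s ''freq'' (map (\<lambda>p. f (path_line p)) ps) \<and>
     stores s ''len'' (map length ps) \<and> stores s ''path'' (concat ps))"

context lp_trace
begin

lemma outputs_concept_of_emitted:
  assumes c: "config F m m 0 (paths m) fin op" "\<And>v. op v = []" "\<forall>x\<in>set fin. fst x \<le> fst (snd x)"
    and opt: "\<And>r. r \<le> B \<Longrightarrow> A m root (z m root) \<le> A m root r"
    and em: "emitted (count_list fin) ks s" "distinct ks" "set ks = set fin" "ints s ''lines'' 0 = int (length ks)"
  shows "outputs_concept I (A m root (z m root)) s"
proof -
  let ?g = "path_line \<circ> path_of"
  let ?f = "count_list (map ?g fin)"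
  have val: "\<And>x. x \<in> set fin \<Longrightarrow> valid x" using c(1) by (simp add: config_def)
  \<comment> \<open>Sorted endpoints prevent a line from appearing once in each direction. Distinct
    triples are therefore distinct lines, and multiplicities of triples are multiplicities of
    lines.\<close>
  have inj: "inj_on ?g (set fin)"
  proof (rule inj_onI)
    fix x y assume xy: "x \<in> set fin" "y \<in> set fin" "?g x = ?g y"
    obtain a b t a' b' t' where eq: "x = (a, b, t)" "y = (a', b', t')" by (metis prod_cases3)
    have "a \<le> b" "a' \<le> b'" using c(3) xy(1,2) unfolding eq by fastforce+
    then show "x = y" using path_line_of_inj[of a b t a' b' t'] val xy unfolding eq by simp
  qed
  note o = optimal_of_config[OF trace c(1)[unfolded paths_def] c(2) opt]
  have sets: "set (map path_line (map path_of ks)) = set (map ?g fin)" using em(3) by auto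
  have "(\<lambda>p. ?f (path_line p)) (path_of x) = count_list fin x" if "x \<in> set ks" for x
    using count_list_map_inj_on[OF inj, of x] that em(3) by simp
  then have freq: "map (\<lambda>p. ?f (path_line p)) (map path_of ks) = map (count_list fin) ks" by simp
  show ?thesis unfolding outputs_concept_def
  proof (intro exI[of _ "map path_of ks"] exI[of _ ?f] conjI)
    show "\<forall>p\<in>set (map path_of ks). simple_path I p"
      using val em(3) simple_path_of by auto
    have "inj_on ?g (set ks)" using inj em(3) by simp
    then show "distinct (map path_line (map path_of ks))" using em(2) by (simp add: distinct_map)
    show "optimal I (set (map path_line (map path_of ks))) ?f" unfolding sets by (rule o(1))
    show "concept_cost I (set (map path_line (map path_of ks))) ?f = A m root (z m root)" unfolding sets by (rule o(2))
    show "stores s ''lines'' [length (map path_of ks)]" using em(4) by (simp add: stores_def)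
    show "stores s ''freq'' (map (\<lambda>p. ?f (path_line p)) (map path_of ks))" unfolding freq using em(1) by (simp add: emitted_def)
    show "stores s ''len'' (map length (map path_of ks))" using em(1) by (simp add: emitted_def o_def)
    show "stores s ''path'' (concat (map path_of ks))" using em(1) by (simp add: emitted_def)
  qed
qed

lemma tr_Forward_Emit:
  assumes P: "prepared s" and S: "st 0 0 0 (paths 0) (lengths 0) s"
    and opt: "\<And>r. r \<le> B \<Longrightarrow> A m root (z m root) \<le> A m root r"
  shows "tr (Seq Forward Emit) s (5000 * (n * (n * n) * Suc B)) (outputs_concept I (A m root (z m root)))"
proof (rule tr_SeqI[OF tr_Forward[OF P S], where T' = "1000 * (n * (n * n))"])
  fix s1 assume S1: "st m m 0 (paths m) (\<lambda>_. 0) s1" and f1: "framed Forward s s1"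
  have P1: "prepared s1" by (rule prepared_frame[OF P f1]) simp_all
  obtain fin op where c: "config F m m 0 (paths m) fin op" "finished fin s1" "\<And>v. length (op v) = 0"
    by (rule stE[OF S1]) (rule that, assumption, assumption, assumption)
  have val: "\<forall>x\<in>set fin. valid x" using c(1) by (simp add: config_def)
  have le: "\<forall>x\<in>set fin. fst x \<le> fst (snd x)" using c(2) by (simp add: finished_def)
  have op: "op v = []" for v using c(3) by simp
  show "tr Emit s1 (1000 * (n * (n * n))) (outputs_concept I (A m root (z m root)))"
  proof (rule tr_mono[OF tr_Emit[OF P1 c(2) val] order_refl])
    fix s' assume "\<exists>ks. emitted (count_list fin) ks s' \<and> distinct ks \<and> set ks = set fin \<and> ints s' ''lines'' 0 = int (length ks)"
    then obtain ks where "emitted (count_list fin) ks s'" "distinct ks" "set ks = set fin" "ints s' ''lines'' 0 = int (length ks)"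
      by (elim exE conjE) (rule that; assumption)
    from outputs_concept_of_emitted[OF c(1) op le opt this] show "outputs_concept I (A m root (z m root)) s'" .
  qed
next
  have "n * 1 * Suc B \<le> n * (n * n) * Suc B" using n_pos by (intro mult_le_mono) simp_all
  moreover have "n * (n * n) * 1 \<le> n * (n * n) * Suc B" by (intro mult_le_mono) simp_all
  ultimately have "3000 * (n * Suc B) \<le> 3000 * (n * (n * n) * Suc B)" "1000 * (n * (n * n)) \<le> 1000 * (n * (n * n) * Suc B)"
    by (intro mult_le_mono2; simp)+
  then show "3000 * (n * Suc B) + 1000 * (n * (n * n)) \<le> 5000 * (n * (n * n) * Suc B)" by linarith
qed

end

context lp_run
begin

lemma tr_Concept:
  assumes sol: "solved r s" and zero: "ints s ''sz'' = (\<lambda>_. 0)" "ints s ''cnt'' = (\<lambda>_. 0)"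
  shows "tr Concept s (7000 * (n * (n * n) * Suc B)) (outputs_concept I (A m root r))"
  unfolding Concept_def
proof (rule tr_SeqI[OF tr_Backtrack[OF sol zero(1)], where T' = "6500 * (n * (n * n) * Suc B)"])
  let ?X = "n * (n * n) * Suc B"
  have "n * 1 * 1 \<le> ?X" using n_pos by (intro mult_le_mono) simp_all
  then have X1: "n \<le> ?X" by simp
  have X2: "n * Suc B \<le> ?X" using n_pos by (intro mult_le_mono) simp_all
  show "500 * n + 6500 * ?X \<le> 7000 * ?X" using mult_le_mono2[OF X1, of 500] by linarith
  fix s1 assume B1: "\<exists>z F i. trace z F i \<and> z m root = r \<and> holds_trace F i s1 \<and> (\<forall>v<n. ints s1 ''sz'' (int v) = int (z 0 v))"
    and f1: "framed Backtrack s s1"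
  have R: "ready s" and min: "\<And>r'. r' \<le> B \<Longrightarrow> A m root r \<le> A m root r'" using sol by (simp_all add: solved_def)
  have R1: "ready s1" by (rule ready_frame[OF R f1]) simp_all
  from B1 obtain z F i where tz: "trace z F i" "z m root = r" "holds_trace F i s1" "\<forall>v<n. ints s1 ''sz'' (int v) = int (z 0 v)"
    by (elim exE conjE) (rule that; assumption)
  interpret lp_trace I es n m root ch pa B ed z F i by unfold_locales (rule tz(1))
  have zB: "z k v \<le> B" for k v using tz(1) by (simp add: trace_def)
  show "tr (Seq Fill (Seq (Rows ''rn'' ''n'') (Seq Forward Emit))) s1 (6500 * ?X) (outputs_concept I (A m root r))"
  proof (rule tr_SeqI[OF tr_Fill[OF R1], where T' = "6000 * ?X"])
    show "200 * (n * Suc B) + 6000 * ?X \<le> 6500 * ?X" using mult_le_mono2[OF X2, of 200] by linarith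
    fix s2 assume F2: "\<forall>v<n. \<forall>r\<le>B. ints s2 ''stk'' (idx v r) = int v" and f2: "framed Fill s1 s2"
    have R2: "ready s2" by (rule ready_frame[OF R1 f2]) simp_all
    then have I2: "holds_input s2" by (simp add: ready_def)
    have n2: "ints s2 ''n'' 0 = int n" by (rule readyD(1)[OF R2])
    show "tr (Seq (Rows ''rn'' ''n'') (Seq Forward Emit)) s2 (6000 * ?X) (outputs_concept I (A m root r))"
    proof (rule tr_SeqI[OF tr_Rows[OF I2 n2], where T' = "5000 * ?X"])
      show "100 * n + 5000 * ?X \<le> 6000 * ?X" using mult_le_mono2[OF X1, of 100] by linarith
      fix s3 assume N3: "\<forall>i\<le>n. ints s3 ''rn'' (int i) = int (i * n)" and f3: "framed (Rows ''rn'' ''n'') s2 s3"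
      have R3: "ready s3" by (rule ready_frame[OF R2 f3]) simp_all
      have "holds_trace F i s3" using tz(3) by (simp add: holds_trace_def frame_ints[OF f3] frame_ints[OF f2])
      then have P3: "prepared s3" unfolding prepared_def using R3 N3 by (simp add: jdx_def)
      define op where "op v = (if v < n then replicate (z 0 v) v else [])" for v
      have "config F 0 0 0 (int (\<Sum>v<n. length (op v))) [] op"
        by (rule config_init) (auto simp: op_def)
      then have c0: "config F 0 0 0 (paths 0) [] op" by (simp add: paths_def op_def)
      have "r \<le> B" if "r < z 0 v" for r v using zB[of 0 v] that by simp
      then have "stacks op s3" unfolding stacks_def
        using tz(4) F2 by (auto simp: op_def frame_ints[OF f3] frame_ints[OF f2])
      moreover have "finished [] s3" using zero(2) by (simp add: finished_def frame_ints[OF f3] frame_ints[OF f2] frame_ints[OF f1])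
      moreover have "length (op v) = lengths 0 v" for v by (simp add: op_def lengths_def)
      ultimately have S3: "st 0 0 0 (paths 0) (lengths 0) s3" unfolding st_def using c0 by blast
      from tr_Forward_Emit[OF P3 S3] show "tr (Seq Forward Emit) s3 (5000 * ?X) (outputs_concept I (A m root r))"
        unfolding tz(2) using min by blast
    qed simp_all
  qed
qed

end

context lp_input
begin

lemma input_zero:
  assumes "a \<notin> {''n'', ''m'', ''u'', ''v'', ''fmin'', ''fmax''}"
  shows "ints (input_state I es) a = (\<lambda>_. 0)"
  using assms by (simp add: input_state_def fun_eq_iff)

text \<open>Tables have \<open>Suc B\<close> columns, and \<open>Suc B\<close> is at most twice
  \<open>max 1 b\<close>; cubing gives the factor 8. The maximum with 1 covers \<open>b = 0\<close>,
  where one column remains.\<close>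

lemma W_bound:
  assumes "B \<le> b"
  shows "Suc B * (Suc B * Suc B) \<le> 8 * (max 1 b) ^ 3"
proof -
  have "Suc B \<le> 2 * max 1 b" using assms by simp
  then have "Suc B * (Suc B * Suc B) \<le> (2 * max 1 b) * ((2 * max 1 b) * (2 * max 1 b))" by (intro mult_le_mono)
  then show ?thesis by (simp add: power3_eq_cube algebra_simps)
qed

lemma infeasible:
  assumes "e \<in> edges I" "fmax I e < 0"
  shows "\<not> feasible I L f"
proof
  assume "feasible I L f"
  then have "(\<Sum>l | l \<in> L \<and> e \<in> line_edges l. int (f l)) \<le> fmax I e" using assms(1) by (simp add: feasible_def)
  moreover have "0 \<le> (\<Sum>l | l \<in> L \<and> e \<in> line_edges l. int (f l))" by (rule sum_nonneg) simp
  ultimately show False using assms(2) by simp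
qed

text \<open>The two claims are proved together because the first depends on the second program: a
  minimum in the table is the optimal cost only once a concept attaining it has been
  constructed.\<close>

lemma tr_both:
  assumes b: "\<And>e. e \<in> edges I \<Longrightarrow> fmax I e \<le> int b"
  shows "tr Min_cost (input_state I es) (50000 * (n * max 1 b ^ 3)) (outputs_min_cost I)"
    and "tr Opt_concept (input_state I es) (200000 * (n ^ 3 * max 1 b ^ 3)) (outputs_optimal_concept I)"
proof -
  let ?s0 = "input_state I es"
  let ?f = "\<forall>e\<in>edges I. 0 \<le> fmax I e"
  define M where "M = max 1 b ^ 3"
  have M: "1 \<le> M" by (simp add: M_def)
  have nM: "n * 1 \<le> n * M" "1 * 1 \<le> n * M" by (rule mult_le_mono; use n_pos M in simp)+
  have "n * 1 \<le> n * (n * n)" using n_pos by (intro mult_le_mono) simp_all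
  then have nn: "n * M \<le> n ^ 3 * M" by (intro mult_le_mono) (simp_all add: power3_eq_cube)
  define Q where "Q s \<longleftrightarrow> ints s ''feasible'' 0 = (if ?f then 1 else 0) \<and>
    (if ?f then \<exists>root ch pa ed B r. B \<le> b \<and> lp_run I es n m root ch pa B ed \<and> lp_run.solved I es n m root ch pa B ed r s
     else \<not> (\<exists>L f. feasible I L f))" for s
  have 1: "tr Min_cost ?s0 (50000 * (n * M)) Q"
    unfolding Min_cost_def
  proof (rule tr_SeqI[OF tr_Check[OF holds_input_init b], where T' = "45000 * (n * M)"])
    show "200 * n + 45000 * (n * M) \<le> 50000 * (n * M)" using nM by linarith
    fix s1 assume s1: "ints s1 ''feasible'' 0 = (if ?f then 1 else 0) \<and> (\<exists>B\<le>b. ints s1 ''B'' 0 = int B \<and> (\<forall>e\<in>edges I. fmax I e \<le> int B))"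
      and f1: "framed Check ?s0 s1"
    show "tr (If (ILess (Const 0) (Var ''feasible'')) Solve Skip) s1 (45000 * (n * M)) Q"
    proof (rule tr_If[where T = "40000 * (n * M)"])
      show "1 + btime (ILess (Const 0) (Var ''feasible'')) + 40000 * (n * M) \<le> 45000 * (n * M)" using nM by simp
    next
      assume "\<not> bval (ILess (Const 0) (Var ''feasible'')) s1"
      then have nf: "\<not> ?f" using s1 by (simp split: if_splits)
      then have "\<not> (\<exists>L f. feasible I L f)" using infeasible by (meson not_le)
      then have "Q s1" using s1 nf by (simp add: Q_def)
      then show "tr Skip s1 (40000 * (n * M)) Q" using nM by (intro tr_effect) simp_all
    next
      assume "bval (ILess (Const 0) (Var ''feasible'')) s1"
      then have f: ?f using s1 by (simp split: if_splits)
      from s1 obtain B where B: "B \<le> b" "ints s1 ''B'' 0 = int B" "\<forall>e\<in>edges I. fmax I e \<le> int B" by blast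
      have I1: "holds_input s1" by (rule holds_input_frame[OF holds_input_init f1]) simp_all
      have z: "ints s1 ''deg'' = (\<lambda>_. 0)" "ints s1 ''sm'' = (\<lambda>_. 0)" by (simp_all add: frame_ints[OF f1] input_zero)
      have bnd: "0 \<le> fmax I e \<and> fmax I e \<le> int B" if "e \<in> edges I" for e using f B(3) that by blast
      have T: "5000 * (n * (Suc B * (Suc B * Suc B))) \<le> 40000 * (n * M)"
        using mult_le_mono2[OF W_bound[OF B(1)], of "5000 * n"] by (simp add: M_def)
      show "tr Solve s1 (40000 * (n * M)) Q"
      proof (rule tr_mono[OF tr_frame[OF tr_Solve[OF I1 B(2) z bnd]] T])
        fix s2 assume s2: "(\<exists>root ch pa ed r. lp_run I es n m root ch pa B ed \<and> lp_run.solved I es n m root ch pa B ed r s2) \<and>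
          framed Solve s1 s2"
        have "ints s2 ''feasible'' = ints s1 ''feasible''" by (rule frame_ints[OF conjunct2[OF s2]]) simp
        moreover have "\<exists>root ch pa ed B r. B \<le> b \<and> lp_run I es n m root ch pa B ed \<and> lp_run.solved I es n m root ch pa B ed r s2"
          using conjunct1[OF s2] B(1) by blast
        ultimately show "Q s2" unfolding Q_def using s1 f by simp
      qed
    qed
  qed
  define out where "out s \<longleftrightarrow> (if ?f then \<exists>c. outputs_concept I c s else \<not> (\<exists>L f. feasible I L f))" for s
  let ?Q = "\<lambda>s s'. out s' \<and> ints s' ''feasible'' 0 = ints s ''feasible'' 0 \<and> (?f \<longrightarrow> outputs_concept I (reals s ''cost'' 0) s')"
  have 2: "tr (If (ILess (Const 0) (Var ''feasible'')) Concept Skip) s (100000 * (n ^ 3 * M)) (?Q s)"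
    if Qs: "Q s" and fr: "framed Min_cost ?s0 s" for s
  proof (rule tr_If[where T = "60000 * (n ^ 3 * M)"])
    have "1 * 1 \<le> n ^ 3 * M" by (rule mult_le_mono) (use n_pos M in simp_all)
    then have p: "1 \<le> n ^ 3 * M" by simp
    then show "1 + btime (ILess (Const 0) (Var ''feasible'')) + 60000 * (n ^ 3 * M) \<le> 100000 * (n ^ 3 * M)" by simp
    {
      assume "\<not> bval (ILess (Const 0) (Var ''feasible'')) s"
      then have nf: "\<not> ?f" using Qs unfolding Q_def by (auto split: if_splits)
      then show "tr Skip s (60000 * (n ^ 3 * M)) (?Q s)"
        using Qs p nf by (intro tr_effect) (auto simp: Q_def out_def)
    next
      assume "bval (ILess (Const 0) (Var ''feasible'')) s"
      then have f: ?f using Qs unfolding Q_def by (auto split: if_splits)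
      then have "\<exists>root ch pa ed B r. B \<le> b \<and> lp_run I es n m root ch pa B ed \<and> lp_run.solved I es n m root ch pa B ed r s"
        using Qs unfolding Q_def by simp
      then obtain root ch pa ed B r where B: "B \<le> b" and run: "lp_run I es n m root ch pa B ed"
        and sol: "lp_run.solved I es n m root ch pa B ed r s" by (elim exE conjE) (rule that; assumption)
      interpret lp_run I es n m root ch pa B ed by (rule run)
      have z: "ints s ''sz'' = (\<lambda>_. 0)" "ints s ''cnt'' = (\<lambda>_. 0)"
        by (simp_all add: frame_ints[OF fr] Min_cost_def input_zero)
      have c: "reals s ''cost'' 0 = A m root r" using sol by (simp add: solved_def)
      have "Suc B * (1 * 1) \<le> Suc B * (Suc B * Suc B)" by (intro mult_le_mono) simp_all
      also have "\<dots> \<le> 8 * M" using W_bound[OF B] by (simp add: M_def)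
      finally have "7000 * (n * (n * n)) * Suc B \<le> 7000 * (n * (n * n)) * (8 * M)" by (intro mult_le_mono2) simp
      then have T: "7000 * (n * (n * n) * Suc B) \<le> 60000 * (n ^ 3 * M)" by (simp add: power3_eq_cube mult.assoc)
      show "tr Concept s (60000 * (n ^ 3 * M)) (?Q s)"
      proof (rule tr_mono[OF tr_frame[OF tr_Concept[OF sol z]] T])
        fix s' assume s': "outputs_concept I (A m root r) s' \<and> framed Concept s s'"
        have "ints s' ''feasible'' = ints s ''feasible''" by (rule frame_ints[OF conjunct2[OF s']]) (simp add: Concept_def)
        then show "out s' \<and> ints s' ''feasible'' 0 = ints s ''feasible'' 0 \<and> (?f \<longrightarrow> outputs_concept I (reals s ''cost'' 0) s')"
          using s' f unfolding c out_def by auto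
      qed
    }
  qed
  \<comment> \<open>An output concept witnesses feasibility, and a negative upper bound refutes it,
    so the sign test decides feasibility exactly.\<close>
  have feas: "?f \<longleftrightarrow> (\<exists>L f. feasible I L f)" if "outputs_concept I c s \<or> \<not> ?f" for c s
    using that infeasible unfolding outputs_concept_def optimal_def by (meson not_le)
  show "tr Min_cost ?s0 (50000 * (n * max 1 b ^ 3)) (outputs_min_cost I)"
    unfolding M_def[symmetric]
  proof (rule tr_mono[OF tr_frame[OF 1] order_refl])
    fix s assume s: "Q s \<and> framed Min_cost ?s0 s"
    \<comment> \<open>The continuation into the second program serves here only as an existence
      proof: its final state supplies an optimal concept whose cost is the value already computed,
      and its running time does not enter the first bound.\<close>
    from 2[OF conjunct1[OF s] conjunct2[OF s]] obtain s' where s': "out s'" "?f \<longrightarrow> outputs_concept I (reals s ''cost'' 0) s'"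
      unfolding tr_def by blast
    then have eq: "?f \<longleftrightarrow> (\<exists>L f. feasible I L f)" using feas by blast
    have "reports_feasibility I s" using s unfolding Q_def reports_feasibility_def eq by simp
    moreover have "\<exists>L f. optimal I L f \<and> reals s ''cost'' 0 = concept_cost I L f" if ?f
      using s'(2) that unfolding outputs_concept_def by metis
    ultimately show "outputs_min_cost I s" unfolding outputs_min_cost_def using eq by blast
  qed
  show "tr Opt_concept ?s0 (200000 * (n ^ 3 * max 1 b ^ 3)) (outputs_optimal_concept I)"
    unfolding M_def[symmetric] Opt_concept_def
  proof (rule tr_SeqI[OF 1, where T' = "100000 * (n ^ 3 * M)"])
    show "50000 * (n * M) + 100000 * (n ^ 3 * M) \<le> 200000 * (n ^ 3 * M)" using mult_le_mono2[OF nn, of 50000] by linarith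
    fix s assume s: "Q s" "framed Min_cost ?s0 s"
    show "tr (If (ILess (Const 0) (Var ''feasible'')) Concept Skip) s (100000 * (n ^ 3 * M)) (outputs_optimal_concept I)"
    proof (rule tr_mono[OF 2[OF s] order_refl])
      fix s' assume s': "out s' \<and> ints s' ''feasible'' 0 = ints s ''feasible'' 0 \<and> (?f \<longrightarrow> outputs_concept I (reals s ''cost'' 0) s')"
      then have eq: "?f \<longleftrightarrow> (\<exists>L f. feasible I L f)" using feas by blast
      have "reports_feasibility I s'" using s(1) s' unfolding Q_def reports_feasibility_def eq by simp
      then show "outputs_optimal_concept I s'"
        using s' unfolding outputs_optimal_concept_def eq outputs_concept_def by blast
    qed
  qed
qed

end

theorem theorem11:
  shows "(\<exists>(P :: com) (C :: nat). \<forall>(b :: nat) (I :: nat lp_instance) (es :: (nat \<times> nat) list).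
            lp_instance_wf I \<and> tree I \<and> edge_list I es \<and> dfix I = 0 \<and>
            (\<forall>e\<in>edges I. fmax I e \<le> int b) \<longrightarrow>
            solves_within P outputs_min_cost I es (C * (card (verts I) * (max 1 b) ^ 3)))
       \<and> (\<exists>(P :: com) (C :: nat). \<forall>(b :: nat) (I :: nat lp_instance) (es :: (nat \<times> nat) list).
            lp_instance_wf I \<and> tree I \<and> edge_list I es \<and> dfix I = 0 \<and>
            (\<forall>e\<in>edges I. fmax I e \<le> int b) \<longrightarrow>
            solves_within P outputs_optimal_concept I es (C * (card (verts I) ^ 3 * (max 1 b) ^ 3)))"
proof -
  have "solves_within Min_cost outputs_min_cost I es (50000 * (card (verts I) * (max 1 b) ^ 3)) \<and>
    solves_within Opt_concept outputs_optimal_concept I es (200000 * (card (verts I) ^ 3 * (max 1 b) ^ 3))"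
    if "lp_instance_wf I \<and> tree I \<and> edge_list I es \<and> dfix I = 0 \<and> (\<forall>e\<in>edges I. fmax I e \<le> int b)"
    for b :: nat and I :: "nat lp_instance" and es :: "(nat \<times> nat) list"
  proof -
    interpret lp_input I es "card (verts I)" "length es" by unfold_locales (use that in simp_all)
    show ?thesis using tr_both[of b] that unfolding solves_within_def tr_def by blast
  qed
  then show ?thesis by blast
qed

end
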